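(* Algorithm $\mathcal{A}$ (described in the context) run with the neighboring function $\mathrm{neighbors}(B)=\bigcup_{v\in V(G)}\mathrm{neighbors}(B,v)$, where for $v\notin B$ $$\mathrm{neighbors}(B,v)=\{\mathrm{comp}(\{v\}\cup(B_i\setminus N(v))\cup B_{1-i})\;:\;i=0,1\}$$ and $\mathrm{neighbors}(B,v)=\{B\}$ for $v\in B$, outputs all maximal induced bipartite subgraphs of $G$ without duplication, with $O(n(m+n\alpha(n)))$ delay.
   Context: $G$ is a simple undirected graph with vertices labeled $v_1,\dots,v_n$ and $m$ edges; isolated vertices are disregarded in the complexity analysis; $\alpha(\cdot)$ is the inverse Ackermann function. A maximal induced bipartite subgraph is an inclusion-maximal $B\subseteq V(G)$ with $G[B]$ bipartite; it is written $\langle B_0,B_1\rangle$ with $B_0\cap B_1=\emptyset$, $B_0\cup B_1=B$, $G[B_0],G[B_1]$ edgeless, and in each connected component of $G[B]$ the vertex of smallest label lies in $B_0$. $N(v)$ is the neighborhood of $v$. $\mathrm{comp}(A)$, for $A$ inducing a bipartite subgraph, returns a maximal induced bipartite subgraph containing $A$, obtained by repeatedly adding a vertex whose addition keeps the subgraph bipartite, until impossible. Algorithm $\mathcal{A}$: compute an arbitrary maximal solution $S_0$ and call $\mathrm{enum}(S_0)$ with an initially empty global set $\mathcal{S}$; $\mathrm{enum}(S)$ adds $S$ to $\mathcal{S}$, and for each $S'\in\mathrm{neighbors}(S)$ with $S'\notin\mathcal{S}$ calls $\mathrm{enum}(S')$; $S$ is output before the loop if the recursion depth is even and after the loop if it is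 odd. Delay is the maximum time before the first output, between consecutive outputs, and after the last output. *)

theory Defs
  imports Main
begin

text \<open>The vertex labelled \<open>v\<^sub>i\<close> is the number \<open>i\<close>; edges are two-element sets of vertices.\<close>

definition verts :: "nat \<Rightarrow> nat set" where
  "verts n = {1..n}"

definition simple_graph :: "nat \<Rightarrow> nat set set \<Rightarrow> bool" where
  "simple_graph n E \<longleftrightarrow> (\<forall>e\<in>E. \<exists>u\<in>verts n. \<exists>v\<in>verts n. u \<noteq> v \<and> e = {u, v})"

definition nbhd :: "nat set set \<Rightarrow> nat \<Rightarrow> nat set" where
  "nbhd E v = {u. {u, v} \<in> E}"

definition edgeless :: "nat set set \<Rightarrow> nat set \<Rightarrow> bool" where
  "edgeless E X \<longleftrightarrow> (\<forall>u\<in>X. \<forall>v\<in>X. {u, v} \<notin> E)"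

definition bipartition :: "nat set set \<Rightarrow> nat set \<Rightarrow> nat set \<Rightarrow> nat set \<Rightarrow> bool" where
  "bipartition E B X Y \<longleftrightarrow> X \<inter> Y = {} \<and> X \<union> Y = B \<and> edgeless E X \<and> edgeless E Y"

definition bipartite :: "nat set set \<Rightarrow> nat set \<Rightarrow> bool" where
  "bipartite E B \<longleftrightarrow> (\<exists>X Y. bipartition E B X Y)"

definition max_bip :: "nat \<Rightarrow> nat set set \<Rightarrow> nat set \<Rightarrow> bool" where
  "max_bip n E B \<longleftrightarrow> B \<subseteq> verts n \<and> bipartite E B \<and>
     (\<forall>C. B \<subset> C \<and> C \<subseteq> verts n \<longrightarrow> \<not> bipartite E C)"

text \<open>\<open>(u, v) \<in> conn E B\<close>, for \<open>u\<close> and \<open>v\<close> in \<open>B\<close>: both lie in the same connected component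
  of \<open>G[B]\<close>.\<close>

definition conn :: "nat set set \<Rightarrow> nat set \<Rightarrow> (nat \<times> nat) set" where
  "conn E B = {(u, v). u \<in> B \<and> v \<in> B \<and> {u, v} \<in> E}\<^sup>*"

definition canonical_bipartition :: "nat set set \<Rightarrow> nat set \<Rightarrow> nat set \<Rightarrow> nat set \<Rightarrow> bool" where
  "canonical_bipartition E B B0 B1 \<longleftrightarrow> bipartition E B B0 B1 \<and>
     (\<forall>v\<in>B. (\<forall>u\<in>B. (u, v) \<in> conn E B \<longrightarrow> v \<le> u) \<longrightarrow> v \<in> B0)"

definition side :: "nat set set \<Rightarrow> nat set \<Rightarrow> nat \<Rightarrow> nat set" where
  "side E B i = (let (B0, B1) = (THE (X, Y). canonical_bipartition E B X Y)
                 in if i = 0 then B0 else B1)"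

lemma conn_sym:
  assumes "(u, v) \<in> conn E B"
  shows "(v, u) \<in> conn E B"
proof -
  have "sym {(u, v). u \<in> B \<and> v \<in> B \<and> {u, v} \<in> E}"
    by (rule symI) (simp add: insert_commute)
  then have "sym (conn E B)" unfolding conn_def by (rule sym_rtrancl)
  then show ?thesis using assms by (rule symD)
qed

lemma conn_trans: "(u, v) \<in> conn E B \<Longrightarrow> (v, w) \<in> conn E B \<Longrightarrow> (u, w) \<in> conn E B"
  unfolding conn_def by (rule rtrancl_trans)

lemma bipartition_edge:
  assumes "bipartition E B X Y" "u \<in> B" "v \<in> B" "{u, v} \<in> E"
  shows "u \<in> X \<longleftrightarrow> v \<notin> X"
  using assms unfolding bipartition_def edgeless_def by blast

lemma canonical_unique:
  assumes c: "canonical_bipartition E B X Y" and c': "canonical_bipartition E B X' Y'"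
  shows "X = X' \<and> Y = Y'"
proof -
  have bp: "bipartition E B X Y" "bipartition E B X' Y'"
    using c c' by (auto simp: canonical_bipartition_def)
  have inv: "(u \<in> X \<longleftrightarrow> u \<in> X') \<longleftrightarrow> (v \<in> X \<longleftrightarrow> v \<in> X')" if "(u, v) \<in> conn E B" for u v
    using that unfolding conn_def
  proof (induction rule: rtrancl_induct)
    case (step y z)
    then show ?case using bipartition_edge[OF bp(1), of y z] bipartition_edge[OF bp(2), of y z] by auto
  qed simp
  have "v \<in> X \<longleftrightarrow> v \<in> X'" if v: "v \<in> B" for v
  proof -
    let ?P = "\<lambda>u. u \<in> B \<and> (u, v) \<in> conn E B"
    define r where "r = (LEAST u. ?P u)"
    have "?P v" using v by (simp add: conn_def)
    then have r: "?P r" unfolding r_def by (rule LeastI)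
    have "r \<le> u" if "u \<in> B" "(u, r) \<in> conn E B" for u
      unfolding r_def using that r by (intro Least_le) (blast intro: conn_trans)
    then have "r \<in> X" "r \<in> X'"
      using c c' r unfolding canonical_bipartition_def by blast+
    then show ?thesis using inv r by blast
  qed
  then show ?thesis using bp unfolding bipartition_def by blast
qed

lemma canonical_exists:
  assumes "bipartite E B"
  shows "\<exists>B0 B1. canonical_bipartition E B B0 B1"
proof -
  obtain X Y where bp: "bipartition E B X Y" using assms by (auto simp: bipartite_def)
  define r where "r v = (LEAST u. u \<in> B \<and> (u, v) \<in> conn E B)" for v
  define B0 where "B0 = {v \<in> B. v \<in> X \<longleftrightarrow> r v \<in> X}"
  have r_eq: "r u = r v" if "u \<in> B" "v \<in> B" "{u, v} \<in> E" for u v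
  proof -
    have "(u, v) \<in> conn E B" using that by (auto simp: conn_def)
    then have "(w, u) \<in> conn E B \<longleftrightarrow> (w, v) \<in> conn E B" for w
      using conn_trans conn_sym by metis
    then show ?thesis by (simp add: r_def)
  qed
  have "r v = v" if "v \<in> B" "\<forall>u\<in>B. (u, v) \<in> conn E B \<longrightarrow> v \<le> u" for v
    unfolding r_def using that by (intro Least_equality) (auto simp: conn_def)
  moreover have "bipartition E B B0 (B - B0)"
  proof -
    have "\<not> ((u \<in> B0) = (v \<in> B0))" if "u \<in> B" "v \<in> B" "{u, v} \<in> E" for u v
      using bipartition_edge[OF bp that] r_eq[OF that] that by (simp add: B0_def) metis
    moreover have "B0 \<subseteq> B" by (auto simp: B0_def)
    ultimately show ?thesis unfolding bipartition_def edgeless_def by blast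
  qed
  ultimately have "canonical_bipartition E B B0 (B - B0)"
    unfolding canonical_bipartition_def by (simp add: B0_def)
  then show ?thesis by blast
qed

text \<open>\<open>side E B 0\<close> and \<open>side E B 1\<close> are the classes \<open>B\<^sub>0\<close> and \<open>B\<^sub>1\<close> of the solution \<open>B\<close>.\<close>

lemma side_eq:
  assumes "canonical_bipartition E B B0 B1"
  shows "side E B 0 = B0" "side E B 1 = B1"
proof -
  have "(THE (X, Y). canonical_bipartition E B X Y) = (B0, B1)"
  proof (rule the_equality)
    show "case (B0, B1) of (X, Y) \<Rightarrow> canonical_bipartition E B X Y" using assms by simp
  next
    fix p assume "case p of (X, Y) \<Rightarrow> canonical_bipartition E B X Y"
    then show "p = (B0, B1)" using canonical_unique[OF _ assms] by (cases p) simp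
  qed
  then show "side E B 0 = B0" "side E B 1 = B1" by (simp_all add: side_def)
qed

definition grow :: "nat \<Rightarrow> nat set set \<Rightarrow> (nat set \<times> nat set) set" where
  "grow n E = {(A, insert v A) | A v. v \<in> verts n \<and> v \<notin> A \<and> bipartite E (insert v A)}"

text \<open>The completion procedure leaves the choice of the added vertices open, so it is any function
  with the following property.\<close>

definition is_comp :: "nat \<Rightarrow> nat set set \<Rightarrow> (nat set \<Rightarrow> nat set) \<Rightarrow> bool" where
  "is_comp n E cmp \<longleftrightarrow> (\<forall>A. A \<subseteq> verts n \<and> bipartite E A \<longrightarrow>
     (A, cmp A) \<in> (grow n E)\<^sup>* \<and> cmp A \<notin> Domain (grow n E))"

definition neighbors_at ::
  "nat set set \<Rightarrow> (nat set \<Rightarrow> nat set) \<Rightarrow> nat set \<Rightarrow> nat \<Rightarrow> nat set set" where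
  "neighbors_at E cmp B v =
     (if v \<in> B then {B}
      else {cmp ({v} \<union> (side E B i - nbhd E v) \<union> side E B (1 - i)) | i. i \<in> {0, 1}})"

definition neighbors ::
  "nat \<Rightarrow> nat set set \<Rightarrow> (nat set \<Rightarrow> nat set) \<Rightarrow> nat set \<Rightarrow> nat set set" where
  "neighbors n E cmp B = (\<Union>v\<in>verts n. neighbors_at E cmp B v)"

text \<open>The order in which the loop runs through \<open>neighbors(S)\<close> is arbitrary: it is given by a list
  of the elements of that set. A repeated list element has no effect, since it is in \<open>\<S>\<close> when it
  is met again.\<close>

definition is_order ::
  "nat \<Rightarrow> nat set set \<Rightarrow> (nat set \<Rightarrow> nat set) \<Rightarrow> (nat set \<Rightarrow> nat set list) \<Rightarrow> bool" where
  "is_order n E cmp ord \<longleftrightarrow> (\<forall>B. max_bip n E B \<longrightarrow> set (ord B) = neighbors n E cmp B)"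

text \<open>\<open>enum ord d S \<S> out \<S>'\<close>: the call of \<open>enum(S)\<close> at recursion depth \<open>d\<close>, with \<open>\<S>\<close> the value
  of the global set, terminates with output sequence \<open>out\<close> and leaves the global set as \<open>\<S>'\<close>.
  \<open>loop\<close> describes the remaining iterations of the loop of a call at depth \<open>d\<close>.\<close>

inductive enum :: "(nat set \<Rightarrow> nat set list) \<Rightarrow> nat \<Rightarrow> nat set \<Rightarrow> nat set set \<Rightarrow>
    nat set list \<Rightarrow> nat set set \<Rightarrow> bool"
  and loop :: "(nat set \<Rightarrow> nat set list) \<Rightarrow> nat \<Rightarrow> nat set list \<Rightarrow> nat set set \<Rightarrow>
    nat set list \<Rightarrow> nat set set \<Rightarrow> bool"
  for ord :: "nat set \<Rightarrow> nat set list" where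
  enum: "loop ord d (ord S) (insert S \<S>) out \<S>' \<Longrightarrow>
    enum ord d S \<S> (if even d then S # out else out @ [S]) \<S>'"
| loop_done: "loop ord d [] \<S> [] \<S>"
| loop_skip: "S' \<in> \<S> \<Longrightarrow> loop ord d Ss \<S> out \<S>' \<Longrightarrow> loop ord d (S' # Ss) \<S> out \<S>'"
| loop_call: "S' \<notin> \<S> \<Longrightarrow> enum ord (Suc d) S' \<S> out1 \<S>1 \<Longrightarrow> loop ord d Ss \<S>1 out2 \<S>2 \<Longrightarrow>
    loop ord d (S' # Ss) \<S> (out1 @ out2) \<S>2"

definition alg_outputs :: "(nat set \<Rightarrow> nat set list) \<Rightarrow> nat set \<Rightarrow> nat set list \<Rightarrow> bool" where
  "alg_outputs ord S0 out \<longleftrightarrow> (\<exists>\<S>. enum ord 0 S0 {} out \<S>)"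

text \<open>A random access machine with uniform cost and arithmetic limited to addition and truncated
  subtraction. Programs are structured; their memory consists of registers and of arrays, both
  addressed by constants in the program text, so a given program uses only finitely many of either.
  Arrays are unbounded and indexed by computed values. Evaluating an expression costs one unit per
  node, and every command costs one more unit.\<close>

datatype aexp = N nat | R nat | Arr nat aexp | Plus aexp aexp | Minus aexp aexp

datatype bexp = Less aexp aexp | Eq aexp aexp | Not bexp | And bexp bexp

datatype com =
    Skip
  | Assign nat aexp
  | Store nat aexp aexp
  | Print aexp
  | End_Solution
  | Seq com com
  | If bexp com com
  | While bexp com

record state =
  reg :: "nat \<Rightarrow> nat"
  arr :: "nat \<Rightarrow> nat \<Rightarrow> nat"

fun aval :: "aexp \<Rightarrow> state \<Rightarrow> nat" where
  "aval (N k) s = k"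
| "aval (R x) s = reg s x"
| "aval (Arr a e) s = arr s a (aval e s)"
| "aval (Plus e f) s = aval e s + aval f s"
| "aval (Minus e f) s = aval e s - aval f s"

fun acost :: "aexp \<Rightarrow> nat" where
  "acost (N k) = 1"
| "acost (R x) = 1"
| "acost (Arr a e) = 1 + acost e"
| "acost (Plus e f) = 1 + acost e + acost f"
| "acost (Minus e f) = 1 + acost e + acost f"

fun bval :: "bexp \<Rightarrow> state \<Rightarrow> bool" where
  "bval (Less e f) s \<longleftrightarrow> aval e s < aval f s"
| "bval (Eq e f) s \<longleftrightarrow> aval e s = aval f s"
| "bval (Not b) s \<longleftrightarrow> \<not> bval b s"
| "bval (And b c) s \<longleftrightarrow> bval b s \<and> bval c s"

fun bcost :: "bexp \<Rightarrow> nat" where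
  "bcost (Less e f) = 1 + acost e + acost f"
| "bcost (Eq e f) = 1 + acost e + acost f"
| "bcost (Not b) = 1 + bcost b"
| "bcost (And b c) = 1 + bcost b + bcost c"

datatype event = Tick | Printed nat | Solution_End

abbreviation ticks :: "nat \<Rightarrow> event list" where
  "ticks k \<equiv> replicate k Tick"

text \<open>\<open>exec c s tr t\<close>: started in \<open>s\<close>, the program \<open>c\<close> terminates in \<open>t\<close>; the trace \<open>tr\<close> records
  its elementary steps and its writes to the output tape, in order.\<close>

inductive exec :: "com \<Rightarrow> state \<Rightarrow> event list \<Rightarrow> state \<Rightarrow> bool" where
  Skip: "exec Skip s (ticks 1) s"
| Assign: "exec (Assign x e) s (ticks (1 + acost e)) (s\<lparr>reg := (reg s)(x := aval e s)\<rparr>)"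
| Store: "exec (Store a e f) s (ticks (1 + acost e + acost f))
    (s\<lparr>arr := (arr s)(a := (arr s a)(aval e s := aval f s))\<rparr>)"
| Print: "exec (Print e) s (ticks (1 + acost e) @ [Printed (aval e s)]) s"
| End_Solution: "exec End_Solution s (ticks 1 @ [Solution_End]) s"
| Seq: "exec c s tr1 s' \<Longrightarrow> exec d s' tr2 t \<Longrightarrow> exec (Seq c d) s (ticks 1 @ tr1 @ tr2) t"
| IfTrue: "bval b s \<Longrightarrow> exec c s tr t \<Longrightarrow> exec (If b c d) s (ticks (1 + bcost b) @ tr) t"
| IfFalse: "\<not> bval b s \<Longrightarrow> exec d s tr t \<Longrightarrow> exec (If b c d) s (ticks (1 + bcost b) @ tr) t"
| WhileFalse: "\<not> bval b s \<Longrightarrow> exec (While b c) s (ticks (1 + bcost b)) s"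
| WhileTrue: "bval b s \<Longrightarrow> exec c s tr1 s' \<Longrightarrow> exec (While b c) s' tr2 t \<Longrightarrow>
    exec (While b c) s (ticks (1 + bcost b) @ tr1 @ tr2) t"

lemma exec_deterministic:
  "exec c s tr t \<Longrightarrow> exec c s tr' t' \<Longrightarrow> tr' = tr \<and> t' = t"
proof (induction arbitrary: tr' t' rule: exec.induct)
  case (Seq c s tr1 s' d tr2 t)
  from Seq.prems obtain u1 u u2 where "exec c s u1 u" "exec d u u2 t'" "tr' = ticks 1 @ u1 @ u2"
    by cases blast
  then show ?case using Seq.IH by metis
next
  case (IfTrue b s c tr t d)
  from IfTrue.prems(1) IfTrue.hyps(1) obtain u where "exec c s u t'" "tr' = ticks (1 + bcost b) @ u"
    by cases auto
  then show ?case using IfTrue.IH by metis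
next
  case (IfFalse b s d tr t c)
  from IfFalse.prems(1) IfFalse.hyps(1) obtain u where "exec d s u t'" "tr' = ticks (1 + bcost b) @ u"
    by cases auto
  then show ?case using IfFalse.IH by metis
next
  case (WhileTrue b s c tr1 s' tr2 t)
  from WhileTrue.prems(1) WhileTrue.hyps(1) obtain u1 u u2
    where "exec c s u1 u" "exec (While b c) u u2 t'" "tr' = ticks (1 + bcost b) @ u1 @ u2"
    by cases auto
  then show ?case using WhileTrue.IH by metis
next
  case (WhileFalse b s c)
  from WhileFalse.prems(1) show ?case by cases (use WhileFalse.hyps in auto)
next
  case (Skip s)
  then show ?case by cases auto
next
  case (Assign x e s)
  then show ?case by cases auto
next
  case (Store a e f s)
  then show ?case by cases auto
next
  case (Print e s)
  then show ?case by cases auto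
next
  case (End_Solution s)
  then show ?case by cases auto
qed

text \<open>Numbers of steps before the first completed solution, between consecutive ones, and after the
  last one; the first argument counts the steps since the last completion.\<close>

fun gaps :: "nat \<Rightarrow> event list \<Rightarrow> nat list" where
  "gaps k [] = [k]"
| "gaps k (Tick # tr) = gaps (Suc k) tr"
| "gaps k (Printed v # tr) = gaps k tr"
| "gaps k (Solution_End # tr) = k # gaps 0 tr"

definition delay :: "event list \<Rightarrow> nat" where
  "delay tr = Max (set (gaps 0 tr))"

text \<open>The output tape holds exactly the solutions of the given sequence, each written as the
  increasing list of its vertices followed by an end marker.\<close>

definition writes :: "event list \<Rightarrow> nat set list \<Rightarrow> bool" where
  "writes tr out \<longleftrightarrow> filter (\<lambda>e. e \<noteq> Tick) tr =
     concat (map (\<lambda>S. map Printed (sorted_list_of_set S) @ [Solution_End]) out)"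

text \<open>The input is \<open>n\<close> (in register 0) together with an adjacency list representation: the
  neighbours of \<open>v\<close> stand, in some order, in array 1 from position \<open>arr s 0 v\<close> up to but excluding
  position \<open>arr s 0 (v + 1)\<close>. The remaining registers and arrays are zero.\<close>

definition encodes :: "state \<Rightarrow> nat \<Rightarrow> nat set set \<Rightarrow> bool" where
  "encodes s n E \<longleftrightarrow>
     reg s = (\<lambda>_. 0)(0 := n) \<and> (\<forall>a\<ge>2. arr s a = (\<lambda>_. 0)) \<and> arr s 0 1 = 0 \<and>
     (\<forall>v\<in>verts n. arr s 0 v \<le> arr s 0 (v + 1) \<and>
        inj_on (arr s 1) {arr s 0 v..<arr s 0 (v + 1)} \<and>
        arr s 1 ` {arr s 0 v..<arr s 0 (v + 1)} = nbhd E v)"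

fun ack :: "nat \<Rightarrow> nat \<Rightarrow> nat" where
  "ack 0 k = Suc k"
| "ack (Suc i) 0 = ack i 1"
| "ack (Suc i) (Suc k) = ack i (ack (Suc i) k)"

text \<open>As usual the values are at least 1; without \<open>1 \<le> k\<close> the value at 1 would be 0.\<close>

definition inv_ack :: "nat \<Rightarrow> nat" where
  "inv_ack n = (LEAST k. 1 \<le> k \<and> n \<le> ack k k)"

end

theory Submission imports Defs "HOL-Library.Nat_Bijection" begin

text \<open>
  Correctness. Fix a solution \<open>T\<close> and order it so that every prefix meets each component of \<open>G[T]\<close>
  in a connected set. If a reached solution \<open>B\<close> contains a prefix \<open>P\<close> but not the next vertex \<open>v\<close>, then
  the neighbours of \<open>v\<close> in \<open>P\<close> lie in one connected piece of \<open>P\<close> and in one class of \<open>T\<close>, hence in one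
  class of \<open>B\<close>. For the other class \<open>i\<close> the neighbour of \<open>B\<close> given by \<open>v\<close> and \<open>i\<close> contains
  \<open>P \<union> {v}\<close>. So \<open>T\<close> is reached, and depth-first search outputs every reached solution once.

  Delay. The completion procedure needs no union-find structure: it runs in time \<open>O(m + n)\<close> if the
  vertices are tried in the order of a breadth-first search. A vertex that fails once
  fails for ever, so each one is tried once. The components of the initial set are coloured
  beforehand; when a vertex is added, the components that it meets join the current component of the
  search, where flipping the colours of a component costs a single assignment. Since numbers are unbounded,
  the set \<open>\<S>\<close> is an array indexed by the codes \<open>\<Sum>v\<in>S. 2^v\<close>. So one round of the main loop, which treats
  one neighbour, takes \<open>O(m + n)\<close> steps, and by the alternating output rule at most \<open>4 n + 5\<close> rounds pass
  between two outputs.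

  Register 0 holds \<open>n\<close>, 1 the number of active calls, 2 the parity of the depth, 3 the position
  in the current loop, 4 a set code, 5 to 7 the variables of the loops over vertices and neighbours, 8 to 11 the
  head, tail, offset and root of a search, 12 and 13 the vertex that is scanned and the vertex that is visited,
  14 and 15 the result and the colour of a test, 16 and 17 the pair \<open>v\<close>, \<open>i\<close> of a neighbour.
  Array 2 holds the powers of 2, 3 the set \<open>\<S>\<close>, 4 and 5 the stack of calls (solution and position),
  6 the current vertex set, 7 a representative of the component, 8 the class, 9 the vertices
  already tried, 10 the queue, 11 and 12 the components that are reached and those that are flipped.
\<close>

section \<open>The solution graph\<close>

text \<open>What replaces union-find is the moment of a test. A vertex \<open>y\<close> is tested
  either from a pending vertex of the queue or as a new root when the queue is empty. Every scanned
  vertex has had all its neighbours tested, so inside the reached part an untested \<open>y\<close>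
  is adjacent only to pending vertices, and these always lie in one component. Its other neighbours
  lie in components that have not been reached; these are components of the initial set, whose
  representatives are known. Hence a clash that remains after flipping means an odd cycle, and the
  test is exact. The recursive description fixes neither the completion nor the order of the loops.
  The program supplies both, and its flat loop is matched with the recursion call by call; the count
  of steps since the last output is carried through this simulation, because it depends on where the
  outputs of nested calls fall.\<close>

lemma bipartite_subset: "bipartite E B \<Longrightarrow> A \<subseteq> B \<Longrightarrow> bipartite E A"
proof -
  assume "bipartite E B" "A \<subseteq> B"
  then obtain X Y where "bipartition E B X Y" by (auto simp: bipartite_def)
  then have "bipartition E A (X \<inter> A) (Y \<inter> A)"
    using \<open>A \<subseteq> B\<close> unfolding bipartition_def edgeless_def by blast
  then show ?thesis by (auto simp: bipartite_def)
qed

lemma conn_mono: "A \<subseteq> B \<Longrightarrow> conn E A \<subseteq> conn E B"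
  unfolding conn_def by (intro rtrancl_mono) auto

lemma conn_refl [simp]: "(u, u) \<in> conn E B"
  by (simp add: conn_def)

lemma conn_edge: "u \<in> B \<Longrightarrow> v \<in> B \<Longrightarrow> {u, v} \<in> E \<Longrightarrow> (u, v) \<in> conn E B"
  by (auto simp: conn_def)

text \<open>Every edge changes the class in both bipartitions, so whether they agree is constant
  along a path. This carries information about classes from one solution to another.\<close>

lemma bipartition_conn:
  assumes "bipartition E B X Y" "bipartition E B X' Y'" "(u, v) \<in> conn E B"
  shows "(u \<in> X \<longleftrightarrow> u \<in> X') \<longleftrightarrow> (v \<in> X \<longleftrightarrow> v \<in> X')"
  using assms(3) unfolding conn_def
proof (induction rule: rtrancl_induct)
  case (step y z)
  then show ?case
    using bipartition_edge[OF assms(1), of y z] bipartition_edge[OF assms(2), of y z] by auto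
qed simp

text \<open>Induction along the path. This is how a search, or a prefix without outgoing edges, is
  shown to have exhausted a component.\<close>

lemma conn_closed:
  assumes "(u, v) \<in> conn E B" "u \<in> D" "\<And>x y. x \<in> D \<Longrightarrow> y \<in> B \<Longrightarrow> {x, y} \<in> E \<Longrightarrow> y \<in> D"
  shows "v \<in> D"
  using assms(1) unfolding conn_def
  by (induction rule: rtrancl_induct) (use assms in auto)

text \<open>Bipartiteness is hereditary, so a bipartite proper superset would already allow the
  addition of one of its vertices. Hence greedy completion stops exactly at the maximal
  solutions.\<close>

lemma max_bip_iff:
  "max_bip n E B \<longleftrightarrow> B \<subseteq> verts n \<and> bipartite E B \<and> B \<notin> Domain (grow n E)"
proof
  assume m: "max_bip n E B"
  have "B \<notin> Domain (grow n E)"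
  proof
    assume "B \<in> Domain (grow n E)"
    then obtain v where "v \<in> verts n" "v \<notin> B" "bipartite E (insert v B)"
      by (auto simp: grow_def)
    moreover have "B \<subset> insert v B" "insert v B \<subseteq> verts n"
      using calculation m by (auto simp: max_bip_def)
    ultimately show False using m unfolding max_bip_def by blast
  qed
  then show "B \<subseteq> verts n \<and> bipartite E B \<and> B \<notin> Domain (grow n E)"
    using m by (auto simp: max_bip_def)
next
  assume b: "B \<subseteq> verts n \<and> bipartite E B \<and> B \<notin> Domain (grow n E)"
  have "\<not> bipartite E C" if C: "B \<subset> C" "C \<subseteq> verts n" for C
  proof
    assume "bipartite E C"
    obtain v where v: "v \<in> C" "v \<notin> B" using C by blast
    then have "bipartite E (insert v B)" "v \<in> verts n"
      using bipartite_subset[OF \<open>bipartite E C\<close>, of "insert v B"] C by auto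
    then show False using b v by (auto simp: grow_def)
  qed
  then show "max_bip n E B" using b by (auto simp: max_bip_def)
qed

lemma grow_rtrancl:
  assumes "(A, B) \<in> (grow n E)\<^sup>*" "A \<subseteq> verts n" "bipartite E A"
  shows "A \<subseteq> B \<and> B \<subseteq> verts n \<and> bipartite E B"
  using assms(1) by (induction rule: rtrancl_induct) (use assms in \<open>auto simp: grow_def\<close>)

lemma is_comp_max:
  assumes "is_comp n E cmp" "A \<subseteq> verts n" "bipartite E A"
  shows "A \<subseteq> cmp A" "max_bip n E (cmp A)"
  using assms grow_rtrancl[of A "cmp A" n E] by (auto simp: is_comp_def max_bip_iff)

section \<open>Classes, seeds and neighbours of a solution\<close>

lemma side_bipartition:
  assumes "bipartite E B"
  shows "bipartition E B (side E B 0) (side E B 1)"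
proof -
  obtain B0 B1 where "canonical_bipartition E B B0 B1" using canonical_exists[OF assms] by blast
  then show ?thesis using side_eq by (metis canonical_bipartition_def)
qed

lemma side_Un: "bipartite E B \<Longrightarrow> i \<in> {0, 1} \<Longrightarrow> side E B i \<union> side E B (1 - i) = B"
  using side_bipartition[of E B] by (auto simp: bipartition_def)

lemma simple_graph_no_loop: "simple_graph n E \<Longrightarrow> {v} \<notin> E"
  unfolding simple_graph_def by (metis doubleton_eq_iff insert_absorb2)

definition nbr_seed :: "nat set set \<Rightarrow> nat set \<Rightarrow> nat \<Rightarrow> nat \<Rightarrow> nat set" where
  "nbr_seed E B v i = {v} \<union> (side E B i - nbhd E v) \<union> side E B (1 - i)"

text \<open>The vertex \<open>v\<close> joins class \<open>i\<close>, from which its neighbours have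
  been removed, and the other class stays as it is.\<close>

lemma nbr_seed:
  assumes "simple_graph n E" "B \<subseteq> verts n" "bipartite E B" "v \<in> verts n" "v \<notin> B" "i \<in> {0, 1}"
  shows "nbr_seed E B v i \<subseteq> verts n" "bipartite E (nbr_seed E B v i)"
proof -
  have u: "side E B i \<union> side E B (1 - i) = B" by (rule side_Un[OF assms(3,6)])
  then show "nbr_seed E B v i \<subseteq> verts n" using assms unfolding nbr_seed_def by blast
  have e: "edgeless E (side E B i)" "edgeless E (side E B (1 - i))"
    "side E B i \<inter> side E B (1 - i) = {}"
    using side_bipartition[OF assms(3)] assms(6) by (auto simp: bipartition_def)
  have "bipartition E (nbr_seed E B v i) ({v} \<union> (side E B i - nbhd E v)) (side E B (1 - i))"
    using e simple_graph_no_loop[OF assms(1), of v] u assms(5)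
    unfolding bipartition_def nbr_seed_def edgeless_def nbhd_def
    by (auto simp: insert_commute)
  then show "bipartite E (nbr_seed E B v i)" by (auto simp: bipartite_def)
qed

lemma neighbors_at_eq:
  "neighbors_at E cmp B v = (if v \<in> B then {B} else (\<lambda>i. cmp (nbr_seed E B v i)) ` {0, 1})"
  unfolding neighbors_at_def nbr_seed_def by (simp only: Setcompr_eq_image)

lemma neighbors_max:
  assumes "simple_graph n E" "is_comp n E cmp" "max_bip n E B" "B' \<in> neighbors n E cmp B"
  shows "max_bip n E B'"
proof -
  obtain v where v: "v \<in> verts n" "B' \<in> neighbors_at E cmp B v"
    using assms(4) by (auto simp: neighbors_def)
  show ?thesis
  proof (cases "v \<in> B")
    case True then show ?thesis using v assms(3) by (simp add: neighbors_at_eq)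
  next
    case False
    then obtain i where i: "i \<in> {0, 1}" "B' = cmp (nbr_seed E B v i)"
      using v by (auto simp: neighbors_at_eq)
    then show ?thesis
      using is_comp_max(2)[OF assms(2) nbr_seed[OF assms(1) _ _ v(1) False i(1)]] assms(3)
      by (simp add: max_bip_def)
  qed
qed

text \<open>If \<open>P\<close> meets every component of \<open>G[T]\<close> in a connected set, then the neighbours of \<open>v\<close> in
  \<open>P\<close>, which all lie in one class of \<open>T\<close>, also lie in one class of any solution \<open>B \<supseteq> P\<close>, and
  choosing \<open>i\<close> as the other class preserves \<open>P\<close>.\<close>

lemma neighbor_containing:
  assumes sg: "simple_graph n E" and c: "is_comp n E cmp" and B: "max_bip n E B"
    and T: "bipartite E T" "T \<subseteq> verts n" and P: "P \<subseteq> T" "P \<subseteq> B"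
    and con: "\<And>u w. u \<in> P \<Longrightarrow> w \<in> P \<Longrightarrow> (u, w) \<in> conn E T \<Longrightarrow> (u, w) \<in> conn E P"
    and v: "v \<in> T" "v \<notin> B"
  shows "\<exists>B'\<in>neighbors n E cmp B. insert v P \<subseteq> B'"
proof -
  have bB: "bipartite E B" "B \<subseteq> verts n" using B by (auto simp: max_bip_def)
  note sb = side_bipartition[OF bB(1)]
  obtain X Y where XY: "bipartition E T X Y" using T(1) by (auto simp: bipartite_def)
  have same: "u \<in> side E B 0 \<longleftrightarrow> w \<in> side E B 0"
    if u: "u \<in> P" "{u, v} \<in> E" and w: "w \<in> P" "{w, v} \<in> E" for u w
  proof -
    have "(u, v) \<in> conn E T" "(v, w) \<in> conn E T"
      using u w v P by (auto intro!: conn_edge simp: insert_commute)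
    then have uw: "(u, w) \<in> conn E P" using con u w conn_trans by blast
    \<comment> \<open>Connectedness is only known inside \<open>P\<close>, so the bipartitions of
      \<open>T\<close> and of \<open>B\<close> are both restricted to this common subset before they
      are compared.\<close>
    have bp: "bipartition E P (X \<inter> P) (Y \<inter> P)"
      using XY P unfolding bipartition_def edgeless_def by blast
    have bp': "bipartition E P (side E B 0 \<inter> P) (side E B 1 \<inter> P)"
      using sb P unfolding bipartition_def edgeless_def by blast
    have "u \<in> X \<longleftrightarrow> w \<in> X"
      using bipartition_edge[OF XY, of u v] bipartition_edge[OF XY, of w v] u w v P by auto
    then show ?thesis using bipartition_conn[OF bp bp' uw] u w by auto
  qed
  obtain i where i: "i \<in> {0, 1::nat}" "\<forall>u\<in>P. {u, v} \<in> E \<longrightarrow> u \<notin> side E B i"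
  proof (cases "\<exists>u\<in>P. {u, v} \<in> E \<and> u \<in> side E B 0")
    case True
    then have "\<forall>w\<in>P. {w, v} \<in> E \<longrightarrow> w \<in> side E B 0" using same by blast
    then show ?thesis using that[of 1] sb by (auto simp: bipartition_def)
  next
    case False
    then show ?thesis using that[of 0] by auto
  qed
  have vn: "v \<in> verts n" using v T by blast
  have "insert v P \<subseteq> nbr_seed E B v i"
    using i P(2) side_Un[OF bB(1) i(1)] unfolding nbr_seed_def nbhd_def by blast
  moreover have "nbr_seed E B v i \<subseteq> cmp (nbr_seed E B v i)"
    using is_comp_max(1)[OF c nbr_seed[OF sg bB(2) bB(1) vn v(2) i(1)]] .
  moreover have "cmp (nbr_seed E B v i) \<in> neighbors n E cmp B"
    using vn v(2) i(1) by (auto simp: neighbors_def neighbors_at_eq)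
  ultimately show ?thesis by blast
qed

text \<open>\<open>\<C>\<close> stands for the solutions reached by the search. The witness
  \<open>B\<close> changes with the prefix: passing to a neighbour may lose vertices of
  \<open>T\<close> outside the prefix, so only the prefix itself can grow steadily.\<close>

lemma neighbors_strongly_connected:
  assumes sg: "simple_graph n E" and c: "is_comp n E cmp" and S0: "max_bip n E S0" "S0 \<in> \<C>"
    and closed: "\<And>B B'. B \<in> \<C> \<Longrightarrow> max_bip n E B \<Longrightarrow> B' \<in> neighbors n E cmp B \<Longrightarrow> B' \<in> \<C>"
    and T: "max_bip n E T"
  shows "T \<in> \<C>"
proof -
  have bT: "bipartite E T" "T \<subseteq> verts n" using T by (auto simp: max_bip_def)
  have fT: "finite T" using bT(2) finite_subset by (fastforce simp: verts_def)
  have "\<exists>P B. P \<subseteq> T \<and> card P = k \<and> P \<subseteq> B \<and> max_bip n E B \<and> B \<in> \<C> \<and>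
      (\<forall>u\<in>P. \<forall>w\<in>P. (u, w) \<in> conn E T \<longrightarrow> (u, w) \<in> conn E P)" if "k \<le> card T" for k
    using that
  proof (induction k)
    case 0
    show ?case using S0 by (intro exI[of _ "{}"] exI[of _ S0]) auto
  next
    case (Suc k)
    then obtain P B where P: "P \<subseteq> T" "card P = k" "P \<subseteq> B" "max_bip n E B" "B \<in> \<C>"
      and con: "\<And>u w. u \<in> P \<Longrightarrow> w \<in> P \<Longrightarrow> (u, w) \<in> conn E T \<Longrightarrow> (u, w) \<in> conn E P" by auto
    have "P \<noteq> T" using P(2) Suc.prems by auto
    then obtain v where v: "v \<in> T" "v \<notin> P" and
      adj: "(\<exists>p\<in>P. {p, v} \<in> E) \<or> (\<forall>p\<in>P. \<forall>w\<in>T - P. {p, w} \<notin> E)"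
      using P(1) by blast
    have step: "(u, v) \<in> conn E (insert v P)" if u: "u \<in> P" "(u, v) \<in> conn E T" for u
    proof (cases "\<exists>p\<in>P. {p, v} \<in> E")
      case True
      then obtain p where p: "p \<in> P" "{p, v} \<in> E" by blast
      then have "(v, p) \<in> conn E T" using v P(1) by (auto intro!: conn_edge simp: insert_commute)
      then have "(u, p) \<in> conn E P" using con u p conn_trans by blast
      moreover have "(p, v) \<in> conn E (insert v P)" using p by (auto intro: conn_edge)
      ultimately show ?thesis using conn_mono[of P "insert v P" E] conn_trans by blast
    next
      case False
      \<comment> \<open>No edge leaves \<open>P\<close> inside \<open>T\<close>, so a path from
        \<open>u\<close> cannot reach a vertex outside \<open>P\<close>: this case is
        vacuous.\<close>
      then have "v \<in> P" using conn_closed[OF u(2) u(1)] adj by blast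
      then show ?thesis using v by blast
    qed
    have con': "\<forall>u\<in>insert v P. \<forall>w\<in>insert v P. (u, w) \<in> conn E T \<longrightarrow> (u, w) \<in> conn E (insert v P)"
      using step con conn_mono[of P "insert v P" E] conn_sym by (metis conn_refl insertE subsetD subset_insertI)
    have "card (insert v P) = Suc k"
      using P v finite_subset[OF P(1) fT] by simp
    moreover obtain B' where "insert v P \<subseteq> B'" "max_bip n E B'" "B' \<in> \<C>"
    proof (cases "v \<in> B")
      case True then show ?thesis using that[of B] P by auto
    next
      case False
      obtain B' where "B' \<in> neighbors n E cmp B" "insert v P \<subseteq> B'"
        using neighbor_containing[OF sg c P(4) bT P(1,3) con v(1) False] by blast
      then show ?thesis using that[of B'] neighbors_max[OF sg c P(4)] closed[OF P(5,4)] by blast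
    qed
    ultimately show ?case using con' P(1) v(1)
      by (intro exI[of _ "insert v P"] exI[of _ B']) auto
  qed
  from this[of "card T"] obtain P B where "P \<subseteq> T" "card P = card T" "P \<subseteq> B" "max_bip n E B" "B \<in> \<C>"
    by auto
  \<comment> \<open>The prefix is now all of \<open>T\<close>, so \<open>T \<subseteq> B\<close>,
    and maximality of \<open>T\<close> gives \<open>T = B\<close>.\<close>
  moreover have "P = T" using calculation fT by (simp add: card_subset_eq)
  ultimately show ?thesis using T by (metis max_bip_def psubsetI)
qed

text \<open>The closure clause covers the solutions output by this very call. It cannot be claimed
  for all of \<open>\<S>\<close>, since callers on the stack are in \<open>\<S>\<close> while their
  loops are unfinished. At the root \<open>\<S>\<close> is empty, so nothing is left out.\<close>

lemma enum_loop_sound: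
  "enum ord d S \<S> out \<S>' \<Longrightarrow> S \<notin> \<S> \<Longrightarrow>
    \<S>' = \<S> \<union> set out \<and> S \<in> set out \<and> distinct out \<and> \<S> \<inter> set out = {} \<and>
    (\<forall>X\<in>set out. set (ord X) \<subseteq> \<S>')"
  "loop ord d L \<S> out \<S>' \<Longrightarrow>
    \<S>' = \<S> \<union> set out \<and> set L \<subseteq> \<S>' \<and> distinct out \<and> \<S> \<inter> set out = {} \<and>
    (\<forall>X\<in>set out. set (ord X) \<subseteq> \<S>')"
  by (induction rule: enum_loop.inducts) (simp; blast)+

lemma enum_loop_max:
  assumes "\<And>B B'. max_bip n E B \<Longrightarrow> B' \<in> set (ord B) \<Longrightarrow> max_bip n E B'"
  shows "enum ord d S \<S> out \<S>' \<Longrightarrow> max_bip n E S \<Longrightarrow> \<forall>X\<in>set out. max_bip n E X"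
    "loop ord d L \<S> out \<S>' \<Longrightarrow> \<forall>X\<in>set L. max_bip n E X \<Longrightarrow> \<forall>X\<in>set out. max_bip n E X"
  by (induction rule: enum_loop.inducts) (auto dest: assms)

lemma finite_max_bip: "finite {B. max_bip n E B}"
  by (rule finite_subset[of _ "Pow (verts n)"]) (auto simp: max_bip_def verts_def)

text \<open>Each call adds \<open>S\<close>, so fewer solutions remain outside the global set. The
  inner induction along the loop takes an arbitrary larger set, because earlier iterations may have
  added solutions.\<close>

lemma enum_terminates:
  assumes ord: "\<And>B B'. max_bip n E B \<Longrightarrow> B' \<in> set (ord B) \<Longrightarrow> max_bip n E B'"
  shows "max_bip n E S \<Longrightarrow> S \<notin> \<S> \<Longrightarrow> \<exists>out \<S>'. enum ord d S \<S> out \<S>'"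
proof (induction "card ({B. max_bip n E B} - \<S>)" arbitrary: S \<S> d rule: less_induct)
  case less
  have fewer: "card ({B. max_bip n E B} - \<S>') < card ({B. max_bip n E B} - \<S>)" if "insert S \<S> \<subseteq> \<S>'" for \<S>'
    by (rule psubset_card_mono) (use that less.prems finite_max_bip in auto)
  have "\<exists>out \<S>''. loop ord d L \<S>' out \<S>''"
    if "insert S \<S> \<subseteq> \<S>'" "\<forall>X\<in>set L. max_bip n E X" for L \<S>'
    using that
  proof (induction L arbitrary: \<S>')
    case Nil
    then show ?case using loop_done by blast
  next
    case (Cons S' Ss)
    show ?case
    proof (cases "S' \<in> \<S>'")
      case True
      then show ?thesis using Cons loop_skip by (metis list.set_intros(2))
    next
      case False
      obtain out1 \<S>1 where e: "enum ord (Suc d) S' \<S>' out1 \<S>1"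
        using less.hyps[OF fewer[OF Cons.prems(1)] _ False, of "Suc d"] Cons.prems by auto
      have "insert S \<S> \<subseteq> \<S>1" using enum_loop_sound(1)[OF e False] Cons.prems by blast
      then obtain out2 \<S>2 where "loop ord d Ss \<S>1 out2 \<S>2" using Cons by (metis list.set_intros(2))
      then show ?thesis using loop_call[OF False e] by blast
    qed
  qed
  from this[of "insert S \<S>" "ord S"] show ?case using less.prems ord enum by blast
qed

lemma enumeration_correct:
  assumes "simple_graph n E" "is_comp n E cmp" "is_order n E cmp ord" "max_bip n E S0"
  shows "\<exists>out. alg_outputs ord S0 out"
    and "alg_outputs ord S0 out \<Longrightarrow> distinct out \<and> set out = {B. max_bip n E B}"
proof -
  have ord: "set (ord B) = neighbors n E cmp B" if "max_bip n E B" for B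
    using assms(3) that by (simp add: is_order_def)
  have max: "max_bip n E B'" if "max_bip n E B" "B' \<in> set (ord B)" for B B'
    using neighbors_max[OF assms(1,2) that(1)] that ord by blast
  show "\<exists>out. alg_outputs ord S0 out"
    using enum_terminates[OF max assms(4), where \<S> = "{}" and d = 0] by (auto simp: alg_outputs_def)
  assume "alg_outputs ord S0 out"
  then obtain \<S> where e: "enum ord 0 S0 {} out \<S>" by (auto simp: alg_outputs_def)
  note s = enum_loop_sound(1)[OF e]
  have m: "\<forall>X\<in>set out. max_bip n E X"
    by (rule enum_loop_max(1)[OF _ e assms(4)]) (rule max)
  have "T \<in> set out" if "max_bip n E T" for T
    by (rule neighbors_strongly_connected[OF assms(1,2,4) _ _ that]) (use s ord in auto)
  then show "distinct out \<and> set out = {B. max_bip n E B}" using s m by blast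
qed

section \<open>Running times and frame conditions\<close>

notation Seq (infixr ";;" 60)

abbreviation outputs :: "event list \<Rightarrow> event list" where
  "outputs \<equiv> filter (\<lambda>e. e \<noteq> Tick)"

definition ntick :: "event list \<Rightarrow> nat" where
  "ntick tr = length (filter (\<lambda>e. e = Tick) tr)"

lemma ntick_simps [simp]:
  "ntick [] = 0" "ntick (a @ b) = ntick a + ntick b" "ntick (ticks k) = k"
  "ntick (Tick # a) = Suc (ntick a)" "ntick (Printed v # a) = ntick a"
  "ntick (Solution_End # a) = ntick a"
  by (auto simp: ntick_def filter_replicate)

text \<open>Total correctness with the exact number of steps. The existential form loses nothing, as
  execution is deterministic. The output is hidden from the postcondition, so programs that print
  are treated with \<open>exec\<close> itself.\<close>

definition wp :: "com \<Rightarrow> state \<Rightarrow> (state \<Rightarrow> nat \<Rightarrow> bool) \<Rightarrow> bool" where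
  "wp c s Q \<longleftrightarrow> (\<exists>tr t. exec c s tr t \<and> Q t (ntick tr))"

inductive_simps exec_iffs: "exec Skip s tr t" "exec (Assign x e) s tr t" "exec (Store a e f) s tr t"
  "exec (c ;; d) s tr t" "exec (If b c d) s tr t"

lemma wp_Skip: "wp Skip s Q \<longleftrightarrow> Q s 1"
  by (simp add: wp_def exec_iffs)

lemma wp_Assign: "wp (Assign x e) s Q \<longleftrightarrow> Q (s\<lparr>reg := (reg s)(x := aval e s)\<rparr>) (1 + acost e)"
  unfolding wp_def exec_iffs by (simp del: replicate.simps)

lemma wp_Store: "wp (Store a e f) s Q \<longleftrightarrow>
    Q (s\<lparr>arr := (arr s)(a := (arr s a)(aval e s := aval f s))\<rparr>) (1 + acost e + acost f)"
  unfolding wp_def exec_iffs by (simp del: replicate.simps)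

lemma wp_Seq: "wp (c ;; d) s Q \<longleftrightarrow> wp c s (\<lambda>s' k. wp d s' (\<lambda>t k'. Q t (1 + k + k')))"
  by (simp add: wp_def exec_iffs) (metis ntick_simps(2,4))

lemma wp_If: "wp (If b c d) s Q \<longleftrightarrow>
    (if bval b s then wp c s (\<lambda>t k. Q t (1 + bcost b + k)) else wp d s (\<lambda>t k. Q t (1 + bcost b + k)))"
  by (simp add: wp_def exec_iffs) (metis ntick_simps(2,3,4))

lemmas wp_simps = wp_Skip wp_Assign wp_Store wp_Seq wp_If

lemma wp_mono: "wp c s Q \<Longrightarrow> (\<And>t k. Q t k \<Longrightarrow> Q' t k) \<Longrightarrow> wp c s Q'"
  unfolding wp_def by blast

lemma wp_while_false: "\<not> bval b s \<Longrightarrow> Q s (1 + bcost b) \<Longrightarrow> wp (While b c) s Q"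
  unfolding wp_def by (metis exec.WhileFalse ntick_simps(3))

lemma wp_while_true:
  assumes "bval b s" "wp c s (\<lambda>s' k. wp (While b c) s' (\<lambda>t k'. Q t (1 + bcost b + k + k')))"
  shows "wp (While b c) s Q"
proof -
  obtain tr1 s' tr2 t where "exec c s tr1 s'" "exec (While b c) s' tr2 t"
    "Q t (1 + bcost b + ntick tr1 + ntick tr2)" using assms(2) unfolding wp_def by blast
  then show ?thesis unfolding wp_def
    by (intro exI[of _ "ticks (1 + bcost b) @ tr1 @ tr2"] exI[of _ t])
      (use exec.WhileTrue[OF assms(1)] in \<open>auto simp: add.assoc simp del: replicate.simps\<close>)
qed

text \<open>\<open>\<Phi>\<close> is a potential that pays for the body and the test of every
  iteration. As each test costs at least one step, it also serves as the termination
  measure.\<close>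

lemma wp_while:
  assumes "I s"
    and step: "\<And>s. I s \<Longrightarrow> bval b s \<Longrightarrow> wp c s (\<lambda>s' k. I s' \<and> \<Phi> s' + k + 1 + bcost b \<le> \<Phi> s)"
    and exit: "\<And>t k. I t \<Longrightarrow> \<not> bval b t \<Longrightarrow> \<Phi> t + k \<le> \<Phi> s + 1 + bcost b \<Longrightarrow> Q t k"
  shows "wp (While b c) s Q"
proof -
  have "wp (While b c) s (\<lambda>t k. I t \<and> \<not> bval b t \<and> \<Phi> t + k \<le> \<Phi> s + 1 + bcost b)"
    using assms(1)
  proof (induction "\<Phi> s" arbitrary: s rule: less_induct)
    case less
    show ?case
    proof (cases "bval b s")
      case False
      then show ?thesis using less.prems by (intro wp_while_false) auto
    next
      case True
      show ?thesis
        by (rule wp_while_true[OF True], rule wp_mono[OF step[OF less.prems True]],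
            rule wp_mono[OF less.hyps]) auto
    qed
  qed
  then show ?thesis by (rule wp_mono) (use exit in auto)
qed

section \<open>What a program changes, prints and depends on\<close>

fun mod_regs :: "com \<Rightarrow> nat set" where
  "mod_regs (Assign x e) = {x}"
| "mod_regs (c ;; d) = mod_regs c \<union> mod_regs d"
| "mod_regs (If b c d) = mod_regs c \<union> mod_regs d"
| "mod_regs (While b c) = mod_regs c"
| "mod_regs _ = {}"

fun mod_arrs :: "com \<Rightarrow> nat set" where
  "mod_arrs (Store a e f) = {a}"
| "mod_arrs (c ;; d) = mod_arrs c \<union> mod_arrs d"
| "mod_arrs (If b c d) = mod_arrs c \<union> mod_arrs d"
| "mod_arrs (While b c) = mod_arrs c"
| "mod_arrs _ = {}"

lemma exec_frame:
  "exec c s tr t \<Longrightarrow> (\<forall>x. x \<notin> mod_regs c \<longrightarrow> reg t x = reg s x) \<and>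
     (\<forall>a. a \<notin> mod_arrs c \<longrightarrow> arr t a = arr s a)"
  by (induction rule: exec.induct) auto

fun silent :: "com \<Rightarrow> bool" where
  "silent (Print e) \<longleftrightarrow> False"
| "silent End_Solution \<longleftrightarrow> False"
| "silent (c ;; d) \<longleftrightarrow> silent c \<and> silent d"
| "silent (If b c d) \<longleftrightarrow> silent c \<and> silent d"
| "silent (While b c) \<longleftrightarrow> silent c"
| "silent _ \<longleftrightarrow> True"

lemma exec_silent: "exec c s tr t \<Longrightarrow> silent c \<Longrightarrow> outputs tr = []"
  by (induction rule: exec.induct) auto

fun aexp_regs :: "aexp \<Rightarrow> nat set" where
  "aexp_regs (N k) = {}"
| "aexp_regs (R x) = {x}"
| "aexp_regs (Arr a e) = aexp_regs e"
| "aexp_regs (Plus e f) = aexp_regs e \<union> aexp_regs f"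
| "aexp_regs (Minus e f) = aexp_regs e \<union> aexp_regs f"

fun aexp_arrs :: "aexp \<Rightarrow> nat set" where
  "aexp_arrs (N k) = {}"
| "aexp_arrs (R x) = {}"
| "aexp_arrs (Arr a e) = insert a (aexp_arrs e)"
| "aexp_arrs (Plus e f) = aexp_arrs e \<union> aexp_arrs f"
| "aexp_arrs (Minus e f) = aexp_arrs e \<union> aexp_arrs f"

fun bexp_regs :: "bexp \<Rightarrow> nat set" where
  "bexp_regs (Less e f) = aexp_regs e \<union> aexp_regs f"
| "bexp_regs (Eq e f) = aexp_regs e \<union> aexp_regs f"
| "bexp_regs (Not b) = bexp_regs b"
| "bexp_regs (And b c) = bexp_regs b \<union> bexp_regs c"

fun bexp_arrs :: "bexp \<Rightarrow> nat set" where
  "bexp_arrs (Less e f) = aexp_arrs e \<union> aexp_arrs f"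
| "bexp_arrs (Eq e f) = aexp_arrs e \<union> aexp_arrs f"
| "bexp_arrs (Not b) = bexp_arrs b"
| "bexp_arrs (And b c) = bexp_arrs b \<union> bexp_arrs c"

fun com_regs :: "com \<Rightarrow> nat set" where
  "com_regs (Assign x e) = insert x (aexp_regs e)"
| "com_regs (Store a e f) = aexp_regs e \<union> aexp_regs f"
| "com_regs (Print e) = aexp_regs e"
| "com_regs (c ;; d) = com_regs c \<union> com_regs d"
| "com_regs (If b c d) = bexp_regs b \<union> com_regs c \<union> com_regs d"
| "com_regs (While b c) = bexp_regs b \<union> com_regs c"
| "com_regs _ = {}"

fun com_arrs :: "com \<Rightarrow> nat set" where
  "com_arrs (Assign x e) = aexp_arrs e"
| "com_arrs (Store a e f) = insert a (aexp_arrs e \<union> aexp_arrs f)"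
| "com_arrs (Print e) = aexp_arrs e"
| "com_arrs (c ;; d) = com_arrs c \<union> com_arrs d"
| "com_arrs (If b c d) = bexp_arrs b \<union> com_arrs c \<union> com_arrs d"
| "com_arrs (While b c) = bexp_arrs b \<union> com_arrs c"
| "com_arrs _ = {}"

definition agree :: "nat set \<Rightarrow> nat set \<Rightarrow> state \<Rightarrow> state \<Rightarrow> bool" where
  "agree X A s s' \<longleftrightarrow> (\<forall>x\<in>X. reg s x = reg s' x) \<and> (\<forall>a\<in>A. arr s a = arr s' a)"

lemma aval_agree: "agree X A s s' \<Longrightarrow> aexp_regs e \<subseteq> X \<Longrightarrow> aexp_arrs e \<subseteq> A \<Longrightarrow> aval e s = aval e s'"
  by (induction e) (auto simp: agree_def)

lemma bval_agree: "agree X A s s' \<Longrightarrow> bexp_regs b \<subseteq> X \<Longrightarrow> bexp_arrs b \<subseteq> A \<Longrightarrow> bval b s = bval b s'"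
  by (induction b) (auto simp: aval_agree)

text \<open>Induction on the run. It allows a run from an idealised memory to be replayed, with the
  same trace, in the memory of the algorithm, where the stack and the visited set are present as
  well.\<close>

lemma exec_agree:
  "exec c s tr t \<Longrightarrow> agree X A s s' \<Longrightarrow> com_regs c \<subseteq> X \<Longrightarrow> com_arrs c \<subseteq> A \<Longrightarrow>
    \<exists>t'. exec c s' tr t' \<and> agree X A t t'"
proof (induction arbitrary: s' rule: exec.induct)
  case (Assign x e s)
  then show ?case using aval_agree[OF Assign.prems(1), of e] by (auto simp: exec_iffs agree_def)
next
  case (Store a e f s)
  then show ?case using aval_agree[OF Store.prems(1), of e] aval_agree[OF Store.prems(1), of f]
    by (auto simp: exec_iffs agree_def)
next
  case (Print e s)
  then show ?case using exec.Print[of e s'] aval_agree[OF Print.prems(1), of e] by auto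
next
  case (Seq c s tr1 s1 d tr2 t)
  then show ?case by (simp add: exec_iffs) (metis append.assoc)
next
  case (IfTrue b s c tr t d)
  then show ?case using exec.IfTrue bval_agree[OF IfTrue.prems(1), of b] by force
next
  case (IfFalse b s d tr t c)
  then show ?case using exec.IfFalse bval_agree[OF IfFalse.prems(1), of b] by force
next
  case (WhileFalse b s c)
  then show ?case using exec.WhileFalse bval_agree[OF WhileFalse.prems(1), of b] by force
next
  case (WhileTrue b s c tr1 s1 tr2 t)
  then obtain s1' where "exec c s' tr1 s1'" "agree X A s1 s1'" by force
  moreover then obtain t' where "exec (While b c) s1' tr2 t'" "agree X A t t'"
    using WhileTrue by force
  moreover have "bval b s'" using WhileTrue bval_agree[OF WhileTrue.prems(1), of b] by auto
  ultimately show ?case using exec.WhileTrue by blast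
qed (use exec.Skip exec.End_Solution in blast)+

text \<open>Loops over the vertices and over the neighbours of the vertex in register \<open>z\<close>; \<open>c\<close> finds the
  current vertex in register 5, respectively 7.\<close>

definition for_verts :: "com \<Rightarrow> com" where
  "for_verts c = (Assign 5 (N 0) ;; While (Less (R 5) (R 0)) (Assign 5 (Plus (R 5) (N 1)) ;; c))"

definition for_nbrs :: "nat \<Rightarrow> com \<Rightarrow> com" where
  "for_nbrs z c = (Assign 6 (Arr 0 (R z)) ;;
     While (Less (R 6) (Arr 0 (Plus (R z) (N 1))))
       (Assign 7 (Arr 1 (R 6)) ;; Assign 6 (Plus (R 6) (N 1)) ;; c))"

lemma verts_Suc: "verts (Suc n) = insert (Suc n) (verts n)"
  unfolding verts_def by auto

definition keeps :: "nat set \<Rightarrow> nat set \<Rightarrow> state \<Rightarrow> state \<Rightarrow> bool" where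
  "keeps X A s t \<longleftrightarrow> (\<forall>x. x \<notin> X \<longrightarrow> reg t x = reg s x) \<and> (\<forall>a. a \<notin> A \<longrightarrow> arr t a = arr s a)"

lemma keeps_refl [simp]: "keeps X A s s"
  by (simp add: keeps_def)

lemma keeps_trans: "keeps X A s t \<Longrightarrow> keeps Y B t u \<Longrightarrow> X \<union> Y \<subseteq> Z \<Longrightarrow> A \<union> B \<subseteq> C \<Longrightarrow> keeps Z C s u"
  unfolding keeps_def by (metis Un_iff subset_iff)

lemma keepsD: "keeps X A s t \<Longrightarrow> x \<notin> X \<Longrightarrow> reg t x = reg s x"
  "keeps X A s t \<Longrightarrow> a \<notin> A \<Longrightarrow> arr t a = arr s a"
  by (simp_all add: keeps_def)

lemma keeps_upd: "keeps X A s t \<Longrightarrow> x \<in> X \<Longrightarrow> keeps X A s (t\<lparr>reg := (reg t)(x := v)\<rparr>)"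
  by (auto simp: keeps_def)

lemma wp_keeps:
  assumes "wp c s Q" "\<And>t k. Q t k \<Longrightarrow> keeps (mod_regs c) (mod_arrs c) s t \<Longrightarrow> Q' t k"
  shows "wp c s Q'"
  using assms exec_frame unfolding wp_def keeps_def by blast

text \<open>\<open>I v\<close> describes the state after the vertices \<open>1..v\<close>; as the
  counter is increased before the body, the body sees \<open>Suc v\<close>. The 9 steps besides
  \<open>\<tau>\<close> are the test (4), the increment (4) and the sequencing (1).\<close>

lemma wp_for_verts:
  assumes mods: "0 \<notin> mod_regs c" "5 \<notin> mod_regs c"
    and stable: "\<And>v s w. I v s \<Longrightarrow> I v (s\<lparr>reg := (reg s)(5 := w)\<rparr>)"
    and init: "I 0 s"
    and step: "\<And>v t. I v t \<Longrightarrow> v < n \<Longrightarrow> reg t 0 = n \<Longrightarrow> reg t 5 = Suc v \<Longrightarrow>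
      keeps (insert 5 (mod_regs c)) (mod_arrs c) s t \<Longrightarrow> wp c t (\<lambda>t' k. I (Suc v) t' \<and> k \<le> \<tau>)"
    and n: "reg s 0 = n"
    and exit: "\<And>t k. I n t \<Longrightarrow> keeps (insert 5 (mod_regs c)) (mod_arrs c) s t \<Longrightarrow>
      k \<le> (\<tau> + 9) * (n + 1) \<Longrightarrow> Q t k"
  shows "wp (for_verts c) s Q"
  unfolding for_verts_def wp_Seq wp_Assign
proof (rule wp_while[where I = "\<lambda>t. reg t 0 = n \<and> reg t 5 \<le> n \<and> I (reg t 5) t \<and>
        keeps (insert 5 (mod_regs c)) (mod_arrs c) s t"
      and \<Phi> = "\<lambda>s. (\<tau> + 9) * (n - reg s 5)"], goal_cases)
  case 1
  then show ?case using stable[OF init] n by (simp add: keeps_upd)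
next
  case (2 t)
  let ?t = "t\<lparr>reg := (reg t)(5 := Suc (reg t 5))\<rparr>"
  have lt: "reg t 5 < n" using 2 by simp
  have "wp c ?t (\<lambda>t' k. I (Suc (reg t 5)) t' \<and> k \<le> \<tau>)"
    by (rule step) (use 2 lt stable in \<open>auto simp: keeps_upd\<close>)
  then have "wp c ?t (\<lambda>t' k. I (Suc (reg t 5)) t' \<and> k \<le> \<tau> \<and> keeps (mod_regs c) (mod_arrs c) ?t t')"
    by (rule wp_keeps) simp
  then have w: "wp c ?t (\<lambda>t' k. (reg t' 0 = n \<and> reg t' 5 \<le> n \<and> I (reg t' 5) t' \<and>
        keeps (insert 5 (mod_regs c)) (mod_arrs c) s t') \<and>
       (\<tau> + 9) * (n - reg t' 5) + k + 9 \<le> (\<tau> + 9) * (n - reg t 5))"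
  proof (rule wp_mono)
    fix t' k
    assume a: "I (Suc (reg t 5)) t' \<and> k \<le> \<tau> \<and> keeps (mod_regs c) (mod_arrs c) ?t t'"
    then have r: "reg t' 0 = n" "reg t' 5 = Suc (reg t 5)"
      using mods 2 by (simp_all add: keeps_def)
    have "n - reg t 5 = Suc (n - reg t' 5)" using lt r by simp
    moreover have "keeps (insert 5 (mod_regs c)) (mod_arrs c) s t'"
      using a 2 by (auto simp: keeps_def)
    ultimately show "(reg t' 0 = n \<and> reg t' 5 \<le> n \<and> I (reg t' 5) t' \<and>
        keeps (insert 5 (mod_regs c)) (mod_arrs c) s t') \<and>
       (\<tau> + 9) * (n - reg t' 5) + k + 9 \<le> (\<tau> + 9) * (n - reg t 5)"
      using r a lt by simp
  qed
  show ?case unfolding wp_Seq wp_Assign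
    using w by (auto elim!: wp_mono)
next
  case (3 t k)
  then have "reg t 5 = n" by simp
  then show ?case using 3 by (intro exit) auto
qed

section \<open>The graph as adjacency lists\<close>

locale graph_input =
  fixes n :: nat and E :: "nat set set" and off adj :: "nat \<Rightarrow> nat"
  assumes simple: "simple_graph n E"
    and off_1: "off 1 = 0"
    and off_mono: "v \<in> verts n \<Longrightarrow> off v \<le> off (v + 1)"
    and adj_inj: "v \<in> verts n \<Longrightarrow> inj_on adj {off v..<off (v + 1)}"
    and adj_image: "v \<in> verts n \<Longrightarrow> adj ` {off v..<off (v + 1)} = nbhd E v"
begin

abbreviation deg :: "nat \<Rightarrow> nat" where
  "deg v \<equiv> card (nbhd E v)"

lemma deg_eq: "v \<in> verts n \<Longrightarrow> off v + deg v = off (v + 1)"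
  using card_image[OF adj_inj, of v] adj_image[of v] off_mono[of v] by simp

lemma nbhd_verts: "nbhd E v \<subseteq> verts n"
  using simple unfolding simple_graph_def nbhd_def by (auto simp: doubleton_eq_iff dest!: bspec)

lemma nbhd_sym: "u \<in> nbhd E v \<longleftrightarrow> v \<in> nbhd E u"
  by (simp add: nbhd_def insert_commute)

lemma finite_nbhd [simp]: "finite (nbhd E v)"
  by (rule finite_subset[OF nbhd_verts]) (simp add: verts_def)

lemma finite_E: "finite E"
proof (rule finite_subset)
  show "E \<subseteq> Pow (verts n)" using simple unfolding simple_graph_def by fastforce
qed (simp add: verts_def)

text \<open>Handshake count: an ordered pair of adjacent vertices is determined by its edge and one
  bit for the orientation.\<close>

lemma sum_deg: "(\<Sum>v\<in>verts n. deg v) \<le> 2 * card E"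
proof -
  let ?D = "SIGMA v:verts n. nbhd E v"
  have "(\<Sum>v\<in>verts n. deg v) = card ?D"
    by (rule card_SigmaI[symmetric]) (auto simp: verts_def)
  also have "\<dots> \<le> card (E \<times> (UNIV :: bool set))"
  proof (rule card_inj_on_le)
    show "inj_on (\<lambda>(v, u). ({u, v}, u < v)) ?D"
    proof (rule inj_onI, clarify)
      fix a b c d assume "b \<in> nbhd E a" "d \<in> nbhd E c" "{b, a} = {d, c}" "(b < a) = (d < c)"
      then show "a = c \<and> b = d" by (auto simp: doubleton_eq_iff)
    qed
  qed (use finite_E in \<open>auto simp: nbhd_def\<close>)
  finally show ?thesis by (simp add: card_cartesian_product mult.commute)
qed

text \<open>The order of an adjacency list is unknown, so \<open>I\<close> depends on the set
  \<open>M\<close> of neighbours already treated rather than on an index. Injectivity of the list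
  yields \<open>u \<notin> M\<close> and makes its length the degree.\<close>

lemma wp_for_nbrs:
  assumes mods: "z \<notin> mod_regs c" "6 \<notin> mod_regs c" "z \<noteq> 6" "z \<noteq> 7" "0 \<notin> mod_arrs c" "1 \<notin> mod_arrs c"
    and stable: "\<And>M s i u. I M s \<Longrightarrow> I M (s\<lparr>reg := (reg s)(6 := i)\<rparr>) \<and> I M (s\<lparr>reg := (reg s)(7 := u)\<rparr>)"
    and y: "reg s z = y" "y \<in> verts n" and g: "arr s 0 = off" "arr s 1 = adj"
    and init: "I {} s"
    and step: "\<And>M u t. I M t \<Longrightarrow> reg t 7 = u \<Longrightarrow> u \<in> nbhd E y \<Longrightarrow> u \<notin> M \<Longrightarrow>
      keeps ({6, 7} \<union> mod_regs c) (mod_arrs c) s t \<Longrightarrow> wp c t (\<lambda>t' k. I (insert u M) t' \<and> k \<le> \<tau>)"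
    and exit: "\<And>t k. I (nbhd E y) t \<Longrightarrow> keeps ({6, 7} \<union> mod_regs c) (mod_arrs c) s t \<Longrightarrow>
      k \<le> (\<tau> + 20) * (deg y + 1) \<Longrightarrow> Q t k"
  shows "wp (for_nbrs z c) s Q"
  unfolding for_nbrs_def wp_Seq wp_Assign
proof (rule wp_while[where I = "\<lambda>t. off y \<le> reg t 6 \<and> reg t 6 \<le> off (y + 1) \<and>
        I (adj ` {off y..<reg t 6}) t \<and> keeps ({6, 7} \<union> mod_regs c) (mod_arrs c) s t"
      and \<Phi> = "\<lambda>s. (\<tau> + 20) * (off (y + 1) - reg s 6)"], goal_cases)
  case 1
  then show ?case using stable[OF init] y g off_mono[OF y(2)] by (simp add: keeps_upd)
next
  case (2 t)
  let ?i = "reg t 6" and ?u = "adj (reg t 6)"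
  let ?t = "t\<lparr>reg := (reg t)(7 := ?u, 6 := Suc ?i)\<rparr>"
  let ?M = "adj ` {off y..<?i}"
  have k: "reg t z = y" "arr t 0 = off" "arr t 1 = adj"
    using 2 mods y g by (auto simp: keeps_def)
  have lt: "?i < off (y + 1)" using 2 k by simp
  have u: "?u \<in> nbhd E y" "?u \<notin> ?M"
    using 2 lt adj_image[OF y(2)] inj_onD[OF adj_inj[OF y(2)], of ?i] by fastforce+
  have I: "I ?M ?t"
    using 2 stable[THEN conjunct1, of ?M "t\<lparr>reg := (reg t)(7 := ?u)\<rparr>" "Suc ?i"] stable by simp
  have ks: "keeps ({6, 7} \<union> mod_regs c) (mod_arrs c) s ?t"
    using 2 by (auto simp: keeps_def)
  have "wp c ?t (\<lambda>t' k. I (insert ?u ?M) t' \<and> k \<le> \<tau>)"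
    by (rule step[OF I _ u ks]) simp
  then have "wp c ?t (\<lambda>t' k. I (insert ?u ?M) t' \<and> k \<le> \<tau> \<and> keeps (mod_regs c) (mod_arrs c) ?t t')"
    by (rule wp_keeps) simp
  then have w: "wp c ?t (\<lambda>t' k'. (off y \<le> reg t' 6 \<and> reg t' 6 \<le> off (y + 1) \<and>
        I (adj ` {off y..<reg t' 6}) t' \<and> keeps ({6, 7} \<union> mod_regs c) (mod_arrs c) s t') \<and>
      (\<tau> + 20) * (off (y + 1) - reg t' 6) + k' + 18 \<le> (\<tau> + 20) * (off (y + 1) - ?i))"
  proof (rule wp_mono)
    fix t' k
    assume a: "I (insert ?u ?M) t' \<and> k \<le> \<tau> \<and> keeps (mod_regs c) (mod_arrs c) ?t t'"
    then have r: "reg t' 6 = Suc ?i" using mods by (simp add: keeps_def)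
    have "adj ` {off y..<Suc ?i} = insert ?u ?M" using 2 by (simp add: atLeastLessThanSuc)
    moreover have "off (y + 1) - ?i = Suc (off (y + 1) - Suc ?i)" using lt by simp
    moreover have "keeps ({6, 7} \<union> mod_regs c) (mod_arrs c) s t'"
      using a ks by (auto simp: keeps_def)
    ultimately show "(off y \<le> reg t' 6 \<and> reg t' 6 \<le> off (y + 1) \<and>
        I (adj ` {off y..<reg t' 6}) t' \<and> keeps ({6, 7} \<union> mod_regs c) (mod_arrs c) s t') \<and>
      (\<tau> + 20) * (off (y + 1) - reg t' 6) + k + 18 \<le> (\<tau> + 20) * (off (y + 1) - ?i)"
      using r a lt 2 by simp
  qed
  have e: "t\<lparr>reg := (reg t)(7 := ?u), reg := (reg (t\<lparr>reg := (reg t)(7 := ?u)\<rparr>))(6 := Suc ?i)\<rparr> = ?t"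
    by simp
  show ?case unfolding wp_Seq wp_Assign
    using w k by (auto simp: elim!: wp_mono)
next
  case (3 t k)
  have "reg t z = y" "arr t 0 = off" using 3 mods y g by (auto simp: keeps_def)
  then have "reg t 6 = off (y + 1)" using 3 by simp
  moreover have "off (y + 1) - off y = deg y" using deg_eq[OF y(2)] by simp
  ultimately show ?case using 3 adj_image[OF y(2)] y g by (intro exit) auto
qed

end

section \<open>Breadth-first search\<close>

text \<open>One flat loop instead of nested ones, so that a single potential bounds the time
  although heads, neighbours and roots alternate. Register 12 tells \<open>V\<close> from where
  \<open>y\<close> is visited; for a root it is 0, which is no vertex.\<close>

definition search :: "com \<Rightarrow> com" where
  "search V = (Assign 8 (N 1) ;; Assign 9 (N 1) ;; Assign 10 (N 0) ;; Assign 11 (N 0) ;;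
    While (Not (And (Not (Less (R 8) (R 9))) (Not (Less (R 11) (R 0)))))
     (If (Less (R 8) (R 9))
       (Assign 12 (Arr 10 (R 8)) ;;
        If (Less (Plus (Arr 0 (R 12)) (R 10)) (Arr 0 (Plus (R 12) (N 1))))
          (Assign 13 (Arr 1 (Plus (Arr 0 (R 12)) (R 10))) ;; Assign 10 (Plus (R 10) (N 1)) ;; V)
          (Assign 8 (Plus (R 8) (N 1)) ;; Assign 10 (N 0)))
       (Assign 11 (Plus (R 11) (N 1)) ;; Assign 13 (R 11) ;; Assign 12 (N 0) ;; V)))"

definition enqueue :: com where
  "enqueue = (Store 10 (R 9) (R 13) ;; Assign 9 (Plus (R 9) (N 1)))"

context graph_input
begin

text \<open>The contract of a visit. \<open>D\<close> holds the vertices ever put into the queue,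
  \<open>P\<close> those already scanned, and \<open>sn\<close> reads off the arrays which vertices
  need no further work. Only the first visit of \<open>y\<close> may cost time in proportion to its
  degree. A root comes with an empty queue (\<open>P = D\<close>) and with all smaller vertices
  seen.\<close>

definition visit_spec ::
  "com \<Rightarrow> (nat set \<Rightarrow> nat set \<Rightarrow> (nat \<Rightarrow> nat \<Rightarrow> nat) \<Rightarrow> bool) \<Rightarrow> ((nat \<Rightarrow> nat \<Rightarrow> nat) \<Rightarrow> nat set) \<Rightarrow> nat \<Rightarrow> bool" where
  "visit_spec V J sn \<tau> \<longleftrightarrow> (\<forall>s P D y.
     reg s 0 = n \<and> arr s 0 = off \<and> arr s 1 = adj \<and> reg s 13 = y \<and> y \<in> verts n \<and>
     1 \<le> reg s 9 \<and> (y \<notin> D \<longrightarrow> reg s 9 \<le> n) \<and> J P D (arr s) \<and> P \<subseteq> D \<and> D \<subseteq> verts n \<and>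
     (\<forall>x\<in>P. nbhd E x \<subseteq> sn (arr s)) \<and>
     (reg s 12 \<in> D - P \<and> y \<in> nbhd E (reg s 12) \<or>
      reg s 12 = 0 \<and> P = D \<and> {1..<y} \<subseteq> sn (arr s)) \<longrightarrow>
     wp V s (\<lambda>t k. k \<le> \<tau> * (1 + (if y \<in> sn (arr s) then 0 else deg y)) \<and>
       insert y (sn (arr s)) \<subseteq> sn (arr t) \<and>
       (reg t 9 = reg s 9 \<and> arr t 10 = arr s 10 \<and> J P D (arr t) \<or>
        y \<notin> D \<and> reg t 9 = Suc (reg s 9) \<and> arr t 10 = (arr s 10)(reg s 9 := y) \<and>
        J P (insert y D) (arr t))))"

lemma sum_verts_remove: "x \<in> verts n \<Longrightarrow> x \<notin> P \<Longrightarrow>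
    (\<Sum>v\<in>verts n - P. f v) = f x + (\<Sum>v\<in>verts n - insert x P. f v :: nat)"
  using sum.remove[of "verts n - P" x f] by (simp add: verts_def Diff_insert[symmetric])

lemma sum_verts_mono: "P \<subseteq> P' \<Longrightarrow> (\<Sum>v\<in>verts n - P'. f v) \<le> (\<Sum>v\<in>verts n - P. f v :: nat)"
  by (rule sum_mono2) (auto simp: verts_def)

lemma wp_search:
  assumes V: "visit_spec V J sn \<tau>"
    and mods: "mod_regs V \<inter> {0, 8, 10, 11} = {}" "mod_arrs V \<inter> {0, 1} = {}"
    and J_processed: "\<And>P D a x. J P D a \<Longrightarrow> x \<in> D - P \<Longrightarrow> nbhd E x \<subseteq> sn a \<Longrightarrow> J (insert x P) D a"
    and init: "reg s 0 = n" "arr s 0 = off" "arr s 1 = adj" "J {} {} (arr s)"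
    and exit: "\<And>t k D. J D D (arr t) \<Longrightarrow> verts n \<subseteq> sn (arr t) \<Longrightarrow> D \<subseteq> verts n \<Longrightarrow>
      (\<forall>x\<in>D. nbhd E x \<subseteq> sn (arr t)) \<Longrightarrow>
      k \<le> (\<tau> + 50) * (4 * card E + 2 * n + 1) \<Longrightarrow> Q t k"
  shows "wp (search V) s Q"
proof -
  define PP where "PP s = arr s 10 ` {1..<reg s 8}" for s :: state
  define DD where "DD s = arr s 10 ` {1..<reg s 9}" for s :: state
  define I where "I s \<longleftrightarrow> reg s 0 = n \<and> arr s 0 = off \<and> arr s 1 = adj \<and>
    1 \<le> reg s 8 \<and> reg s 8 \<le> reg s 9 \<and> inj_on (arr s 10) {1..<reg s 9} \<and> DD s \<subseteq> verts n \<and>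
    J (PP s) (DD s) (arr s) \<and> (\<forall>x\<in>PP s. nbhd E x \<subseteq> sn (arr s)) \<and>
    {1..reg s 11} \<subseteq> sn (arr s) \<and> reg s 11 \<le> n \<and>
    (if reg s 8 < reg s 9 then reg s 10 \<le> deg (arr s 10 (reg s 8)) \<and>
        adj ` {off (arr s 10 (reg s 8))..<off (arr s 10 (reg s 8)) + reg s 10} \<subseteq> sn (arr s)
     else reg s 10 = 0)" for s :: state
  \<comment> \<open>Each unscanned vertex is charged its degree for the scan and one round for its
    removal, each untried root one round, and each unseen vertex its degree once more for the first
    visit. As the degrees sum to at most \<open>2 * card E\<close>, the total is
    \<open>4 * card E + 2 * n\<close>, up to the factors.\<close>
  define \<Phi> where "\<Phi> s = (\<tau> + 50) * ((\<Sum>v\<in>verts n - PP s. deg v + 1) - reg s 10 + (n - reg s 11)) +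
    \<tau> * (\<Sum>v\<in>verts n - sn (arr s). deg v)" for s :: state
  have visit: "wp V s (\<lambda>t k. I t \<and> \<Phi> t + k + 50 \<le> \<Phi> s')"
    if y: "reg s 13 = y" "y \<in> verts n"
      and c: "reg s 0 = n" "arr s 0 = off" "arr s 1 = adj" "1 \<le> reg s 8" "reg s 8 \<le> reg s 9"
         "inj_on (arr s 10) {1..<reg s 9}" "DD s \<subseteq> verts n" "J (PP s) (DD s) (arr s)"
         "\<forall>x\<in>PP s. nbhd E x \<subseteq> sn (arr s)" "{1..<reg s 11} \<subseteq> sn (arr s)" "reg s 11 \<le> n"
      and d: "reg s 8 < reg s 9 \<and> reg s 12 = arr s 10 (reg s 8) \<and> y \<in> nbhd E (reg s 12) \<and>
           {1..reg s 11} \<subseteq> sn (arr s) \<and> 1 \<le> reg s 10 \<and>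
           reg s 10 \<le> deg (reg s 12) \<and> adj ` {off (reg s 12)..<off (reg s 12) + reg s 10} \<subseteq> insert y (sn (arr s))
         \<or> reg s 8 = reg s 9 \<and> reg s 12 = 0 \<and> y = reg s 11 \<and> reg s 10 = 0"
      and p: "(\<tau> + 50) * ((\<Sum>v\<in>verts n - PP s. deg v + 1) - reg s 10 + (n - reg s 11) + 1) +
        \<tau> * (\<Sum>v\<in>verts n - sn (arr s). deg v) \<le> \<Phi> s'"
    for s s' y
  proof -
    let ?post = "\<lambda>t k. k \<le> \<tau> * (1 + (if y \<in> sn (arr s) then 0 else deg y)) \<and>
       insert y (sn (arr s)) \<subseteq> sn (arr t) \<and>
       (reg t 9 = reg s 9 \<and> arr t 10 = arr s 10 \<and> J (PP s) (DD s) (arr t) \<or>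
        y \<notin> DD s \<and> reg t 9 = Suc (reg s 9) \<and> arr t 10 = (arr s 10)(reg s 9 := y) \<and>
        J (PP s) (insert y (DD s)) (arr t))"
    let ?scan = "reg s 8 < reg s 9 \<and> reg s 12 = arr s 10 (reg s 8) \<and> y \<in> nbhd E (reg s 12) \<and>
           {1..reg s 11} \<subseteq> sn (arr s) \<and> 1 \<le> reg s 10 \<and>
           reg s 10 \<le> deg (reg s 12) \<and> adj ` {off (reg s 12)..<off (reg s 12) + reg s 10} \<subseteq> insert y (sn (arr s))"
    have PD: "PP s \<subseteq> DD s" using c(5) by (auto simp: PP_def DD_def)
    have cardD: "card (DD s) = reg s 9 - 1" using card_image[OF c(6)] by (simp add: DD_def)
    \<comment> \<open>The queue holds distinct vertices, so a new one still fits into positions 1 to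
      \<open>n\<close>. This keeps array 10 zero elsewhere, on which the next reset relies.\<close>
    have "reg s 9 \<le> n" if "y \<notin> DD s"
    proof -
      have "card (insert y (DD s)) \<le> card (verts n)"
        by (rule card_mono) (use c y in \<open>auto simp: verts_def\<close>)
      moreover have "finite (DD s)" by (simp add: DD_def)
      ultimately show ?thesis using that cardD by (simp add: verts_def)
    qed
    moreover have "reg s 12 \<in> DD s - PP s \<and> y \<in> nbhd E (reg s 12) \<or>
        reg s 12 = 0 \<and> PP s = DD s \<and> {1..<y} \<subseteq> sn (arr s)"
      using d
    proof
      assume a: "?scan"
      then have "reg s 12 \<in> DD s" using c by (auto simp: DD_def)
      moreover have "reg s 12 \<notin> PP s"
        using a c(4) inj_onD[OF c(6), of "reg s 8"] by (fastforce simp: PP_def)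
      ultimately show ?thesis using a by blast
    qed (use c in \<open>auto simp: PP_def DD_def\<close>)
    ultimately have "wp V s ?post"
      using V[unfolded visit_spec_def, rule_format, of s y "DD s" "PP s"] y c PD by auto
    then show ?thesis
    proof (rule wp_keeps)
      fix t k
      assume a: "?post t k" and ks: "keeps (mod_regs V) (mod_arrs V) s t"
      have r: "reg t 0 = n" "reg t 8 = reg s 8" "reg t 10 = reg s 10" "reg t 11 = reg s 11"
        "arr t 0 = off" "arr t 1 = adj"
        using ks mods c by (auto simp: keeps_def)
      have q: "PP t = PP s" "inj_on (arr t 10) {1..<reg t 9}" "DD t \<subseteq> verts n" "reg s 9 \<le> reg t 9"
        "J (PP t) (DD t) (arr t)" "reg s 8 < reg s 9 \<longrightarrow> arr t 10 (reg s 8) = arr s 10 (reg s 8)"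
      proof -
        show "PP t = PP s" using a r c(5) unfolding PP_def by (intro image_cong) auto
        show "reg s 9 \<le> reg t 9" "reg s 8 < reg s 9 \<longrightarrow> arr t 10 (reg s 8) = arr s 10 (reg s 8)"
          using a by auto
        have "DD t = DD s \<and> inj_on (arr t 10) {1..<reg t 9} \<and> J (PP s) (DD t) (arr t) \<or>
          DD t = insert y (DD s) \<and> inj_on (arr t 10) {1..<reg t 9} \<and> J (PP s) (DD t) (arr t)"
        proof (cases "reg t 9 = reg s 9")
          case True then show ?thesis using a c by (auto simp: DD_def)
        next
          case False
          then have b: "y \<notin> DD s" "reg t 9 = Suc (reg s 9)" "arr t 10 = (arr s 10)(reg s 9 := y)"
            "J (PP s) (insert y (DD s)) (arr t)" using a by auto
          have e: "{1..<reg t 9} = insert (reg s 9) {1..<reg s 9}" using b c by auto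
          have im: "arr t 10 ` {1..<reg s 9} = DD s" using b by (auto simp: DD_def image_iff)
          have D: "DD t = insert y (DD s)"
            unfolding DD_def[of t] e image_insert im using b by simp
          have "inj_on (arr t 10) {1..<reg s 9}"
            using c(6) b(3) by (auto simp: inj_on_def)
          then have "inj_on (arr t 10) {1..<reg t 9}"
            unfolding e using im b by (simp add: inj_on_insert)
          then show ?thesis using D b by simp
        qed
        then show "inj_on (arr t 10) {1..<reg t 9}" "DD t \<subseteq> verts n" "J (PP t) (DD t) (arr t)"
          using \<open>PP t = PP s\<close> c(7) y by auto
      qed
      have sub: "insert y (sn (arr s)) \<subseteq> sn (arr t)" using a by blast
      have I: "I t"
      proof -
        have "{1..reg t 11} \<subseteq> sn (arr t)"
        proof (cases "y = reg s 11 \<and> reg s 8 = reg s 9")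
          case True
          then have "{1..reg t 11} \<subseteq> insert y {1..<reg s 11}" using r by auto
          then show ?thesis using sub c(10) by blast
        next
          case False then show ?thesis using d sub r by auto
        qed
        moreover have "if reg t 8 < reg t 9 then reg t 10 \<le> deg (arr t 10 (reg t 8)) \<and>
            adj ` {off (arr t 10 (reg t 8))..<off (arr t 10 (reg t 8)) + reg t 10} \<subseteq> sn (arr t)
           else reg t 10 = 0"
          using d
        proof
          assume d1: "?scan"
          then have "arr t 10 (reg t 8) = reg s 12" "reg t 8 < reg t 9" using q r by auto
          moreover have "adj ` {off (reg s 12)..<off (reg s 12) + reg s 10} \<subseteq> sn (arr t)"
            using d1 sub by (meson subset_trans)
          moreover have "reg s 10 \<le> deg (reg s 12)" using d1 by blast
          ultimately show ?thesis using r by simp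
        qed (use r in auto)
        moreover have "\<forall>x\<in>PP t. nbhd E x \<subseteq> sn (arr t)" using c(9) sub q(1) by blast
        ultimately show ?thesis unfolding I_def using r q c by simp
      qed
      have s1: "(\<Sum>v\<in>verts n - sn (arr t). deg v) + (if y \<in> sn (arr s) then 0 else deg y)
          \<le> (\<Sum>v\<in>verts n - sn (arr s). deg v)"
        using sum_verts_remove[OF y(2), of "sn (arr s)" deg] sum_verts_mono[OF sub, of deg]
          sum_verts_mono[of "sn (arr s)" "sn (arr t)" deg] sub by auto
      have "\<tau> * (\<Sum>v\<in>verts n - sn (arr t). deg v) + \<tau> * (if y \<in> sn (arr s) then 0 else deg y)
          \<le> \<tau> * (\<Sum>v\<in>verts n - sn (arr s). deg v)"
        using mult_le_mono2[OF s1, of \<tau>] by (simp only: distrib_left)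
      moreover have "k \<le> \<tau> + \<tau> * (if y \<in> sn (arr s) then 0 else deg y)"
        using a by (simp add: distrib_left)
      ultimately have "\<Phi> t + k + 50 \<le> \<Phi> s'"
        using p unfolding \<Phi>_def q(1) r by (simp only: distrib_left mult_1_right)
      then show "I t \<and> \<Phi> t + k + 50 \<le> \<Phi> s'" using I by blast
    qed
  qed
  show ?thesis unfolding search_def wp_Seq wp_Assign
  proof (rule wp_while[where I = I and \<Phi> = \<Phi>], goal_cases)
    case 1
    then show ?case using init by (simp add: I_def PP_def DD_def)
  next
    case (2 s)
    note I = 2(1)[unfolded I_def]
    show ?case
    proof (cases "reg s 8 < reg s 9")
      case True
      let ?x = "arr s 10 (reg s 8)"
      have x: "?x \<in> verts n" using I True by (auto simp: DD_def)
      have xD: "?x \<in> DD s - PP s"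
        using I True inj_onD[of "arr s 10" "{1..<reg s 9}" "reg s 8"] by (fastforce simp: DD_def PP_def)
      have j: "reg s 10 \<le> deg ?x" using I True by simp
      \<comment> \<open>The share of the head is split off: \<open>deg ?x\<close> rounds that scan a
        neighbour and one that removes the head.\<close>
      have sm: "(\<Sum>v\<in>verts n - PP s. deg v + 1) = deg ?x + 1 + (\<Sum>v\<in>verts n - insert ?x (PP s). deg v + 1)"
        using sum_verts_remove[OF x, of "PP s" "\<lambda>v. deg v + 1"] xD by simp
      show ?thesis
      proof (cases "off ?x + reg s 10 < off (?x + 1)")
        case lt: True
        let ?y = "adj (off ?x + reg s 10)"
        let ?s = "s\<lparr>reg := (reg s)(12 := ?x, 13 := ?y, 10 := Suc (reg s 10))\<rparr>"
        have y: "?y \<in> nbhd E ?x" using lt adj_image[OF x] by force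
        then have yv: "?y \<in> verts n" using nbhd_verts by blast
        have dx: "Suc (reg s 10) \<le> deg ?x" using lt deg_eq[OF x] by simp
        have img: "adj ` {off ?x..<off ?x + Suc (reg s 10)} = insert ?y (adj ` {off ?x..<off ?x + reg s 10})"
          by (simp add: atLeastLessThanSuc)
        have eqs: "PP ?s = PP s" "DD ?s = DD s" by (simp_all add: PP_def DD_def)
        have "wp V ?s (\<lambda>t k. I t \<and> \<Phi> t + k + 50 \<le> \<Phi> s)"
        proof (rule visit[of _ ?y])
          have regs: "reg ?s 10 = Suc (reg s 10)" "reg ?s 11 = reg s 11" "arr ?s = arr s" by simp_all
          have e: "(\<Sum>v\<in>verts n - PP s. deg v + 1) - Suc (reg s 10) + (n - reg s 11) + 1
            = (\<Sum>v\<in>verts n - PP s. deg v + 1) - reg s 10 + (n - reg s 11)"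
            using sm dx by simp
          show "(\<tau> + 50) * ((\<Sum>v\<in>verts n - PP ?s. deg v + 1) - reg ?s 10 + (n - reg ?s 11) + 1) +
            \<tau> * (\<Sum>v\<in>verts n - sn (arr ?s). deg v) \<le> \<Phi> s"
            unfolding eqs \<Phi>_def regs e by (rule le_refl)
        qed (use I y yv dx img eqs True in auto)
        then show ?thesis
          using True I lt by (auto simp: wp_If wp_Seq wp_Assign fun_upd_twist elim!: wp_mono)
      next
        case ge: False
        let ?s = "s\<lparr>reg := (reg s)(12 := ?x, 8 := Suc (reg s 8), 10 := 0)\<rparr>"
        have jd: "reg s 10 = deg ?x" using ge deg_eq[OF x] j by simp
        have nb: "nbhd E ?x \<subseteq> sn (arr s)"
          using I True jd deg_eq[OF x] adj_image[OF x] by simp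
        have eqs: "PP ?s = insert ?x (PP s)" "DD ?s = DD s"
        proof -
          have "{1..<Suc (reg s 8)} = insert (reg s 8) {1..<reg s 8}" using I by auto
          then show "PP ?s = insert ?x (PP s)" by (simp add: PP_def)
        qed (simp add: DD_def)
        have "J (insert ?x (PP s)) (DD s) (arr s)" using J_processed[OF _ xD nb] I by blast
        then have "I ?s" using I True nb eqs by (auto simp: I_def)
        moreover have "\<Phi> ?s + (\<tau> + 50) \<le> \<Phi> s"
        proof -
          have "(\<Sum>v\<in>verts n - PP s. deg v + 1) - reg s 10 + (n - reg s 11) =
            (\<Sum>v\<in>verts n - PP ?s. deg v + 1) - reg ?s 10 + (n - reg ?s 11) + 1"
            using sm jd eqs by simp
          then show ?thesis unfolding \<Phi>_def by (simp add: distrib_left)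
        qed
        ultimately show ?thesis
          using True I ge by (simp add: wp_If wp_Seq wp_Assign)
      qed
    next
      case False
      let ?y = "Suc (reg s 11)"
      let ?s = "s\<lparr>reg := (reg s)(11 := ?y, 13 := ?y, 12 := 0)\<rparr>"
      have lt: "reg s 11 < n" using 2(2) I False by simp
      have q: "reg s 8 = reg s 9" "reg s 10 = 0" using I False by auto
      have eqs: "PP ?s = PP s" "DD ?s = DD s" by (simp_all add: PP_def DD_def)
      have "{1..<?y} = {1..reg s 11}" by auto
      moreover have "wp V ?s (\<lambda>t k. I t \<and> \<Phi> t + k + 50 \<le> \<Phi> s)"
      proof (rule visit[of _ ?y])
        have regs: "reg ?s 10 = reg s 10" "reg ?s 11 = ?y" "arr ?s = arr s" by simp_all
        have e: "a + (n - ?y) + 1 = a + (n - reg s 11)" for a using lt by simp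
        show "(\<tau> + 50) * ((\<Sum>v\<in>verts n - PP ?s. deg v + 1) - reg ?s 10 + (n - reg ?s 11) + 1) +
            \<tau> * (\<Sum>v\<in>verts n - sn (arr ?s). deg v) \<le> \<Phi> s"
          unfolding eqs \<Phi>_def regs e by (rule le_refl)
      qed (use I q eqs lt calculation in \<open>auto simp: verts_def\<close>)
      ultimately show ?thesis
        using False I by (auto simp: wp_If wp_Seq wp_Assign fun_upd_twist elim!: wp_mono)
    qed
  next
    case (3 t k)
    let ?s = "s\<lparr>reg := (reg s)(8 := 1, 9 := 1, 10 := 0, 11 := 0)\<rparr>"
    note I = 3(1)[unfolded I_def]
    have e: "reg t 8 = reg t 9" "reg t 11 = n" using 3 I by auto
    then have PD: "PP t = DD t" by (simp add: PP_def DD_def)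
    have "(\<Sum>v\<in>verts n - PP ?s. deg v + 1) \<le> 2 * card E + n"
      using sum_deg by (simp add: PP_def sum_Suc verts_def)
    then have "(\<tau> + 50) * ((\<Sum>v\<in>verts n - PP ?s. deg v + 1) - reg ?s 10 + (n - reg ?s 11)) \<le>
      (\<tau> + 50) * (2 * card E + n + n)" by (intro mult_le_mono) auto
    moreover have "\<tau> * (\<Sum>v\<in>verts n - sn (arr s). deg v) \<le> (\<tau> + 50) * (2 * card E)"
      using sum_verts_mono[of "{}" "sn (arr s)" deg] sum_deg by (intro mult_le_mono) auto
    ultimately have "\<Phi> ?s + (\<tau> + 50) \<le> (\<tau> + 50) * (4 * card E + 2 * n + 1)"
      by (simp add: \<Phi>_def distrib_left)
    then show ?case
      using 3(3) I e PD by (intro exit[of "DD t"]) (auto simp: fun_upd_twist verts_def)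
  qed
qed

end

section \<open>Components and their classes\<close>

definition visit_colour :: com where
  "visit_colour = If (And (Not (Eq (Arr 6 (R 13)) (N 0))) (Eq (Arr 7 (R 13)) (N 0)))
    (If (Eq (R 12) (N 0))
       (Store 7 (R 13) (R 13) ;; Store 8 (R 13) (N 0))
       (Store 7 (R 13) (Arr 7 (R 12)) ;; Store 8 (R 13) (Minus (N 1) (Arr 8 (R 12)))) ;;
     enqueue)
    Skip"

definition ind :: "nat set \<Rightarrow> nat \<Rightarrow> nat" where
  "ind X = (\<lambda>v. if v \<in> X then 1 else 0)"

lemma ind_simps [simp]: "ind X v = 0 \<longleftrightarrow> v \<notin> X" "ind X v = 1 \<longleftrightarrow> v \<in> X" "ind X v = Suc 0 \<longleftrightarrow> v \<in> X"
  "0 < ind X v \<longleftrightarrow> v \<in> X"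
  by (auto simp: ind_def)

lemma ind_insert: "(ind X)(v := Suc 0) = ind (insert v X)"
  by (auto simp: ind_def)

lemma ind_remove: "(ind X)(v := 0) = ind (X - {v})"
  by (auto simp: ind_def)

definition coloured :: "nat set set \<Rightarrow> nat set \<Rightarrow> (nat \<Rightarrow> nat \<Rightarrow> nat) \<Rightarrow> bool" where
  "coloured E X a \<longleftrightarrow> (\<forall>v. a 7 v \<noteq> 0 \<longleftrightarrow> v \<in> X) \<and> (\<forall>v\<in>X. a 7 v \<in> X) \<and> a 8 = ind (side E X 1) \<and>
    (\<forall>u\<in>X. \<forall>v\<in>X. a 7 u = a 7 v \<longleftrightarrow> (u, v) \<in> conn E X)"

definition queue_clean :: "nat \<Rightarrow> (nat \<Rightarrow> nat) \<Rightarrow> bool" where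
  "queue_clean n q \<longleftrightarrow> (\<forall>i. i \<notin> verts n \<longrightarrow> q i = 0)"

context graph_input
begin

text \<open>Roots are tried by increasing label, so each root is the least vertex of its component.
  Giving it class 0 therefore produces the canonical bipartition, and as representative it separates
  the components.\<close>

lemma wp_colour:
  assumes X: "X \<subseteq> verts n" "bipartite E X"
    and s: "reg s 0 = n" "arr s 0 = off" "arr s 1 = adj" "arr s 6 = ind X"
      "arr s 7 = (\<lambda>_. 0)" "arr s 8 = (\<lambda>_. 0)" "arr s 10 = (\<lambda>_. 0)"
  shows "wp (search visit_colour) s (\<lambda>t k. k \<le> 100 * (4 * card E + 2 * n + 1) \<and>
    arr t 6 = ind X \<and> coloured E X (arr t) \<and> queue_clean n (arr t 10))"
proof -
  obtain X0 X1 where cb: "canonical_bipartition E X X0 X1" using canonical_exists[OF X(2)] by blast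
  then have bp: "bipartition E X X0 X1" by (simp add: canonical_bipartition_def)
  define good where "good a v \<longleftrightarrow> v \<in> X \<and> a 8 v = ind X1 v \<and> a 7 v \<in> X \<and> (a 7 v, v) \<in> conn E X \<and>
      (\<forall>u\<in>X. (u, v) \<in> conn E X \<longrightarrow> a 7 v \<le> u)" for a :: "nat \<Rightarrow> nat \<Rightarrow> nat" and v
  define J where "J P D a \<longleftrightarrow> a 6 = ind X \<and> D = {v. a 7 v \<noteq> 0} \<and> (\<forall>v\<in>D. good a v) \<and>
    (\<forall>v. v \<notin> D \<longrightarrow> a 8 v = 0) \<and> queue_clean n (a 10)"
    for P D :: "nat set" and a :: "nat \<Rightarrow> nat \<Rightarrow> nat"
  \<comment> \<open>Vertices outside \<open>X\<close> count as seen from the start, because a visit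
    leaves them alone.\<close>
  define sn where "sn a = {v. a 6 v = 0 \<or> a 7 v \<noteq> 0}" for a :: "nat \<Rightarrow> nat \<Rightarrow> nat"
  have V: "visit_spec visit_colour J sn 50"
    unfolding visit_spec_def
  proof (intro allI impI, elim conjE)
    fix s :: state and P D y
    assume a: "y \<in> verts n" "reg s 13 = y" "1 \<le> reg s 9" "y \<notin> D \<longrightarrow> reg s 9 \<le> n"
      and j: "J P D (arr s)" and cl: "\<forall>x\<in>P. nbhd E x \<subseteq> sn (arr s)"
      and c: "reg s 12 \<in> D - P \<and> y \<in> nbhd E (reg s 12) \<or>
        reg s 12 = 0 \<and> P = D \<and> {1..<y} \<subseteq> sn (arr s)"
    have y0: "0 < y" using a by (simp add: verts_def)
    have a6: "arr s 6 = ind X" and D: "D = {v. arr s 7 v \<noteq> 0}" using j by (auto simp: J_def)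
    have qc: "queue_clean n (arr s 10)" using j by (simp add: J_def)
    have qc': "queue_clean n ((arr s 10)(reg s 9 := y))" if "y \<notin> D"
      using qc a that by (auto simp: queue_clean_def verts_def)
    have upd: "J P (insert y D) a'"
      if yD: "y \<in> X" "y \<notin> D" and r: "a' 6 = arr s 6" "a' 7 = (arr s 7)(y := \<rho>)" "a' 8 = (arr s 8)(y := ind X1 y)"
        "a' 10 = (arr s 10)(reg s 9 := y)" "\<rho> \<noteq> 0" "\<rho> \<in> X" "(\<rho>, y) \<in> conn E X"
        "\<And>u. u \<in> X \<Longrightarrow> (u, y) \<in> conn E X \<Longrightarrow> \<rho> \<le> u" for \<rho> a'
    proof -
      have "good a' v" if "v \<in> insert y D" for v
      proof (cases "v = y")
        case True then show ?thesis using r yD by (simp add: good_def)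
      next
        case False
        then have "good (arr s) v" using that j by (auto simp: J_def)
        then show ?thesis using False r by (simp add: good_def)
      qed
      then show ?thesis using j r qc'[OF yD(2)] D by (auto simp: J_def)
    qed
    show "wp visit_colour s (\<lambda>t k. k \<le> 50 * (1 + (if y \<in> sn (arr s) then 0 else deg y)) \<and>
       insert y (sn (arr s)) \<subseteq> sn (arr t) \<and>
       (reg t 9 = reg s 9 \<and> arr t 10 = arr s 10 \<and> J P D (arr t) \<or>
        y \<notin> D \<and> reg t 9 = Suc (reg s 9) \<and> arr t 10 = (arr s 10)(reg s 9 := y) \<and>
        J P (insert y D) (arr t)))"
    proof (cases "y \<in> X \<and> arr s 7 y = 0")
      case False
      then show ?thesis using j a a6
        by (auto simp: visit_colour_def wp_simps sn_def)
    next
      case True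
      then have yD: "y \<notin> D" using D by simp
      show ?thesis
      proof (cases "reg s 12 = 0")
        case x0: True
        have PD: "P = D" "{1..<y} \<subseteq> sn (arr s)" using c x0 j X by (auto simp: J_def good_def verts_def)
        \<comment> \<open>A smaller \<open>u\<close> in the component of \<open>y\<close> would
          already be discovered. When a root is tried, all discovered vertices are scanned, so the
          whole component, and with it \<open>y\<close>, would have been coloured.\<close>
        have least: "y \<le> u" if u: "u \<in> X" "(u, y) \<in> conn E X" for u
        proof (rule ccontr)
          assume "\<not> y \<le> u"
          then have "u \<in> {1..<y}" using u X(1) by (auto simp: verts_def)
          then have "u \<in> sn (arr s)" using PD(2) by blast
          then have "u \<in> D" using u a6 D by (simp add: sn_def)
          then have "y \<in> D"
            by (rule conn_closed[OF u(2)])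
              (use cl PD(1) D a6 in \<open>auto simp: nbhd_def sn_def insert_commute\<close>)
          then show False using yD by simp
        qed
        then have "y \<in> X0" using cb True unfolding canonical_bipartition_def by blast
        then have "ind X1 y = 0" using bp by (auto simp: bipartition_def)
        then have "J P (insert y D) ((arr s)(7 := (arr s 7)(y := y), 8 := (arr s 8)(y := 0), 10 := (arr s 10)(reg s 9 := y)))"
          by (intro upd[of _ y]) (use True yD y0 least in auto)
        then show ?thesis using x0 True a a6 yD y0
          by (auto simp: visit_colour_def enqueue_def wp_simps sn_def)
      next
        case x0: False
        then have x: "reg s 12 \<in> D" "{y, reg s 12} \<in> E" using c by (auto simp: nbhd_def)
        then have g: "good (arr s) (reg s 12)" using j by (auto simp: J_def)
        have e: "(reg s 12, y) \<in> conn E X"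
          using g x True by (auto intro!: conn_edge simp: good_def insert_commute)
        have "ind X1 y = 1 - arr s 8 (reg s 12)"
          using g bipartition_edge[OF bp, of y "reg s 12"] x True bp
          by (auto simp: good_def ind_def bipartition_def)
        then have col: "ind X1 y = Suc 0 - arr s 8 (reg s 12)" by simp
        let ?\<rho> = "arr s 7 (reg s 12)"
        have "J P (insert y D) ((arr s)(7 := (arr s 7)(y := ?\<rho>), 8 := (arr s 8)(y := Suc 0 - arr s 8 (reg s 12)),
            10 := (arr s 10)(reg s 9 := y)))"
        proof (rule upd[of _ ?\<rho>])
          show "(?\<rho>, y) \<in> conn E X" using g e conn_trans by (auto simp: good_def)
          show "?\<rho> \<le> u" if "u \<in> X" "(u, y) \<in> conn E X" for u
            using g that conn_trans[OF that(2) conn_sym[OF e]] by (auto simp: good_def)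
        qed (use True yD col g x D in \<open>auto simp: good_def\<close>)
        moreover have "y \<noteq> reg s 12" using x yD by blast
        ultimately show ?thesis using x0 True a a6 yD x D
          by (auto simp: visit_colour_def enqueue_def wp_simps sn_def)
      qed
    qed
  qed
  show ?thesis
  proof (rule wp_search[OF V])
    show "J {} {} (arr s)" using s by (simp add: J_def queue_clean_def)
  next
    fix t k D
    assume j: "J D D (arr t)" and sn: "verts n \<subseteq> sn (arr t)" and k: "k \<le> (50 + 50) * (4 * card E + 2 * n + 1)"
    have "D = X" using j sn X by (auto simp: J_def sn_def good_def)
    have g: "good (arr t) v" if "v \<in> X" for v using j that \<open>D = X\<close> by (auto simp: J_def)
    have D: "{v. arr t 7 v \<noteq> 0} = X" using j \<open>D = X\<close> by (simp add: J_def)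
    have "arr t 8 = ind (side E X 1)"
    proof
      fix v show "arr t 8 v = ind (side E X 1) v"
        using j g[of v] bp \<open>D = X\<close> side_eq[OF cb] by (cases "v \<in> X") (auto simp: J_def good_def bipartition_def ind_def)
    qed
    moreover have "arr t 7 u = arr t 7 v \<longleftrightarrow> (u, v) \<in> conn E X" if "u \<in> X" "v \<in> X" for u v
    proof
      assume "arr t 7 u = arr t 7 v"
      then show "(u, v) \<in> conn E X" using g that conn_trans conn_sym unfolding good_def by metis
    next
      assume c: "(u, v) \<in> conn E X"
      then have "(arr t 7 u, v) \<in> conn E X" "(arr t 7 v, u) \<in> conn E X"
        using g that conn_trans conn_sym unfolding good_def by metis+
      then show "arr t 7 u = arr t 7 v" using g that unfolding good_def by (meson le_antisym)
    qed
    ultimately show "k \<le> 100 * (4 * card E + 2 * n + 1) \<and> arr t 6 = ind X \<and> coloured E X (arr t) \<and>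
        queue_clean n (arr t 10)"
      using j k D g by (auto simp: coloured_def J_def good_def)
  qed (use s in \<open>auto simp: visit_colour_def enqueue_def J_def\<close>)
qed

end

section \<open>Greedy extension: invariant\<close>

text \<open>\<open>S\<close> is the current vertex set, \<open>Z\<close> the set of tested vertices, \<open>P\<close> the set of processed ones.
  \<open>W\<close> is a union of components of \<open>G[S]\<close>: those that the search has reached. The other
  components are those of the initial set and are told apart by \<open>\<rho>\<close>.\<close>

locale grow_inv =
  fixes n :: nat and E :: "nat set set" and A S Z P W :: "nat set" and ec :: "nat \<Rightarrow> bool" and \<rho> :: "nat \<Rightarrow> nat"
  assumes initial: "A \<subseteq> S"
    and in_verts: "S \<subseteq> verts n"
    and grown: "(A, S) \<in> (grow n E)\<^sup>*"
    and proper: "u \<in> S \<Longrightarrow> w \<in> S \<Longrightarrow> {u, w} \<in> E \<Longrightarrow> ec u \<noteq> ec w"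
    and reached_subset: "W \<subseteq> S"
    and reached_closed: "u \<in> W \<Longrightarrow> w \<in> S \<Longrightarrow> {u, w} \<in> E \<Longrightarrow> w \<in> W"
    and representative: "u \<in> S \<Longrightarrow> \<rho> u \<in> S"
    and reached_component: "u \<in> W \<Longrightarrow> w \<in> S \<Longrightarrow> \<rho> u = \<rho> w \<Longrightarrow> w \<in> W"
    and unreached_component: "u \<in> S \<Longrightarrow> u \<notin> W \<Longrightarrow> w \<in> S \<Longrightarrow> w \<notin> W \<Longrightarrow> \<rho> u = \<rho> w \<longleftrightarrow> (u, w) \<in> conn E S"
    and tested: "u \<in> Z \<Longrightarrow> u \<in> W \<or> u \<notin> S \<and> \<not> bipartite E (insert u S)"
    and processed: "P \<subseteq> Z \<inter> S"
    and pending_conn: "u \<in> W \<Longrightarrow> u \<notin> P \<Longrightarrow> w \<in> W \<Longrightarrow> w \<notin> P \<Longrightarrow> (u, w) \<in> conn E S"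
    and reached_from: "u \<in> W \<Longrightarrow> \<exists>w\<in>Z \<inter> S. (u, w) \<in> conn E S"

lemmas grow_invD = grow_inv.initial grow_inv.in_verts grow_inv.grown grow_inv.proper
  grow_inv.reached_subset grow_inv.reached_closed grow_inv.representative grow_inv.reached_component
  grow_inv.unreached_component grow_inv.tested grow_inv.processed grow_inv.pending_conn grow_inv.reached_from

lemma two_colouring: "(\<And>u w. u \<in> S \<Longrightarrow> w \<in> S \<Longrightarrow> {u, w} \<in> E \<Longrightarrow> ec u \<noteq> ec w) \<Longrightarrow>
    bipartition E S {u \<in> S. ec u} {u \<in> S. \<not> ec u}"
  unfolding bipartition_def edgeless_def by blast

context graph_input
begin

lemma edge_sym: "{u, w} \<in> E \<longleftrightarrow> {w, u} \<in> E"
  by (simp add: insert_commute)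

text \<open>When the queue is empty, \<open>P\<close> is closed under the edges of
  \<open>G[S]\<close>, and every reached vertex is connected to a tested member of \<open>S\<close>,
  hence to \<open>P\<close>. So nothing is pending when a root is tried.\<close>

lemma grow_inv_reached_processed:
  assumes g: "grow_inv n E A S Z P W ec \<rho>" and cl: "\<forall>x\<in>P. nbhd E x \<subseteq> Z" and P: "P = Z \<inter> S"
  shows "W \<subseteq> P"
proof
  fix u assume "u \<in> W"
  then obtain w where w: "w \<in> P" "(w, u) \<in> conn E S" using grow_invD(13)[OF g] P conn_sym by blast
  show "u \<in> P" by (rule conn_closed[OF w(2,1)]) (use cl P edge_sym in \<open>auto simp: nbhd_def\<close>)
qed

text \<open>A member of \<open>S\<close> met from a pending vertex is already in \<open>W\<close>,
  so \<open>W\<close> does not change. A root is outside \<open>W\<close> and brings in exactly its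
  component; as the old \<open>W\<close> is processed, the pending vertices again lie in one
  component.\<close>

lemma grow_inv_visit_member:
  assumes g: "grow_inv n E A S Z P W ec \<rho>" and cl: "\<forall>x\<in>P. nbhd E x \<subseteq> Z"
    and y: "y \<in> S" "y \<notin> Z"
    and c: "(\<exists>x\<in>Z \<inter> S - P. y \<in> nbhd E x) \<or> P = Z \<inter> S"
  shows "grow_inv n E A S (insert y Z) P (W \<union> {u \<in> S. \<rho> u = \<rho> y}) ec \<rho>"
  using c
proof
  assume "\<exists>x\<in>Z \<inter> S - P. y \<in> nbhd E x"
  then obtain x where x: "x \<in> Z" "x \<in> S" "y \<in> nbhd E x" by blast
  then have "x \<in> W" using grow_invD(10)[OF g] by blast
  then have "y \<in> W" using grow_invD(6)[OF g] x y edge_sym by (auto simp: nbhd_def)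
  then have "W \<union> {u \<in> S. \<rho> u = \<rho> y} = W" using grow_invD(8)[OF g, of y] by auto
  then have e: "W \<union> {u \<in> S. \<rho> u = \<rho> y} = W" .
  show ?thesis unfolding e
  proof (rule grow_inv.intro)
    show "u \<in> W \<or> u \<notin> S \<and> \<not> bipartite E (insert u S)" if "u \<in> insert y Z" for u
      using that grow_invD(10)[OF g, of u] \<open>y \<in> W\<close> by blast
    show "\<exists>w\<in>insert y Z \<inter> S. (u, w) \<in> conn E S" if "u \<in> W" for u
      using grow_invD(13)[OF g that] by blast
    show "P \<subseteq> insert y Z \<inter> S" using grow_invD(11)[OF g] by blast
  qed (rule grow_invD[OF g]; assumption)+
next
  assume P: "P = Z \<inter> S"
  have WP: "W \<subseteq> P" by (rule grow_inv_reached_processed[OF g cl P])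
  have yW: "y \<notin> W" using WP P y by blast
  let ?C = "{u \<in> S. \<rho> u = \<rho> y}"
  have CW: "?C \<inter> W = {}" using grow_invD(8)[OF g] y yW by fastforce
  have C: "(u, w) \<in> conn E S" if "u \<in> ?C" "w \<in> ?C" for u w
    using grow_invD(9)[OF g, of u w] that CW by auto
  show ?thesis
  proof (rule grow_inv.intro)
    show "A \<subseteq> S" "S \<subseteq> verts n" "(A, S) \<in> (grow n E)\<^sup>*" by (rule grow_invD[OF g])+
  next
    fix u w assume "u \<in> S" "w \<in> S" "{u, w} \<in> E"
    then show "ec u \<noteq> ec w" by (rule grow_invD(4)[OF g])
  next
    fix u w assume uw: "u \<in> W \<union> ?C" "w \<in> S" "{u, w} \<in> E"
    show "w \<in> W \<union> ?C"
    proof (cases "u \<in> W")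
      case True then show ?thesis using grow_invD(6)[OF g] uw by blast
    next
      case False
      then have u: "u \<in> S" "\<rho> u = \<rho> y" using uw by auto
      have "w \<notin> W" using grow_invD(6)[OF g, of w u] uw u False edge_sym by blast
      then have "\<rho> u = \<rho> w" using grow_invD(9)[OF g, of u w] uw u False by (auto intro: conn_edge)
      then show ?thesis using uw u by auto
    qed
  next
    fix u assume "u \<in> W \<union> ?C"
    then show "\<exists>w\<in>insert y Z \<inter> S. (u, w) \<in> conn E S" using grow_invD(13)[OF g, of u] C[of u y] y by blast
  next
    fix u w assume "u \<in> W \<union> ?C" "u \<notin> P" "w \<in> W \<union> ?C" "w \<notin> P"
    then show "(u, w) \<in> conn E S" using WP C by blast
  next
    fix u w assume "u \<in> W \<union> ?C" "w \<in> S" "\<rho> u = \<rho> w"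
    then show "w \<in> W \<union> ?C" using grow_invD(8)[OF g, of u w] by auto
  next
    fix u w assume "u \<in> S" "u \<notin> W \<union> ?C" "w \<in> S" "w \<notin> W \<union> ?C"
    then show "\<rho> u = \<rho> w \<longleftrightarrow> (u, w) \<in> conn E S" using grow_invD(9)[OF g, of u w] by blast
  next
    fix u assume "u \<in> insert y Z"
    then show "u \<in> W \<union> ?C \<or> u \<notin> S \<and> \<not> bipartite E (insert u S)"
      using grow_invD(10)[OF g, of u] y by blast
  qed (use grow_invD(5,7)[OF g] P in auto)
qed

text \<open>As \<open>y\<close> is untested, none of its neighbours is processed. So
  \<open>u\<close> and \<open>w\<close> are connected in \<open>G[S]\<close>, by
  \<open>pending_conn\<close> if they are reached and by \<open>\<rho>\<close> otherwise, and their
  different colours close an odd cycle through \<open>y\<close>.\<close>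

lemma grow_inv_reject:
  assumes g: "grow_inv n E A S Z P W ec \<rho>" and cl: "\<forall>x\<in>P. nbhd E x \<subseteq> Z"
    and y: "y \<notin> S" "y \<notin> Z"
    and uw: "u \<in> nbhd E y \<inter> S" "w \<in> nbhd E y \<inter> S" "ec u \<noteq> ec w"
      "u \<in> W \<and> w \<in> W \<or> u \<notin> W \<and> w \<notin> W \<and> \<rho> u = \<rho> w"
  shows "grow_inv n E A S (insert y Z) P W ec \<rho>"
proof -
  have np: "x \<notin> P" if "x \<in> nbhd E y" for x using cl that y nbhd_sym by blast
  have c: "(u, w) \<in> conn E S"
    using uw(4) grow_invD(12)[OF g, of u w] grow_invD(9)[OF g, of u w] uw(1,2) np by auto
  have "\<not> bipartite E (insert y S)"
  proof
    assume "bipartite E (insert y S)"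
    then obtain X Y where XY: "bipartition E (insert y S) X Y" by (auto simp: bipartite_def)
    have e: "{u, y} \<in> E" "{w, y} \<in> E" "u \<in> S" "w \<in> S" using uw by (auto simp: nbhd_def)
    then have "u \<in> X \<longleftrightarrow> w \<in> X"
      using bipartition_edge[OF XY, of u y] bipartition_edge[OF XY, of w y] by simp
    moreover have "bipartition E S (X \<inter> S) (Y \<inter> S)"
      using XY unfolding bipartition_def edgeless_def by blast
    moreover have "bipartition E S {u \<in> S. ec u} {u \<in> S. \<not> ec u}"
      by (rule two_colouring) (rule grow_invD(4)[OF g])
    ultimately show False
      using bipartition_conn[OF _ _ c] e uw(3) by blast
  qed
  then have rejected: "u \<in> W \<or> u \<notin> S \<and> \<not> bipartite E (insert u S)" if "u \<in> insert y Z" for u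
    using grow_invD(10)[OF g, of u] y that by blast
  show ?thesis
  proof (rule grow_inv.intro)
    show "u \<in> W \<or> u \<notin> S \<and> \<not> bipartite E (insert u S)" if "u \<in> insert y Z" for u
      by (rule rejected[OF that])
    show "\<exists>w\<in>insert y Z \<inter> S. (u, w) \<in> conn E S" if "u \<in> W" for u
      using grow_invD(13)[OF g that] by blast
    show "P \<subseteq> insert y Z \<inter> S" using grow_invD(11)[OF g] by blast
  qed (rule grow_invD[OF g]; assumption)+
qed

text \<open>All components that \<open>y\<close> meets become reached. Their representatives are not
  unified: \<open>\<rho>\<close> has to tell components apart only outside \<open>W\<close>. The new
  representative \<open>y\<close> is fresh, since those of old members lie in
  \<open>S\<close>.\<close>

lemma grow_inv_add:
  assumes g: "grow_inv n E A S Z P W ec \<rho>" and cl: "\<forall>x\<in>P. nbhd E x \<subseteq> Z"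
    and y: "y \<notin> S" "y \<notin> Z" "y \<in> verts n"
    and c: "(\<exists>x\<in>Z \<inter> S - P. y \<in> nbhd E x) \<or> P = Z \<inter> S"
    and col: "\<And>u. u \<in> nbhd E y \<inter> S \<Longrightarrow> ec u \<noteq> b"
  shows "grow_inv n E A (insert y S) (insert y Z) P
    (insert y (W \<union> {u \<in> S. \<exists>w\<in>nbhd E y \<inter> S. \<rho> u = \<rho> w})) (ec(y := b)) (\<rho>(y := y))"
proof -
  let ?S = "insert y S" and ?C = "{u \<in> S. \<exists>w\<in>nbhd E y \<inter> S. \<rho> u = \<rho> w}"
  let ?W = "insert y (W \<union> ?C)"
  have ny: "{y} \<notin> E" by (rule simple_graph_no_loop[OF simple])
  have mono: "conn E S \<subseteq> conn E ?S" by (rule conn_mono) blast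
  have proper: "(ec(y := b)) u \<noteq> (ec(y := b)) w" if "u \<in> ?S" "w \<in> ?S" "{u, w} \<in> E" for u w
    using that grow_invD(4)[OF g, of u w] col[of u] col[of w] ny y by (auto simp: nbhd_def insert_commute)
  have "(S, ?S) \<in> grow n E"
  proof -
    have "bipartition E ?S {u \<in> ?S. (ec(y := b)) u} {u \<in> ?S. \<not> (ec(y := b)) u}"
      by (rule two_colouring) (rule proper)
    then show ?thesis using y unfolding grow_def bipartite_def by blast
  qed
  then have gr: "(A, ?S) \<in> (grow n E)\<^sup>*" using grow_invD(3)[OF g] by (rule rtrancl_into_rtrancl[rotated])
  have closed: "w \<in> ?W" if h: "u \<in> ?W" "u \<in> ?S" "w \<in> ?S" "{u, w} \<in> E" for u w
  proof -
    consider "u = y" | "w = y" | "u \<in> S" "w \<in> S" "u \<in> W" | "u \<in> S" "w \<in> S" "u \<in> ?C" "u \<notin> W"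
      using h by blast
    then show ?thesis
    proof cases
      case 1 then show ?thesis using h edge_sym by (auto simp: nbhd_def)
    next
      case 3 then show ?thesis using grow_invD(6)[OF g] h by blast
    next
      case 4
      then have "w \<notin> W" using grow_invD(6)[OF g] h edge_sym by blast
      then have "\<rho> u = \<rho> w" using grow_invD(9)[OF g, of u w] h 4 by (auto intro: conn_edge)
      moreover obtain v where "v \<in> nbhd E y \<inter> S" "\<rho> u = \<rho> v" using 4(3) by blast
      ultimately have "\<exists>v\<in>nbhd E y \<inter> S. \<rho> w = \<rho> v" by metis
      then show ?thesis using 4(2) by blast
    qed simp
  qed
  have id: "(\<rho>(y := y)) u = (\<rho>(y := y)) w \<longleftrightarrow> u = y \<and> w = y \<or> u \<noteq> y \<and> w \<noteq> y \<and> \<rho> u = \<rho> w"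
    if "u \<in> ?S" "w \<in> ?S" for u w
  proof -
    have "\<rho> v \<noteq> y" if "v \<in> S" for v using grow_invD(7)[OF g that] y(1) by metis
    then show ?thesis using that by (cases "u = y"; cases "w = y") fastforce+
  qed
  have idW: "w \<in> ?W" if "u \<in> ?S" "w \<in> ?S" "(\<rho>(y := y)) u = (\<rho>(y := y)) w" and uW: "u \<in> ?W" for u w
  proof (cases "u = y")
    case True
    then show ?thesis using that id[of u w] by blast
  next
    case False
    then have uw: "u \<in> S" "w \<in> S" "\<rho> u = \<rho> w" using that id[of u w] by blast+
    show ?thesis
    proof (cases "u \<in> W")
      case True then show ?thesis using grow_invD(8)[OF g True uw(2,3)] by blast
    next
      case F: False
      then obtain v where "v \<in> nbhd E y \<inter> S" "\<rho> u = \<rho> v" using uW F False by blast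
      then have "\<exists>v\<in>nbhd E y \<inter> S. \<rho> w = \<rho> v" using uw(3) by metis
      then show ?thesis using uw(2) by blast
    qed
  qed
  have idc: "(\<rho>(y := y)) u = (\<rho>(y := y)) w \<longleftrightarrow> (u, w) \<in> conn E ?S"
    if u: "u \<in> ?S" "u \<notin> ?W" and w: "w \<in> ?S" "w \<notin> ?W" for u w
  proof -
    have ne: "u \<noteq> y" "w \<noteq> y" and uS: "u \<in> S" "u \<notin> W" and wS: "w \<in> S" "w \<notin> W"
      using u w by blast+
    have "(u, w) \<in> conn E ?S" if "\<rho> u = \<rho> w"
      using grow_invD(9)[OF g uS wS] that mono by blast
    moreover have "\<rho> u = \<rho> w" if c: "(u, w) \<in> conn E ?S"
    proof -
      have "w \<in> {v \<in> S - ?W. \<rho> v = \<rho> u}"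
      proof (rule conn_closed[OF c])
        show "u \<in> {v \<in> S - ?W. \<rho> v = \<rho> u}" using u uS by blast
      next
        fix v z assume v: "v \<in> {v \<in> S - ?W. \<rho> v = \<rho> u}" and z: "z \<in> ?S" "{v, z} \<in> E"
        have zW: "z \<notin> ?W" using closed[of z v] v z edge_sym by blast
        then have zS: "z \<in> S" "z \<notin> W" using z by blast+
        have vS: "v \<in> S" "v \<notin> W" "\<rho> v = \<rho> u" using v by blast+
        have "\<rho> v = \<rho> z" using grow_invD(9)[OF g vS(1,2) zS] conn_edge[OF vS(1) zS(1) z(2)] by simp
        then have "\<rho> z = \<rho> u" using vS(3) by simp
        then show "z \<in> {v \<in> S - ?W. \<rho> v = \<rho> u}" using zW zS by blast
      qed
      then show ?thesis by simp
    qed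
    ultimately show ?thesis using ne by auto
  qed
  \<comment> \<open>Every pending vertex is connected to \<open>y\<close> in the enlarged graph,
    which gives \<open>pending_conn\<close> by transitivity. In the root case no old vertex is
    pending.\<close>
  have to_y: "(u, y) \<in> conn E ?S" if u: "u \<in> ?W" "u \<notin> P" for u
  proof -
    consider "u = y" | "u \<in> W" | "u \<in> ?C" "u \<notin> W" using u by blast
    then show ?thesis
    proof cases
      case 2
      show ?thesis using c
      proof
        assume "\<exists>x\<in>Z \<inter> S - P. y \<in> nbhd E x"
        then obtain x where x: "x \<in> Z" "x \<in> S" "x \<notin> P" "y \<in> nbhd E x" by blast
        then have "x \<in> W" using grow_invD(10)[OF g] by blast
        then have "(u, x) \<in> conn E ?S" using grow_invD(12)[OF g 2 u(2), of x] x mono by blast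
        moreover have "(x, y) \<in> conn E ?S"
          using x edge_sym by (auto intro!: conn_edge simp: nbhd_def)
        ultimately show ?thesis by (rule conn_trans)
      next
        assume "P = Z \<inter> S"
        then show ?thesis using grow_inv_reached_processed[OF g cl] 2 u by blast
      qed
    next
      case 3
      then obtain w where w: "w \<in> nbhd E y" "w \<in> S" "\<rho> u = \<rho> w" by blast
      have "w \<notin> W" using grow_invD(8)[OF g, of w u] w 3 by auto
      then have "(u, w) \<in> conn E ?S" using grow_invD(9)[OF g, of u w] w 3 mono by auto
      moreover have "(w, y) \<in> conn E ?S" using w by (auto intro!: conn_edge simp: nbhd_def)
      ultimately show ?thesis by (rule conn_trans)
    qed simp
  qed
  \<comment> \<open>Failed tests stay valid, since no superset of a non-bipartite set is
    bipartite.\<close>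
  have rejected: "u \<in> ?W \<or> u \<notin> ?S \<and> \<not> bipartite E (insert u ?S)" if "u \<in> insert y Z" for u
    using that grow_invD(10)[OF g, of u] y bipartite_subset[of E "insert u ?S" "insert u S"] by blast
  have reach: "\<exists>w\<in>insert y Z \<inter> ?S. (u, w) \<in> conn E ?S" if "u \<in> ?W" for u
  proof (cases "u \<in> P")
    case True then show ?thesis using grow_invD(11)[OF g] by (intro bexI[of _ u]) auto
  next
    case False then show ?thesis using to_y[OF that] by blast
  qed
  have front: "(u, w) \<in> conn E ?S" if "u \<in> ?W" "u \<notin> P" "w \<in> ?W" "w \<notin> P" for u w
    using to_y[OF that(1,2)] conn_sym[OF to_y[OF that(3,4)]] by (rule conn_trans)
  have sub: "A \<subseteq> ?S" "?S \<subseteq> verts n" "?W \<subseteq> ?S" "P \<subseteq> insert y Z \<inter> ?S"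
    using grow_invD(1,2,5,11)[OF g] y by auto
  have rep: "(\<rho>(y := y)) u \<in> ?S" if "u \<in> ?S" for u using that grow_invD(7)[OF g] by auto
  show ?thesis
  proof (rule grow_inv.intro)
    fix u w assume "u \<in> ?W" "w \<in> ?S" "{u, w} \<in> E"
    then show "w \<in> ?W" using closed[of u w] sub(3) by blast
  next
    fix u w assume "u \<in> ?W" "w \<in> ?S" "(\<rho>(y := y)) u = (\<rho>(y := y)) w"
    then show "w \<in> ?W" using idW[of u w] sub(3) by blast
  qed (fact sub gr | (rule proper rep idc rejected front reach; assumption))+
qed

end

section \<open>Greedy extension: program\<close>

text \<open>On bits this is exclusive or; at least one of the two truncated differences is
  0.\<close>

abbreviation xor_exp :: "aexp \<Rightarrow> aexp \<Rightarrow> aexp" where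
  "xor_exp e f \<equiv> Plus (Minus e f) (Minus f e)"

abbreviation xor_nat :: "nat \<Rightarrow> nat \<Rightarrow> nat" where
  "xor_nat a b \<equiv> (a - b) + (b - a)"

lemma xor_nat: "a \<le> 1 \<Longrightarrow> b \<le> 1 \<Longrightarrow> xor_nat a b \<le> 1 \<and> xor_nat a (xor_nat a b) = b"
  by (auto simp: le_Suc_eq)

text \<open>The colour of \<open>u\<close> is \<open>arr 8 u\<close>, flipped if \<open>arr 12\<close> is set at the component of \<open>u\<close>. The first
  loop finds the colour that a neighbour of \<open>y\<close> in the reached part forces upon all of them, the second
  one flips the components that are not reached so that one neighbour in each has that colour.\<close>

definition find_colour :: com where
  "find_colour = for_nbrs 13
    (If (And (Not (Eq (Arr 6 (R 7)) (N 0))) (Not (Eq (Arr 11 (Arr 7 (R 7))) (N 0))))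
      (Assign 15 (xor_exp (Arr 8 (R 7)) (Arr 12 (Arr 7 (R 7))))) Skip)"

definition flip_components :: com where
  "flip_components = for_nbrs 13
    (If (And (Not (Eq (Arr 6 (R 7)) (N 0))) (Eq (Arr 11 (Arr 7 (R 7))) (N 0)))
      (Store 12 (Arr 7 (R 7)) (xor_exp (Arr 8 (R 7)) (R 15))) Skip)"

text \<open>After the two previous loops each piece that \<open>y\<close> meets, be it the reached
  part or an unreached component, has a neighbour with the colour in register 15. A deviation is
  thus a conflict inside one piece, which no flip can repair.\<close>

definition check_colour :: com where
  "check_colour = for_nbrs 13
    (If (And (Not (Eq (Arr 6 (R 7)) (N 0)))
        (Not (Eq (xor_exp (Arr 8 (R 7)) (Arr 12 (Arr 7 (R 7)))) (R 15))))
      (Assign 14 (N 0)) Skip)"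

definition reach_components :: com where
  "reach_components = for_nbrs 13
    (If (Not (Eq (Arr 6 (R 7)) (N 0))) (Store 11 (Arr 7 (R 7)) (N 1)) Skip)"

definition insert_vertex :: com where
  "insert_vertex = (Store 6 (R 13) (N 1) ;; Store 7 (R 13) (R 13) ;; Store 8 (R 13) (Minus (N 1) (R 15)))"

definition try_vertex :: com where
  "try_vertex = (Assign 15 (N 0) ;; find_colour ;; flip_components ;; check_colour ;;
    If (Eq (R 14) (N 1)) (reach_components ;; insert_vertex) Skip)"

definition visit_grow :: com where
  "visit_grow = If (Eq (Arr 9 (R 13)) (N 0))
    (Store 9 (R 13) (N 1) ;; Assign 14 (N 1) ;;
     If (Eq (Arr 6 (R 13)) (N 0)) try_vertex Skip ;;
     If (Eq (R 14) (N 1)) (Store 11 (Arr 7 (R 13)) (N 1) ;; enqueue) Skip)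
    Skip"

lemma mods_nbrs [simp]: "mod_regs (for_nbrs z c) = {6, 7} \<union> mod_regs c" "mod_arrs (for_nbrs z c) = mod_arrs c"
  by (auto simp: for_nbrs_def)

text \<open>Clearing positions 1 to \<open>n\<close> restores the zero arrays only if nothing has
  been written elsewhere; this keeps a reset within \<open>O(n)\<close> steps.\<close>

definition clean :: "nat \<Rightarrow> (nat \<Rightarrow> nat \<Rightarrow> nat) \<Rightarrow> bool" where
  "clean n a \<longleftrightarrow> (\<forall>k\<in>{7..12}. \<forall>i. i \<notin> verts n \<longrightarrow> a k i = 0)"

lemma clean_upd: "clean n a \<Longrightarrow> (\<And>i. i \<notin> verts n \<Longrightarrow> f i = 0) \<Longrightarrow> clean n (a(k := f))"
  by (auto simp: clean_def)

lemma cleanD: "clean n a \<Longrightarrow> k \<in> {7..12} \<Longrightarrow> i \<notin> verts n \<Longrightarrow> a k i = 0"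
  by (auto simp: clean_def)

context graph_input
begin

text \<open>Any reached neighbour may supply the colour, as a disagreement among them is detected
  later. If there is none, the initial 0 remains, an arbitrary choice: every component met by
  \<open>y\<close> can then be flipped.\<close>

lemma wp_find_colour:
  assumes y: "reg s 13 = y" "y \<in> verts n" and g: "arr s 0 = off" "arr s 1 = adj"
    and a: "arr s 6 = ind S" "\<And>u. arr s 8 u \<le> 1" "\<And>u. arr s 12 u \<le> 1" and c: "reg s 15 = 0"
    and W: "W = {u \<in> S. arr s 11 (arr s 7 u) \<noteq> 0}"
    and exit: "\<And>t k. keeps {6, 7, 15} {} s t \<Longrightarrow> k \<le> 100 * (deg y + 1) \<Longrightarrow> reg t 15 \<le> 1 \<Longrightarrow>
      (nbhd E y \<inter> W \<noteq> {} \<longrightarrow> (\<exists>u\<in>nbhd E y \<inter> W. xor_nat (arr s 8 u) (arr s 12 (arr s 7 u)) = reg t 15)) \<Longrightarrow> Q t k"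
  shows "wp find_colour s Q"
  unfolding find_colour_def
proof (rule wp_for_nbrs[where y = y and \<tau> = 50 and I = "\<lambda>M t. reg t 15 \<le> 1 \<and>
    (M \<inter> W \<noteq> {} \<longrightarrow> (\<exists>u\<in>M \<inter> W. xor_nat (arr s 8 u) (arr s 12 (arr s 7 u)) = reg t 15))"], goal_cases)
  case (13 M u t)
  have "arr t = arr s" using 13(5) by (auto simp: keeps_def fun_eq_iff)
  then show ?case
    using 13 a W xor_nat[of "arr s 8 u" "arr s 12 (arr s 7 u)"]
    by (auto simp: wp_simps)
next
  case (14 t k)
  have "keeps {6, 7, 15} {} s t" "k \<le> 100 * (deg y + 1)" using 14 by (auto simp: keeps_def)
  then show ?case using exit 14(1) by blast
qed (use y g c in auto)

text \<open>Several neighbours of \<open>y\<close> in one component overwrite the same flag, so it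
  is only recorded that the value stems from one of them. Here \<open>s\<close> is the state before
  the loop and \<open>f\<close> the current array 12.\<close>

definition flipped :: "nat set \<Rightarrow> state \<Rightarrow> (nat \<Rightarrow> nat) \<Rightarrow> bool" where
  "flipped M s f \<longleftrightarrow>
    (\<forall>\<rho>. f \<rho> = arr s 12 \<rho> \<or>
      arr s 11 \<rho> = 0 \<and> (\<exists>u\<in>M. arr s 7 u = \<rho> \<and> f \<rho> = xor_nat (arr s 8 u) (reg s 15))) \<and>
    (\<forall>u\<in>M. arr s 11 (arr s 7 u) = 0 \<longrightarrow>
      (\<exists>u'\<in>M. arr s 7 u' = arr s 7 u \<and> f (arr s 7 u) = xor_nat (arr s 8 u') (reg s 15)))"

lemma flipped_insert:
  assumes f: "flipped M s f" and u: "arr s 11 (arr s 7 u) = 0"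
  shows "flipped (insert u M) s (f(arr s 7 u := xor_nat (arr s 8 u) (reg s 15)))" (is "flipped _ _ ?f")
  unfolding flipped_def
proof (intro conjI allI ballI impI)
  show "?f \<rho> = arr s 12 \<rho> \<or> arr s 11 \<rho> = 0 \<and>
      (\<exists>v\<in>insert u M. arr s 7 v = \<rho> \<and> ?f \<rho> = xor_nat (arr s 8 v) (reg s 15))" for \<rho>
    using f[unfolded flipped_def, THEN conjunct1, rule_format, of \<rho>] u by (cases "\<rho> = arr s 7 u") auto
  fix v assume v: "v \<in> insert u M" "arr s 11 (arr s 7 v) = 0"
  show "\<exists>w\<in>insert u M. arr s 7 w = arr s 7 v \<and> ?f (arr s 7 v) = xor_nat (arr s 8 w) (reg s 15)"
  proof (cases "arr s 7 v = arr s 7 u")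
    case False
    then have "v \<in> M" using v by blast
    then obtain w where "w \<in> M" "arr s 7 w = arr s 7 v" "f (arr s 7 v) = xor_nat (arr s 8 w) (reg s 15)"
      using f v(2) unfolding flipped_def by blast
    then show ?thesis using False by (intro bexI[of _ w]) auto
  qed (auto intro: bexI[of _ u])
qed

lemma wp_flip_components:
  assumes y: "reg s 13 = y" "y \<in> verts n" and g: "arr s 0 = off" "arr s 1 = adj"
    and a: "arr s 6 = ind S"
    and exit: "\<And>t k. keeps {6, 7} {12} s t \<Longrightarrow> k \<le> 100 * (deg y + 1) \<Longrightarrow>
      flipped (nbhd E y \<inter> S) s (arr t 12) \<Longrightarrow> Q t k"
  shows "wp flip_components s Q"
  unfolding flip_components_def
proof (rule wp_for_nbrs[where y = y and \<tau> = 50 and I = "\<lambda>M t. flipped (M \<inter> S) s (arr t 12)"], goal_cases)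
  case 12 show ?case by (simp add: flipped_def)
next
  case (13 M u t)
  have k: "arr t 6 = arr s 6" "arr t 7 = arr s 7" "arr t 8 = arr s 8" "arr t 11 = arr s 11" "reg t 15 = reg s 15"
    using 13(5) by (auto simp: keeps_def)
  have bv: "bval (And (Not (Eq (Arr 6 (R 7)) (N 0))) (Eq (Arr 11 (Arr 7 (R 7))) (N 0))) t \<longleftrightarrow>
      u \<in> S \<and> arr s 11 (arr s 7 u) = 0" using 13(2) k a by auto
  show ?case
  proof (cases "u \<in> S")
    case True
    then have "insert u M \<inter> S = insert u (M \<inter> S)" by blast
    moreover have "flipped (insert u (M \<inter> S)) s (arr t 12)" if "arr s 11 (arr s 7 u) \<noteq> 0"
      using 13(1) that unfolding flipped_def by blast
    ultimately show ?thesis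
      unfolding wp_If bv using True 13(2) k flipped_insert[OF 13(1), of u] by (auto simp: wp_simps)
  next
    case False
    then have "insert u M \<inter> S = M \<inter> S" by blast
    then show ?thesis unfolding wp_If bv using False 13(1) by (simp add: wp_Skip)
  qed
next
  case (14 t k)
  have "keeps {6, 7} {12} s t" "k \<le> 100 * (deg y + 1)" using 14 by (auto simp: keeps_def)
  then show ?case using exit 14(1) by blast
qed (use y g in auto)

lemma wp_check_colour:
  assumes y: "reg s 13 = y" "y \<in> verts n" and g: "arr s 0 = off" "arr s 1 = adj"
    and a: "arr s 6 = ind S" and ok: "reg s 14 = 1"
    and exit: "\<And>t k. keeps {6, 7, 14} {} s t \<Longrightarrow> k \<le> 100 * (deg y + 1) \<Longrightarrow>
      reg t 14 = (if \<forall>u\<in>nbhd E y \<inter> S. xor_nat (arr s 8 u) (arr s 12 (arr s 7 u)) = reg s 15 then 1 else 0) \<Longrightarrow> Q t k"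
  shows "wp check_colour s Q"
  unfolding check_colour_def
proof (rule wp_for_nbrs[where y = y and \<tau> = 50 and I = "\<lambda>M t.
      reg t 14 = (if \<forall>u\<in>M \<inter> S. xor_nat (arr s 8 u) (arr s 12 (arr s 7 u)) = reg s 15 then 1 else 0)"], goal_cases)
  case (13 M u t)
  have k: "arr t = arr s" "reg t 15 = reg s 15"
    using 13(5) by (auto simp: keeps_def fun_eq_iff)
  show ?case
    using 13(1,2) k a by (auto simp: wp_simps)
next
  case (14 t k)
  have "keeps {6, 7, 14} {} s t" "k \<le> 100 * (deg y + 1)" using 14 by (auto simp: keeps_def)
  then show ?case using exit 14(1) by blast
qed (use y g ok in auto)

lemma wp_reach_components:
  assumes y: "reg s 13 = y" "y \<in> verts n" and g: "arr s 0 = off" "arr s 1 = adj"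
    and a: "arr s 6 = ind S"
    and exit: "\<And>t k. keeps {6, 7} {11} s t \<Longrightarrow> k \<le> 100 * (deg y + 1) \<Longrightarrow>
      arr t 11 = (\<lambda>\<rho>. if \<exists>u\<in>nbhd E y \<inter> S. arr s 7 u = \<rho> then 1 else arr s 11 \<rho>) \<Longrightarrow> Q t k"
  shows "wp reach_components s Q"
  unfolding reach_components_def
proof (rule wp_for_nbrs[where y = y and \<tau> = 50 and I = "\<lambda>M t.
      arr t 11 = (\<lambda>\<rho>. if \<exists>u\<in>M \<inter> S. arr s 7 u = \<rho> then 1 else arr s 11 \<rho>)"], goal_cases)
  case (13 M u t)
  have k: "arr t 6 = arr s 6" "arr t 7 = arr s 7"
    using 13(5) by (auto simp: keeps_def fun_eq_iff)
  show ?case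
    using 13(1,2) k a by (auto simp: wp_simps)
next
  case (14 t k)
  have "keeps {6, 7} {11} s t" "k \<le> 100 * (deg y + 1)" using 14 by (auto simp: keeps_def)
  then show ?case using exit 14(1) by blast
qed (use y g in auto)


text \<open>Exactly the tested vertices that belong to \<open>S\<close> enter the queue, hence
  \<open>D = Z \<inter> S\<close>. Flags vanish outside \<open>S\<close>, so a vertex inserted as
  its own representative starts unflipped.\<close>

definition grow_state :: "nat set \<Rightarrow> nat set \<Rightarrow> nat set \<Rightarrow> (nat \<Rightarrow> nat \<Rightarrow> nat) \<Rightarrow> nat set \<Rightarrow> nat set \<Rightarrow> bool" where
  "grow_state A P D a S Z \<longleftrightarrow> a 6 = ind S \<and> a 9 = ind Z \<and> D = Z \<inter> S \<and>
    grow_inv n E A S Z P {u \<in> S. a 11 (a 7 u) \<noteq> 0} (\<lambda>u. a 8 u \<noteq> a 12 (a 7 u)) (a 7) \<and>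
    (\<forall>u. a 8 u \<le> 1) \<and> (\<forall>u. a 12 u \<le> 1) \<and> (\<forall>u. u \<notin> S \<longrightarrow> a 12 u = 0) \<and> clean n a"

text \<open>The caller has already marked \<open>y\<close> as tested and will mark its component as
  reached. So array 9 holds \<open>insert y Z\<close> beforehand, and success is described for the
  memory after the caller's store to array 11.\<close>

lemma wp_try_vertex:
  assumes y: "reg s 13 = y" "y \<in> verts n" "y \<notin> S" "y \<notin> Z" and g: "arr s 0 = off" "arr s 1 = adj"
    and ok: "reg s 14 = 1"
    and a: "arr s 6 = ind S" "arr s 9 = ind (insert y Z)"
      "\<forall>u. arr s 8 u \<le> 1" "\<forall>u. arr s 12 u \<le> 1" "\<forall>u. u \<notin> S \<longrightarrow> arr s 12 u = 0"
    and qc: "clean n (arr s)"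
    and inv: "grow_inv n E A S Z P {u \<in> S. arr s 11 (arr s 7 u) \<noteq> 0}
      (\<lambda>u. arr s 8 u \<noteq> arr s 12 (arr s 7 u)) (arr s 7)"
    and cl: "\<forall>x\<in>P. nbhd E x \<subseteq> Z"
    and c: "(\<exists>x\<in>Z \<inter> S - P. y \<in> nbhd E x) \<or> P = Z \<inter> S"
  shows "wp try_vertex s (\<lambda>t k. keeps {6, 7, 14, 15} {6, 7, 8, 11, 12} s t \<and> k \<le> 460 * (deg y + 1) \<and>
    (reg t 14 = 0 \<and> grow_state A P (Z \<inter> S) (arr t) S (insert y Z) \<or>
     reg t 14 = 1 \<and> grow_state A P (insert y (Z \<inter> S))
       ((arr t)(11 := (arr t 11)(arr t 7 y := 1))) (insert y S) (insert y Z)))"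
proof -
  let ?W = "{u \<in> S. arr s 11 (arr s 7 u) \<noteq> 0}"
  let ?N = "nbhd E y \<inter> S"
  let ?alt = "\<lambda>t. reg t 14 = 0 \<and> grow_state A P (Z \<inter> S) (arr t) S (insert y Z) \<or>
     reg t 14 = 1 \<and> grow_state A P (insert y (Z \<inter> S))
       ((arr t)(11 := (arr t 11)(arr t 7 y := 1))) (insert y S) (insert y Z)"
  have test: "wp (flip_components ;; check_colour ;;
      If (Eq (R 14) (N 1)) (reach_components ;; insert_vertex) Skip) s1 (\<lambda>t k. keeps {6, 7, 14, 15} {6, 7, 8, 11, 12} s t \<and> k \<le> 340 * (deg y + 1) \<and>
    ?alt t)"
    if s1: "keeps {6, 7, 15} {} s s1" and b: "reg s1 15 \<le> 1"
      and found: "?N \<inter> ?W \<noteq> {} \<Longrightarrow> \<exists>u\<in>?N \<inter> ?W. xor_nat (arr s 8 u) (arr s 12 (arr s 7 u)) = reg s1 15"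
    for s1
  proof -
    let ?b = "reg s1 15"
    have r1: "arr s1 = arr s" "reg s1 13 = y" "reg s1 14 = 1"
      using s1 y ok by (auto simp: keeps_def fun_eq_iff)
    show ?thesis unfolding wp_Seq
    proof (rule wp_flip_components[where y = y and S = S], goal_cases)
      case (6 s2 k2)
      define f where "f = arr s2 12"
      have f1: "f \<rho> = arr s 12 \<rho> \<or> arr s 11 \<rho> = 0 \<and> (\<exists>u\<in>?N. arr s 7 u = \<rho> \<and> f \<rho> = xor_nat (arr s 8 u) ?b)" for \<rho>
        using 6(3) r1 unfolding f_def flipped_def by auto
      have f2: "\<exists>u'\<in>?N. arr s 7 u' = arr s 7 u \<and> f (arr s 7 u) = xor_nat (arr s 8 u') ?b"
        if "u \<in> ?N" "u \<notin> ?W" for u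
        using 6(3) r1 that unfolding f_def flipped_def by auto
      have r2: "arr s2 = (arr s)(12 := f)" "reg s2 15 = ?b" "reg s2 13 = y" "reg s2 14 = 1"
        using 6(1) r1 unfolding f_def by (auto simp: keeps_def fun_eq_iff)
      have fb: "f u \<le> 1" for u
        using f1[of u] a(3,4) xor_nat b by metis
      have fW: "f (arr s 7 u) = arr s 12 (arr s 7 u)" if "u \<in> ?W" for u
        using f1[of "arr s 7 u"] that by auto
      have fS: "f u = 0" if "u \<notin> S" for u
        using f1[of u] a(5) grow_invD(7)[OF inv] that by auto
      let ?ec = "\<lambda>u. arr s 8 u \<noteq> f (arr s 7 u)"
      let ?val = "\<lambda>u. xor_nat (arr s 8 u) (f (arr s 7 u))"
      have val: "?val u \<le> 1 \<and> (?val u = 1 \<longleftrightarrow> ?ec u)" for u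
        using a(3)[rule_format, of u] fb[of "arr s 7 u"] by auto
      \<comment> \<open>An edge outside \<open>W\<close> joins vertices with the same
        representative, hence with a common flag, so flipping keeps the colouring proper. Flags of
        the reached part do not change.\<close>
      have inv2: "grow_inv n E A S Z P ?W ?ec (arr s 7)"
      proof (rule grow_inv.intro)
        fix u w assume uw: "u \<in> S" "w \<in> S" "{u, w} \<in> E"
        have ne: "(arr s 8 u \<noteq> arr s 12 (arr s 7 u)) \<noteq> (arr s 8 w \<noteq> arr s 12 (arr s 7 w))"
          using grow_invD(4)[OF inv uw] .
        show "?ec u \<noteq> ?ec w"
        proof (cases "u \<in> ?W")
          case True
          then have "w \<in> ?W" using grow_invD(6)[OF inv] uw by blast
          then show ?thesis using ne fW True by simp
        next
          case False
          then have "w \<notin> ?W" using grow_invD(6)[OF inv, of w u] uw edge_sym by blast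
          then have "arr s 7 u = arr s 7 w"
            using grow_invD(9)[OF inv uw(1) False uw(2)] conn_edge[OF uw] by blast
          moreover have "arr s 8 u \<noteq> arr s 8 w" using ne calculation by auto
          moreover have "arr s 8 u \<le> 1" "arr s 8 w \<le> 1" "f (arr s 7 u) \<le> 1" using a(3) fb by auto
          ultimately show ?thesis by auto
        qed
      qed (rule grow_invD[OF inv]; assumption)+
      show ?case
      proof (rule wp_check_colour[where y = y and S = S], goal_cases)
        case (7 s3 k3)
        have r3: "arr s3 = (arr s)(12 := f)" "reg s3 15 = ?b" "reg s3 13 = y"
          using 7(1) r2 by (auto simp: keeps_def fun_eq_iff)
        have ok3: "reg s3 14 = (if \<forall>u\<in>?N. ?val u = ?b then 1 else 0)"
          using 7(3) r2 by simp
        have k3: "keeps {6, 7, 14, 15} {6, 7, 8, 11, 12} s s3"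
          using s1 6(1) 7(1) by (auto simp: keeps_def)
        show ?case
        proof (cases "\<forall>u\<in>?N. ?val u = ?b")
          case False
          then obtain u where u: "u \<in> ?N" "?val u \<noteq> ?b" by blast
          \<comment> \<open>The partner of a wrongly coloured \<open>u\<close> is the neighbour
            found by the first loop if \<open>u\<close> is reached, and otherwise the neighbour that
            set the flag of its component.\<close>
          have "\<exists>w\<in>?N. ?val w = ?b \<and> (u \<in> ?W \<and> w \<in> ?W \<or> u \<notin> ?W \<and> w \<notin> ?W \<and> arr s 7 u = arr s 7 w)"
          proof (cases "u \<in> ?W")
            case True
            then obtain w where "w \<in> ?N" "w \<in> ?W" "xor_nat (arr s 8 w) (arr s 12 (arr s 7 w)) = ?b"
              using found u by blast
            then show ?thesis using fW[of w] True by (intro bexI[of _ w]) auto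
          next
            case F: False
            then obtain w where w: "w \<in> ?N" "arr s 7 w = arr s 7 u" "f (arr s 7 u) = xor_nat (arr s 8 w) ?b"
              using f2 u by blast
            then have "?val w = ?b" using xor_nat[OF a(3)[rule_format] b] by metis
            moreover have "w \<notin> ?W" using grow_invD(8)[OF inv, of w u] w F u by auto
            ultimately show ?thesis using w F by (intro bexI[of _ w]) auto
          qed
          then obtain w where w: "w \<in> ?N" "?val w = ?b"
            "u \<in> ?W \<and> w \<in> ?W \<or> u \<notin> ?W \<and> w \<notin> ?W \<and> arr s 7 u = arr s 7 w" by blast
          have "?ec u \<noteq> ?ec w" using val[of u] val[of w] u(2) w(2) by auto
          then have "grow_inv n E A S (insert y Z) P ?W ?ec (arr s 7)"
            by (rule grow_inv_reject[OF inv2 cl y(3,4) u(1) w(1) _ w(3)])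
          moreover have "clean n ((arr s)(12 := f))"
            using fS grow_invD(2)[OF inv] by (intro clean_upd[OF qc]) blast
          ultimately have "grow_state A P (Z \<inter> S) (arr s3) S (insert y Z)"
            unfolding grow_state_def r3 using a y fb fS by auto
          then show ?thesis using ok3 False 6(2) 7(2) k3 by (simp add: wp_simps)
        next
          case True
          have "wp reach_components s3 (\<lambda>s' k. wp insert_vertex s' (\<lambda>t k'. keeps {6, 7, 14, 15} {6, 7, 8, 11, 12} s t \<and>
              k + k' \<le> 115 * (deg y + 1) \<and> reg t 14 = 1 \<and> grow_state A P (insert y (Z \<inter> S))
               ((arr t)(11 := (arr t 11)(arr t 7 y := 1))) (insert y S) (insert y Z)))"
          proof (rule wp_reach_components[where y = y and S = S], goal_cases)
            case (6 s4 k4)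
            have r4: "arr s4 6 = ind S" "arr s4 7 = arr s 7" "arr s4 8 = arr s 8" "arr s4 9 = ind (insert y Z)"
              "arr s4 10 = arr s 10" "arr s4 12 = f" "reg s4 15 = ?b" "reg s4 13 = y" "reg s4 14 = 1"
              using 6(1) r3 a ok3 True by (auto simp: keeps_def)
            have a11: "arr s4 11 = (\<lambda>\<rho>. if \<exists>u\<in>?N. arr s 7 u = \<rho> then 1 else arr s 11 \<rho>)"
              using 6(3) r3 by (simp add: fun_eq_iff)
            define a' where "a' = (arr s4)(6 := ind (insert y S), 7 := (arr s 7)(y := y),
              8 := (arr s 8)(y := 1 - ?b), 11 := (arr s4 11)(y := 1))"
            have rS: "arr s 7 u \<in> S" "arr s 7 u \<noteq> y" if "u \<in> S" for u
              using grow_invD(7)[OF inv that] y by auto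
            have W': "{u \<in> insert y S. a' 11 (a' 7 u) \<noteq> 0} =
                insert y (?W \<union> {u \<in> S. \<exists>w\<in>?N. arr s 7 u = arr s 7 w})" (is "?L = ?R")
            proof (intro set_eqI)
              fix u
              show "u \<in> ?L \<longleftrightarrow> u \<in> ?R"
              proof (cases "u \<in> S")
                case True
                then have "u \<noteq> y" using y by blast
                then have "a' 11 (a' 7 u) = arr s4 11 (arr s 7 u)"
                  using rS[OF True] by (simp add: a'_def)
                moreover have "(\<exists>w\<in>?N. arr s 7 w = arr s 7 u) \<longleftrightarrow> (\<exists>w\<in>?N. arr s 7 u = arr s 7 w)"
                  by (intro bex_cong refl) (rule eq_commute)
                then have "arr s4 11 (arr s 7 u) \<noteq> 0 \<longleftrightarrow>
                    (\<exists>w\<in>?N. arr s 7 u = arr s 7 w) \<or> arr s 11 (arr s 7 u) \<noteq> 0"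
                  unfolding a11 by simp
                ultimately show ?thesis using True \<open>u \<noteq> y\<close>
                  by (simp only: mem_Collect_eq insert_iff Un_iff simp_thms) blast
              next
                case False then show ?thesis using y by (auto simp: a'_def)
              qed
            qed
            \<comment> \<open>Only the colours on \<open>insert y S\<close> matter to the invariant,
              so the comparison is masked elsewhere.\<close>
            have ec': "(\<lambda>u. if u \<in> insert y S then a' 8 u \<noteq> a' 12 (a' 7 u) else undefined u) =
              (\<lambda>u. if u \<in> insert y S then (?ec(y := ?b \<noteq> 1)) u else undefined u)"
              using rS r4 fS[OF y(3)] b y(3) by (auto simp: a'_def fun_eq_iff)
            have col: "?ec u \<noteq> (?b \<noteq> 1)" if "u \<in> ?N" for u
            proof -
              have "?val u = ?b" using True that by blast
              then show ?thesis using val[of u] by (metis (no_types))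
            qed
            have "grow_inv n E A (insert y S) (insert y Z) P
              (insert y (?W \<union> {u \<in> S. \<exists>w\<in>?N. arr s 7 u = arr s 7 w})) (?ec(y := ?b \<noteq> 1)) ((arr s 7)(y := y))"
              by (rule grow_inv_add[OF inv2 cl y(3,4,2) c col])
            moreover have "a' 7 = (arr s 7)(y := y)" by (simp add: a'_def)
            ultimately have inv3: "grow_inv n E A (insert y S) (insert y Z) P
                {u \<in> insert y S. a' 11 (a' 7 u) \<noteq> 0} (?ec(y := ?b \<noteq> 1)) (a' 7)"
              unfolding W' by (simp only:)
            have "grow_inv n E A (insert y S) (insert y Z) P {u \<in> insert y S. a' 11 (a' 7 u) \<noteq> 0}
               (\<lambda>u. a' 8 u \<noteq> a' 12 (a' 7 u)) (a' 7)"
            proof (rule grow_inv.intro)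
              fix u w assume uw: "u \<in> insert y S" "w \<in> insert y S" "{u, w} \<in> E"
              show "(a' 8 u \<noteq> a' 12 (a' 7 u)) \<noteq> (a' 8 w \<noteq> a' 12 (a' 7 w))"
                using grow_invD(4)[OF inv3 uw] fun_cong[OF ec', of u] fun_cong[OF ec', of w] uw by simp
            qed (rule grow_invD[OF inv3]; assumption)+
            moreover have "clean n a'"
            proof -
              have "arr s4 = (arr s)(12 := f, 11 := arr s4 11)"
                using 6(1) r3 by (auto simp: keeps_def fun_eq_iff)
              moreover have "clean n ((arr s)(12 := f, 11 := arr s4 11))"
                using qc fS grow_invD(2)[OF inv] rS a11
                by (intro clean_upd[OF clean_upd[OF qc]]) (auto intro: cleanD[OF qc])
              ultimately have "clean n (arr s4)" by simp
              then show ?thesis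
                unfolding a'_def using y a11 rS grow_invD(2)[OF inv]
                by (intro clean_upd) (auto intro: cleanD[OF qc] simp: ind_def)
            qed
            ultimately have gs: "grow_state A P (insert y (Z \<inter> S)) a' (insert y S) (insert y Z)"
              unfolding grow_state_def using r4 a fb fS by (auto simp: a'_def)
            have keep: "keeps {6, 7, 14, 15} {6, 7, 8, 11, 12} s s4"
              using k3 6(1) by (auto simp: keeps_def)
            have "(arr s4)(6 := ind (insert y S), 7 := (arr s 7)(y := y), 8 := (arr s 8)(y := Suc 0 - ?b),
               11 := (arr s4 11)(y := Suc 0)) = a'" by (simp add: a'_def)
            then show ?case
              using r4 6(2) gs keep by (simp add: insert_vertex_def wp_simps ind_insert) (simp add: keeps_def)
          qed (use r3 y g a in auto)
          then show ?thesis
            unfolding wp_If using ok3 True 6(2) 7(2)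
            by (auto simp: wp_Seq elim!: wp_mono)
        qed
      qed (use r2 y g a in auto)
    qed (use r1 y g a in auto)
  qed
  show ?thesis unfolding try_vertex_def wp_Seq[of "Assign 15 (N 0)"] wp_Assign wp_Seq[of find_colour]
  proof (rule wp_find_colour[where y = y and S = S and W = ?W], goal_cases)
    case (10 t k)
    have k1: "keeps {6, 7, 15} {} s t" using 10(1) by (auto simp: keeps_def)
    have "?N \<inter> ?W = nbhd E y \<inter> ?W" by blast
    then show ?case
      by (intro wp_mono[OF test[OF k1 10(3)]]) (use 10 in auto)
  qed (use y g a in auto)
qed

lemma grow_state_queue:
  assumes "grow_state A P D a S Z" "\<And>i. i \<notin> verts n \<Longrightarrow> q i = 0"
  shows "grow_state A P D (a(10 := q)) S Z"
  using assms by (auto simp: grow_state_def intro: clean_upd)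

text \<open>Members of \<open>S\<close> need no test: one store at the representative of
  \<open>y\<close> reaches its whole component. The factor 550 is the 460 of a test with the
  overhead of the visit, rounded up.\<close>

lemma visit_grow_spec:
  "visit_spec visit_grow (\<lambda>P D a. \<exists>S Z. grow_state A P D a S Z) (\<lambda>a. {v. a 9 v \<noteq> 0}) 550"
  unfolding visit_spec_def
proof (intro allI impI, elim conjE exE)
  fix s :: state and P D y S Z
  assume n: "reg s 0 = n" and g: "arr s 0 = off" "arr s 1 = adj" and y: "reg s 13 = y" "y \<in> verts n"
    and q: "1 \<le> reg s 9" "y \<notin> D \<longrightarrow> reg s 9 \<le> n"
    and st: "grow_state A P D (arr s) S Z"
    and cl: "\<forall>x\<in>P. nbhd E x \<subseteq> {v. arr s 9 v \<noteq> 0}"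
    and c: "reg s 12 \<in> D - P \<and> y \<in> nbhd E (reg s 12) \<or>
        reg s 12 = 0 \<and> P = D \<and> {1..<y} \<subseteq> {v. arr s 9 v \<noteq> 0}"
  note d = st[unfolded grow_state_def]
  have D: "D = Z \<inter> S" and a: "arr s 6 = ind S" "arr s 9 = ind Z" and cn: "clean n (arr s)"
    and inv: "grow_inv n E A S Z P {u \<in> S. arr s 11 (arr s 7 u) \<noteq> 0}
      (\<lambda>u. arr s 8 u \<noteq> arr s 12 (arr s 7 u)) (arr s 7)" using d by auto
  have cl': "\<forall>x\<in>P. nbhd E x \<subseteq> Z" using cl a by simp
  have c': "(\<exists>x\<in>Z \<inter> S - P. y \<in> nbhd E x) \<or> P = Z \<inter> S" using c D by blast
  let ?s = "s\<lparr>arr := (arr s)(9 := ind (insert y Z)), reg := (reg s)(14 := 1)\<rparr>"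
  let ?Q = "\<lambda>t k. k \<le> 550 * (1 + (if y \<in> {v. arr s 9 v \<noteq> 0} then 0 else deg y)) \<and>
       insert y {v. arr s 9 v \<noteq> 0} \<subseteq> {v. arr t 9 v \<noteq> 0} \<and>
       (reg t 9 = reg s 9 \<and> arr t 10 = arr s 10 \<and> (\<exists>S Z. grow_state A P D (arr t) S Z) \<or>
        y \<notin> D \<and> reg t 9 = Suc (reg s 9) \<and> arr t 10 = (arr s 10)(reg s 9 := y) \<and>
        (\<exists>S Z. grow_state A P (insert y D) (arr t) S Z))"
  let ?alt = "\<lambda>t. reg t 14 = 0 \<and> grow_state A P (Z \<inter> S) (arr t) S (insert y Z) \<or>
     reg t 14 = 1 \<and> grow_state A P (insert y (Z \<inter> S))
       ((arr t)(11 := (arr t 11)(arr t 7 y := 1))) (insert y S) (insert y Z)"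
  let ?tail = "If (Eq (R 14) (N 1)) (Store 11 (Arr 7 (R 13)) (N 1) ;; enqueue) Skip"
  have "Z \<subseteq> verts n" using cleanD[OF cn, of 9] a by fastforce
  then have cn9: "clean n ((arr s)(9 := ind (insert y Z)))"
    using y by (intro clean_upd[OF cn]) (auto simp: ind_def)
  have tail: "wp ?tail t
      (\<lambda>t' k'. ?Q t' (k + k'))"
    if ks: "keeps {6, 7, 14, 15} {6, 7, 8, 11, 12} ?s t" and k: "k \<le> 500 * (deg y + 1)" and yZ: "y \<notin> Z"
      and alt: "?alt t" for t k
  proof -
    have r: "reg t 9 = reg s 9" "reg t 13 = y" "arr t 9 = ind (insert y Z)" "arr t 10 = arr s 10"
      using ks y by (auto simp: keeps_def)
    show ?thesis
      using alt
    proof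
      assume "reg t 14 = 0 \<and> grow_state A P (Z \<inter> S) (arr t) S (insert y Z)"
      then show ?thesis using r k yZ a D by (auto simp: wp_simps)
    next
      assume h: "reg t 14 = 1 \<and> grow_state A P (insert y (Z \<inter> S))
       ((arr t)(11 := (arr t 11)(arr t 7 y := 1))) (insert y S) (insert y Z)"
      have "grow_state A P (insert y (Z \<inter> S))
       ((arr t)(11 := (arr t 11)(arr t 7 y := 1), 10 := (arr s 10)(reg s 9 := y))) (insert y S) (insert y Z)"
        by (rule grow_state_queue[OF h[THEN conjunct2]])
          (use q yZ D cn in \<open>auto simp: verts_def clean_def\<close>)
      then show ?thesis using r k yZ a D h by (auto simp: wp_simps enqueue_def)
    qed
  qed
  show "wp visit_grow s ?Q"
  proof (cases "y \<in> Z")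
    case True
    then show ?thesis using a y st q by (auto simp: visit_grow_def wp_simps)
  next
    case yZ: False
    have e: "(arr s)(9 := (arr s 9)(y := Suc 0)) = (arr s)(9 := ind (insert y Z))"
      using a by (simp add: ind_insert)
    have "wp (If (Eq (Arr 6 (R 13)) (N 0)) try_vertex Skip ;;
       ?tail) ?s (\<lambda>t k. ?Q t (k + 30))"
    proof (cases "y \<in> S")
      case True
      have W: "{u \<in> S. ((arr s 11)(arr s 7 y := 1)) (arr s 7 u) \<noteq> 0} =
          {u \<in> S. arr s 11 (arr s 7 u) \<noteq> 0} \<union> {u \<in> S. arr s 7 u = arr s 7 y}" by auto
      have yv: "arr s 7 y \<in> verts n" using grow_invD(2,7)[OF inv] True by blast
      have "clean n ((arr s)(9 := ind (insert y Z), 11 := (arr s 11)(arr s 7 y := 1)))"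
        using yv by (intro clean_upd[OF cn9]) (auto intro: cleanD[OF cn])
      then have "grow_state A P (insert y (Z \<inter> S))
         ((arr s)(9 := ind (insert y Z), 11 := (arr s 11)(arr s 7 y := 1))) (insert y S) (insert y Z)"
        using d grow_inv_visit_member[OF inv cl' True yZ c', folded W] True y
        unfolding grow_state_def by (auto simp: insert_absorb)
      then have st1: "grow_state A P (insert y (Z \<inter> S))
         ((arr ?s)(11 := (arr ?s 11)(arr ?s 7 y := 1))) (insert y S) (insert y Z)" by simp
      have "wp ?tail ?s
        (\<lambda>t' k'. ?Q t' (100 + k'))"
        by (rule tail) (use yZ st1 in auto)
      then show ?thesis
        unfolding wp_Seq wp_If[of "Eq (Arr 6 (R 13)) (N 0)"] wp_Skip
        using True y a by (auto elim!: wp_mono)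
    next
      case False
      have "wp try_vertex ?s (\<lambda>t k. keeps {6, 7, 14, 15} {6, 7, 8, 11, 12} ?s t \<and> k \<le> 460 * (deg y + 1) \<and>
    ?alt t)"
        by (rule wp_try_vertex[OF _ y(2) False yZ]) (use d y g inv cl' c' cn9 in auto)
      then have "wp try_vertex ?s (\<lambda>t k. wp ?tail t
          (\<lambda>t' k'. ?Q t' (k + 40 + k')))"
      proof (rule wp_mono)
        fix t k
        assume h: "keeps {6, 7, 14, 15} {6, 7, 8, 11, 12} ?s t \<and> k \<le> 460 * (deg y + 1) \<and>
    ?alt t"
        show "wp ?tail t
          (\<lambda>t' k'. ?Q t' (k + 40 + k'))"
          by (rule tail) (use yZ h in auto)
      qed
      then show ?thesis
        unfolding wp_Seq[of "If (Eq (Arr 6 (R 13)) (N 0)) try_vertex Skip"] wp_If[of "Eq (Arr 6 (R 13)) (N 0)"]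
        using False y a by (auto elim!: wp_mono)
    qed
    then show ?thesis
      unfolding visit_grow_def wp_If[of "Eq (Arr 9 (R 13)) (N 0)"] wp_Seq[of "Store 9 (R 13) (N 1)"]
        wp_Seq[of "Assign 14 (N 1)"] wp_Store wp_Assign
      using yZ a y e by (auto elim!: wp_mono)
  qed
qed

end

section \<open>The completion function\<close>

definition reset :: com where
  "reset = (for_verts (Store 7 (R 5) (N 0) ;; Store 8 (R 5) (N 0) ;; Store 9 (R 5) (N 0) ;;
      Store 10 (R 5) (N 0) ;; Store 11 (R 5) (N 0) ;; Store 12 (R 5) (N 0)) ;;
    Assign 6 (N 0) ;; Assign 7 (N 0) ;; Assign 8 (N 0) ;; Assign 9 (N 0) ;; Assign 10 (N 0) ;;
    Assign 11 (N 0) ;; Assign 12 (N 0) ;; Assign 13 (N 0) ;; Assign 14 (N 0) ;; Assign 15 (N 0))"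

definition extend :: com where
  "extend = (search visit_colour ;; search visit_grow)"

definition complete :: com where
  "complete = (reset ;; extend)"

lemma mods_verts [simp]: "mod_regs (for_verts c) = insert 5 (mod_regs c)" "mod_arrs (for_verts c) = mod_arrs c"
  by (auto simp: for_verts_def)

lemmas program_defs = search_def visit_colour_def visit_grow_def try_vertex_def find_colour_def
  flip_components_def check_colour_def reach_components_def enqueue_def insert_vertex_def

lemma numeral_intervals: "{5..15} = {5, 6, 7, 8, 9, 10, 11, 12, 13, 14, 15::nat}"
  "{6..15} = {6, 7, 8, 9, 10, 11, 12, 13, 14, 15::nat}" "{7..12} = {7, 8, 9, 10, 11, 12::nat}"
  by (simp_all add: numeral_eq_Suc atLeastAtMostSuc_conv insert_commute)

definition was_reset :: "state \<Rightarrow> state \<Rightarrow> bool" where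
  "was_reset s t \<longleftrightarrow> keeps {5..15} {7..12} s t \<and> (\<forall>r\<in>{6..15}. reg t r = 0) \<and>
    (\<forall>a\<in>{7..12}. arr t a = (\<lambda>_. 0))"

lemma mods_reset: "mod_regs reset = {5..15}" "mod_arrs reset = {7..12}"
  unfolding reset_def numeral_intervals by auto

lemma mods_colour: "mod_regs (search visit_colour) \<subseteq> {8..13}" "mod_arrs (search visit_colour) \<subseteq> {7, 8, 10}"
  by (auto simp: program_defs)

lemma mods_extend: "mod_regs extend \<subseteq> {6..15}" "mod_arrs extend \<subseteq> {6..12}"
  by (auto simp: extend_def program_defs for_nbrs_def)

lemma uses_extend: "com_regs extend \<subseteq> insert 0 {6..15}" "com_arrs extend \<subseteq> {0, 1} \<union> {6..12}"
  by (auto simp: extend_def program_defs for_nbrs_def)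

lemma keeps_mono: "keeps X A s t \<Longrightarrow> X \<subseteq> Y \<Longrightarrow> A \<subseteq> B \<Longrightarrow> keeps Y B s t"
  unfolding keeps_def by blast

lemma wp_exec: "wp c s Q \<Longrightarrow> exec c s tr t \<Longrightarrow> Q t (ntick tr)"
  unfolding wp_def using exec_deterministic by blast

context graph_input
begin

definition completed :: "nat set \<Rightarrow> (nat \<Rightarrow> nat \<Rightarrow> nat) \<Rightarrow> bool" where
  "completed A a \<longleftrightarrow> (\<exists>S. a 6 = ind S \<and> (A, S) \<in> (grow n E)\<^sup>* \<and> S \<notin> Domain (grow n E))"

abbreviation graph_size :: nat where
  "graph_size \<equiv> card E + n + 1"

lemma wp_reset:
  assumes n: "reg s 0 = n" and c: "clean n (arr s)"
  shows "wp reset s (\<lambda>t k. was_reset s t \<and> k \<le> 100 * graph_size)"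
proof -
  have "wp reset s (\<lambda>t k. (\<forall>r\<in>{6..15}. reg t r = 0) \<and>
    (\<forall>a\<in>{7..12}. arr t a = (\<lambda>_. 0)) \<and> k \<le> 100 * graph_size)"
    unfolding reset_def wp_Seq
  proof (rule wp_for_verts[where n = n and \<tau> = 50 and
        I = "\<lambda>v t. \<forall>a\<in>{7..12}. \<forall>i. i \<notin> {v<..n} \<longrightarrow> arr t a i = 0"], goal_cases)
    case (4) then show ?case using c by (auto simp: clean_def verts_def)
  next
    case (5 v t)
    have "{v<..n} = insert (Suc v) {Suc v<..n}" using 5 by auto
    then show ?case using 5(1,4)
      unfolding numeral_intervals by (simp add: wp_simps)
  next
    case (7 t k)
    have "\<forall>a\<in>{7..12}. arr t a = (\<lambda>_. 0)" using 7(1) by (simp add: fun_eq_iff)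
    then show ?case using 7 unfolding numeral_intervals by (simp add: wp_simps)
  qed (use n in auto)
  then show ?thesis by (rule wp_keeps) (auto simp: mods_reset was_reset_def)
qed

definition start :: "nat set \<Rightarrow> state" where
  "start A = \<lparr>reg = (\<lambda>_. 0)(0 := n), arr = (\<lambda>_ _. 0)(0 := off, 1 := adj, 6 := ind A)\<rparr>"

text \<open>The greedy result depends on the order of the search, whereas \<open>is_comp\<close>
  asks for a function of the set alone. So it is read off the run of \<open>extend\<close> from a
  fixed memory holding just the graph and \<open>A\<close>; that run is unique by
  determinism.\<close>

definition completion :: "nat set \<Rightarrow> nat set" where
  "completion A = {v. arr (THE t. \<exists>tr. exec extend (start A) tr t) 6 v \<noteq> 0}"

lemma coloured_clean:
  assumes A: "A \<subseteq> verts n" "bipartite E A" and a: "coloured E A a" "queue_clean n (a 10)"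
    "a 9 = (\<lambda>_. 0)" "a 11 = (\<lambda>_. 0)" "a 12 = (\<lambda>_. 0)"
  shows "clean n a"
  unfolding clean_def
proof (intro ballI allI impI)
  fix k i assume k: "k \<in> {7..12::nat}" and i: "i \<notin> verts n"
  have "i \<notin> A" using A i by blast
  moreover have "i \<notin> side E A 1" using side_bipartition[OF A(2)] calculation by (auto simp: bipartition_def)
  moreover have "k = 7 \<or> k = 8 \<or> k = 9 \<or> k = 10 \<or> k = 11 \<or> k = 12" using k by auto
  ultimately show "a k i = 0" using a i by (auto simp: queue_clean_def coloured_def)
qed

text \<open>The two searches cost at most 100 and 600 times \<open>4 * card E + 2 * n + 1\<close>,
  and \<open>700 * 4 \<le> 3000\<close>.\<close>

lemma wp_extend:
  assumes A: "A \<subseteq> verts n" "bipartite E A"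
    and s: "reg s 0 = n" "arr s 0 = off" "arr s 1 = adj" "arr s 6 = ind A"
      "\<forall>a\<in>{7..12}. arr s a = (\<lambda>_. 0)"
  shows "wp extend s (\<lambda>t k. k \<le> 3000 * graph_size \<and> clean n (arr t) \<and>
    completed A (arr t))"
  unfolding extend_def wp_Seq
proof (rule wp_keeps[OF wp_colour[OF A]])
  fix t k
  assume t: "k \<le> 100 * (4 * card E + 2 * n + 1) \<and> arr t 6 = ind A \<and> coloured E A (arr t) \<and> queue_clean n (arr t 10)"
    and ks: "keeps (mod_regs (search visit_colour)) (mod_arrs (search visit_colour)) s t"
  have kr: "reg t 0 = n" "arr t 0 = off" "arr t 1 = adj" "arr t 9 = (\<lambda>_. 0)" "arr t 11 = (\<lambda>_. 0)" "arr t 12 = (\<lambda>_. 0)"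
    using keepsD[OF keeps_mono[OF ks mods_colour]] s by simp_all
  have co: "arr t 7 v \<noteq> 0 \<longleftrightarrow> v \<in> A" "arr t 8 = ind (side E A 1)" for v
    using t by (auto simp: coloured_def)
  have bp: "bipartition E A (side E A 0) (side E A 1)" by (rule side_bipartition[OF A(2)])
  \<comment> \<open>Nothing is reached yet, so \<open>\<rho>\<close> has to separate all components
    of \<open>G[A]\<close>, which the colouring search provides.\<close>
  have "grow_inv n E A A {} {} {} (\<lambda>u. arr t 8 u \<noteq> 0) (arr t 7)"
  proof (rule grow_inv.intro)
    show "(arr t 8 u \<noteq> 0) \<noteq> (arr t 8 w \<noteq> 0)" if "u \<in> A" "w \<in> A" "{u, w} \<in> E" for u w
      using bipartition_edge[OF bp that] bp that co by (auto simp: bipartition_def)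
    show "arr t 7 u \<in> A" if "u \<in> A" for u using t that by (simp add: coloured_def)
    show "arr t 7 u = arr t 7 w \<longleftrightarrow> (u, w) \<in> conn E A" if "u \<in> A" "u \<notin> {}" "w \<in> A" "w \<notin> {}" for u w
      using t that by (simp add: coloured_def)
  qed (use A in auto)
  moreover have "clean n (arr t)" using coloured_clean[OF A, of "arr t"] t kr by blast
  ultimately have "grow_state A {} {} (arr t) A {}"
    using t kr co by (auto simp: grow_state_def ind_def)
  then have init: "\<exists>S Z. grow_state A {} {} (arr t) S Z" by blast
  show "wp (search visit_grow) t (\<lambda>t k'. 1 + k + k' \<le> 3000 * graph_size \<and> clean n (arr t) \<and>
    completed A (arr t))"
  proof (rule wp_search[OF visit_grow_spec _ _ _ _ _ _ init])
    fix P D a x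
    assume "\<exists>S Z. grow_state A P D a S Z" "x \<in> D - P"
    then obtain S Z where g: "grow_state A P D a S Z" by blast
    then have D: "D = Z \<inter> S" and gi: "grow_inv n E A S Z P {u \<in> S. a 11 (a 7 u) \<noteq> 0}
        (\<lambda>u. a 8 u \<noteq> a 12 (a 7 u)) (a 7)" by (auto simp: grow_state_def)
    have "grow_inv n E A S Z (insert x P) {u \<in> S. a 11 (a 7 u) \<noteq> 0} (\<lambda>u. a 8 u \<noteq> a 12 (a 7 u)) (a 7)"
    proof (rule grow_inv.intro)
      show "insert x P \<subseteq> Z \<inter> S" using grow_invD(11)[OF gi] D \<open>x \<in> D - P\<close> by blast
      show "(u, w) \<in> conn E S" if "u \<in> {u \<in> S. a 11 (a 7 u) \<noteq> 0}" "u \<notin> insert x P"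
        "w \<in> {u \<in> S. a 11 (a 7 u) \<noteq> 0}" "w \<notin> insert x P" for u w
        by (rule grow_invD(12)[OF gi]) (use that in auto)
    qed (rule grow_invD[OF gi]; assumption)+
    then show "\<exists>S Z. grow_state A (insert x P) D a S Z" using g unfolding grow_state_def by blast
  next
    fix t k' D
    assume "\<exists>S Z. grow_state A D D (arr t) S Z" and v: "verts n \<subseteq> {v. arr t 9 v \<noteq> 0}"
      and k': "k' \<le> (550 + 50) * (4 * card E + 2 * n + 1)"
    then obtain S Z where g: "grow_state A D D (arr t) S Z" by blast
    then have gi: "grow_inv n E A S Z D {u \<in> S. arr t 11 (arr t 7 u) \<noteq> 0}
        (\<lambda>u. arr t 8 u \<noteq> arr t 12 (arr t 7 u)) (arr t 7)" by (auto simp: grow_state_def)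
    have "Z = {v. arr t 9 v \<noteq> 0}" using g by (simp add: grow_state_def)
    \<comment> \<open>Every vertex has been tested, and by the invariant the failed tests hold for
      the final \<open>S\<close>.\<close>
    then have "S \<notin> Domain (grow n E)" using v grow_invD(10)[OF gi] by (auto simp: grow_def)
    then show "1 + k + k' \<le> 3000 * graph_size \<and> clean n (arr t) \<and>
      completed A (arr t)"
      using g grow_invD(3)[OF gi] t k' by (auto simp: grow_state_def completed_def)
  qed (use kr in \<open>auto simp: program_defs for_nbrs_def\<close>)
qed (use s in auto)

lemma exec_extend_start:
  assumes "A \<subseteq> verts n" "bipartite E A"
  obtains tr t where "exec extend (start A) tr t" "arr t 6 = ind (completion A)"
    "(A, completion A) \<in> (grow n E)\<^sup>*" "completion A \<notin> Domain (grow n E)"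
proof -
  have "wp extend (start A) (\<lambda>t k. k \<le> 3000 * graph_size \<and> clean n (arr t) \<and>
    completed A (arr t))"
    by (rule wp_extend[OF assms]) (auto simp: start_def)
  then obtain tr t S where t: "exec extend (start A) tr t"
    and S: "arr t 6 = ind S" "(A, S) \<in> (grow n E)\<^sup>*" "S \<notin> Domain (grow n E)"
    unfolding wp_def completed_def by blast
  have "(THE t. \<exists>tr. exec extend (start A) tr t) = t"
    using t exec_deterministic by blast
  then have "completion A = S" using S by (simp add: completion_def)
  then show ?thesis using that t S by blast
qed

lemma is_comp_completion: "is_comp n E completion"
  unfolding is_comp_def using exec_extend_start by metis

lemma wp_complete:
  assumes A: "A \<subseteq> verts n" "bipartite E A"
    and s: "reg s 0 = n" "arr s 0 = off" "arr s 1 = adj" "arr s 6 = ind A" "clean n (arr s)"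
  shows "wp complete s (\<lambda>t k. k \<le> 3200 * graph_size \<and> keeps {5..15} {6..12} s t \<and>
    clean n (arr t) \<and> arr t 6 = ind (completion A))"
  unfolding complete_def wp_Seq
proof (rule wp_mono[OF wp_reset[OF s(1,5)]])
  fix t k
  assume w: "was_reset s t \<and> k \<le> 100 * graph_size"
  note h = w[unfolded was_reset_def]
  have kr: "reg t 0 = n" "arr t 0 = off" "arr t 1 = adj" "arr t 6 = ind A"
    using h s by (auto simp: keeps_def)
  \<comment> \<open>After the reset, all the memory that \<open>extend\<close> can read is as in
    \<open>start A\<close>; the stack and the visited set lie in other arrays.\<close>
  have ag: "agree (insert 0 {6..15}) ({0, 1} \<union> {6..12}) (start A) t"
  proof -
    have "arr (start A) a = arr t a" if "a \<in> {0, 1} \<union> {6..12}" for a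
    proof (cases "a \<in> {7..12}")
      case False
      then have "a = 0 \<or> a = 1 \<or> a = 6" using that by auto
      then show ?thesis using kr by (auto simp: start_def)
    qed (use h in \<open>simp add: start_def\<close>)
    then show ?thesis using h kr by (auto simp: agree_def start_def)
  qed
  obtain tr t0 where t0: "exec extend (start A) tr t0" "arr t0 6 = ind (completion A)"
    using exec_extend_start[OF A] by metis
  obtain u where u: "exec extend t tr u" "agree (insert 0 {6..15}) ({0, 1} \<union> {6..12}) t0 u"
    using exec_agree[OF t0(1) ag uses_extend] by blast
  have "wp extend t (\<lambda>t k. k \<le> 3000 * graph_size \<and> clean n (arr t) \<and>
    completed A (arr t))"
    by (rule wp_extend[OF A kr]) (use h in blast)
  note w = wp_exec[OF this u(1)]
  have "arr u 6 = ind (completion A)" using u(2) t0(2) by (simp add: agree_def)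
  moreover have "keeps {5..15} {6..12} s u"
  proof (rule keeps_trans)
    show "keeps {5..15} {7..12} s t" using h by blast
    show "keeps {6..15} {6..12} t u"
      using exec_frame[OF u(1)] by (intro keeps_mono[OF _ mods_extend]) (simp add: keeps_def)
  qed auto
  ultimately show "wp extend t (\<lambda>t k'. 1 + k + k' \<le> 3200 * graph_size \<and> keeps {5..15} {6..12} s t \<and>
    clean n (arr t) \<and> arr t 6 = ind (completion A))"
    using u(1) w h unfolding wp_def by (intro exI[of _ tr] exI[of _ u]) auto
qed

lemma wp_sides:
  assumes A: "A \<subseteq> verts n" "bipartite E A"
    and s: "reg s 0 = n" "arr s 0 = off" "arr s 1 = adj" "arr s 6 = ind A" "clean n (arr s)"
  shows "wp (reset ;; search visit_colour) s (\<lambda>t k. k \<le> 600 * graph_size \<and> keeps {5..15} {7..12} s t \<and>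
    clean n (arr t) \<and> arr t 8 = ind (side E A 1))"
  unfolding wp_Seq
proof (rule wp_mono[OF wp_reset[OF s(1,5)]])
  fix t k
  assume w: "was_reset s t \<and> k \<le> 100 * graph_size"
  note h = w[unfolded was_reset_def]
  have kr: "reg t 0 = n" "arr t 0 = off" "arr t 1 = adj" "arr t 6 = ind A"
    using h s by (auto simp: keeps_def)
  show "wp (search visit_colour) t (\<lambda>t k'. 1 + k + k' \<le> 600 * graph_size \<and> keeps {5..15} {7..12} s t \<and>
    clean n (arr t) \<and> arr t 8 = ind (side E A 1))"
  proof (rule wp_keeps[OF wp_colour[OF A kr]])
    fix u k'
    assume u: "k' \<le> 100 * (4 * card E + 2 * n + 1) \<and> arr u 6 = ind A \<and> coloured E A (arr u) \<and> queue_clean n (arr u 10)"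
      and ks: "keeps (mod_regs (search visit_colour)) (mod_arrs (search visit_colour)) t u"
    have z: "arr u 9 = (\<lambda>_. 0)" "arr u 11 = (\<lambda>_. 0)" "arr u 12 = (\<lambda>_. 0)"
      using keepsD[OF keeps_mono[OF ks mods_colour]] h by simp_all
    have co: "arr u 8 = ind (side E A 1)"
      using u by (simp add: coloured_def)
    have "clean n (arr u)" using coloured_clean[OF A, of "arr u"] u z by blast
    moreover have "keeps {5..15} {7..12} s u"
    proof (rule keeps_trans)
      show "keeps {5..15} {7..12} s t" using h by blast
      show "keeps {8..13} {7, 8, 10} t u" by (rule keeps_mono[OF ks mods_colour])
    qed auto
    ultimately show "1 + k + k' \<le> 600 * graph_size \<and> keeps {5..15} {7..12} s u \<and>
      clean n (arr u) \<and> arr u 8 = ind (side E A 1)" using u h co by auto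
  qed (use h in auto)
qed

end

section \<open>Sets as numbers and output\<close>

definition powers :: com where
  "powers = (Assign 4 (N 1) ;; for_verts (Assign 4 (Plus (R 4) (R 4)) ;; Store 2 (R 5) (R 4)))"

definition encode :: com where
  "encode = (Assign 4 (N 0) ;;
    for_verts (If (Not (Eq (Arr 6 (R 5)) (N 0))) (Assign 4 (Plus (R 4) (Arr 2 (R 5)))) Skip))"

text \<open>Without division, binary digits are extracted from the highest power downwards by
  comparison and subtraction. As the counter runs upwards, register 6 holds the reversed
  index.\<close>

definition decode :: com where
  "decode = (Assign 4 (Arr 4 (R 1)) ;;
    for_verts (Assign 6 (Minus (Plus (R 0) (N 1)) (R 5)) ;;
      If (Less (R 4) (Arr 2 (R 6)))
        (Store 6 (R 6) (N 0))
        (Store 6 (R 6) (N 1) ;; Assign 4 (Minus (R 4) (Arr 2 (R 6))))))"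

definition write_set :: com where
  "write_set = (for_verts (If (Not (Eq (Arr 6 (R 5)) (N 0))) (Print (R 5)) Skip) ;; End_Solution)"

definition seed :: com where
  "seed = (for_nbrs 16 (If (And (Not (Eq (Arr 6 (R 7)) (N 0))) (Eq (Arr 8 (R 7)) (R 17)))
      (Store 6 (R 7) (N 0)) Skip) ;;
    Store 6 (R 16) (N 1))"

lemma set_encode_less: "set_encode (X \<inter> {..<w}) < 2 ^ w"
proof -
  have "set_encode (X \<inter> {..<w}) \<le> (\<Sum>i<w. 2 ^ i)"
    unfolding set_encode_def by (rule sum_mono2) auto
  also have "\<dots> < 2 ^ w" by (simp add: sum_power2[of w, folded atLeast0LessThan] flip: atLeast0LessThan)
  finally show ?thesis .
qed

lemma set_encode_Suc: "set_encode (X \<inter> {..Suc w}) =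
    (if Suc w \<in> X then 2 ^ Suc w else 0) + set_encode (X \<inter> {..w})"
proof (cases "Suc w \<in> X")
  case True
  then have "X \<inter> {..Suc w} = insert (Suc w) (X \<inter> {..w})" by auto
  then show ?thesis using True by (simp add: set_encode_insert)
next
  case False
  then have "X \<inter> {..Suc w} = X \<inter> {..w}" by (auto simp: le_Suc_eq)
  then show ?thesis using False by simp
qed

text \<open>The powers below \<open>2 ^ Suc w\<close> add up to less than it, so the comparison
  reads the top digit.\<close>

lemma set_encode_bit: "2 ^ Suc w \<le> set_encode (X \<inter> {..Suc w}) \<longleftrightarrow> Suc w \<in> X"
  using set_encode_less[of X "Suc w"] by (auto simp: set_encode_Suc lessThan_Suc_atMost not_le)

lemma wp_powers:
  assumes n: "reg s 0 = n"
  shows "wp powers s (\<lambda>t k. k \<le> 50 * (n + 1) \<and> (\<forall>v\<in>verts n. arr t 2 v = 2 ^ v))"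
  unfolding powers_def wp_Seq wp_Assign
proof (rule wp_for_verts[where n = n and \<tau> = 20 and
      I = "\<lambda>v t. reg t 4 = 2 ^ v \<and> (\<forall>u\<in>verts v. arr t 2 u = 2 ^ u)"], goal_cases)
  case (5 v t)
  then show ?case by (simp add: wp_simps verts_Suc mult_2)
qed (use n in \<open>auto simp: verts_def\<close>)

lemma wp_encode:
  assumes n: "reg s 0 = n" and X: "X \<subseteq> verts n" and s: "arr s 6 = ind X" "\<forall>v\<in>verts n. arr s 2 v = 2 ^ v"
  shows "wp encode s (\<lambda>t k. k \<le> 50 * (n + 1) \<and> keeps {4, 5} {} s t \<and> reg t 4 = set_encode X)"
  unfolding encode_def wp_Seq wp_Assign
proof (rule wp_for_verts[where n = n and \<tau> = 20 and
      I = "\<lambda>v t. reg t 4 = set_encode (X \<inter> {..v})"], goal_cases)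
  case 4
  have "X \<inter> {..0} = {}" using X by (auto simp: verts_def)
  then show ?case by simp
next
  case (5 v t)
  have "arr t = arr s" using 5(5) by (auto simp: keeps_def fun_eq_iff)
  then show ?case using 5 s set_encode_Suc[of X v] by (auto simp: wp_simps verts_def)
next
  case (7 t k)
  have "X \<inter> {..n} = X" using X by (auto simp: verts_def)
  then show ?case using 7 by (auto simp: keeps_def)
qed (use n in auto)

text \<open>Positions are overwritten from \<open>n\<close> downwards: array 6 holds
  \<open>X\<close> above the current vertex and the leftover \<open>Y\<close> below, while register
  4 is the code of the part of \<open>X\<close> still to come.\<close>

lemma wp_decode:
  assumes n: "reg s 0 = n" and X: "X \<subseteq> verts n" "Y \<subseteq> verts n"
    and s: "arr s 6 = ind Y" "\<forall>v\<in>verts n. arr s 2 v = 2 ^ v" "arr s 4 (reg s 1) = set_encode X"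
  shows "wp decode s (\<lambda>t k. k \<le> 50 * (n + 1) \<and> keeps {4, 5, 6} {6} s t \<and> arr t 6 = ind X)"
  unfolding decode_def wp_Seq wp_Assign
proof (rule wp_for_verts[where n = n and \<tau> = 30 and
      I = "\<lambda>v t. reg t 4 = set_encode (X \<inter> {..n - v}) \<and> arr t 6 = ind (Y \<inter> {..n - v} \<union> X \<inter> {n - v<..})"], goal_cases)
  case 4
  have "X \<inter> {..n} = X" "Y \<inter> {..n} \<union> X \<inter> {n<..} = Y" using X by (auto simp: verts_def)
  then show ?case using s by simp
next
  case (5 v t)
  obtain w where w: "n - v = Suc w" using 5(2) by (cases "n - v") auto
  have w': "n - Suc v = w" "n + 1 - Suc v = Suc w" "Suc w \<in> verts n" using w 5(2) by (auto simp: verts_def)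
  have p: "arr t 2 (Suc w) = 2 ^ Suc w" using 5(5) s w' by (simp add: keeps_def)
  have e: "Y \<inter> {..Suc w} \<union> X \<inter> {Suc w<..} - {Suc w} = Y \<inter> {..w} \<union> X \<inter> {w<..}" if "Suc w \<notin> X"
    using that by (auto simp: le_Suc_eq Suc_le_eq) (metis Suc_lessI)
  have e': "insert (Suc w) (Y \<inter> {..Suc w} \<union> X \<inter> {Suc w<..}) = Y \<inter> {..w} \<union> X \<inter> {w<..}" if "Suc w \<in> X"
    using that by (auto simp: le_Suc_eq Suc_le_eq)
  have m: "reg t 4 = set_encode (X \<inter> {..Suc w})" and i: "arr t 6 = ind (Y \<inter> {..Suc w} \<union> X \<inter> {Suc w<..})"
    using 5(1) w by auto
  have lt: "reg t 4 < arr t 2 (Suc w) \<longleftrightarrow> Suc w \<notin> X"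
    unfolding m p using set_encode_bit[of w X] by linarith
  have w'': "Suc (reg t 0) - Suc v = Suc w" using w' 5 by simp
  show ?case
  proof (cases "Suc w \<in> X")
    case True
    then have "set_encode (X \<inter> {..Suc w}) - 2 ^ Suc w = set_encode (X \<inter> {..w})"
      by (simp add: set_encode_Suc)
    then show ?thesis using True lt 5(3,4) w'' w' p m i e'
      by (simp add: wp_simps ind_insert)
  next
    case False
    then have "set_encode (X \<inter> {..Suc w}) = set_encode (X \<inter> {..w})"
      by (simp add: set_encode_Suc)
    then show ?thesis using False lt 5(3,4) w'' w' p m i e
      by (simp add: wp_simps ind_remove)
  qed
next
  case (7 t k)
  have "Y \<inter> {..0} \<union> X \<inter> {0<..} = X" using X by (auto simp: verts_def)
  then show ?case using 7 by (auto simp: keeps_def)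
qed (use n in auto)

lemma exec_write_set:
  assumes n: "reg s 0 = n" and X: "X \<subseteq> verts n" "arr s 6 = ind X"
  shows "\<exists>tr t. exec write_set s tr t \<and> keeps {5} {} s t \<and> ntick tr \<le> 50 * (n + 1) \<and>
    outputs tr = map Printed (sorted_list_of_set X) @ [Solution_End]"
proof -
  let ?b = "Less (R 5) (R 0)"
  let ?c = "Assign 5 (Plus (R 5) (N 1)) ;; If (Not (Eq (Arr 6 (R 5)) (N 0))) (Print (R 5)) Skip"
  have loop: "\<exists>tr t. exec (While ?b ?c) s tr t \<and> keeps {5} {} s t \<and> ntick tr \<le> 30 * (n - reg s 5) + 4 \<and>
      outputs tr = map Printed (filter (\<lambda>v. v \<in> X) [Suc (reg s 5)..<Suc n])"
    if "reg s 0 = n" "arr s 6 = ind X" "reg s 5 \<le> n" for s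
    using that
  proof (induction "n - reg s 5" arbitrary: s)
    case 0
    then have "\<not> bval ?b s" by simp
    then have "exec (While ?b ?c) s (ticks (1 + bcost ?b)) s" by (rule exec.WhileFalse)
    then show ?case using 0 by (intro exI conjI) (assumption, auto)
  next
    case (Suc m)
    let ?v = "Suc (reg s 5)"
    let ?s = "s\<lparr>reg := (reg s)(5 := ?v)\<rparr>"
    have b: "bval ?b s" using Suc by simp
    obtain tr t where tr: "exec (While ?b ?c) ?s tr t" "keeps {5} {} ?s t" "ntick tr \<le> 30 * (n - ?v) + 4"
      "outputs tr = map Printed (filter (\<lambda>v. v \<in> X) [Suc ?v..<Suc n])"
    proof -
      have "m = n - reg ?s 5" "reg ?s 0 = n" "arr ?s 6 = ind X" "reg ?s 5 \<le> n" using Suc(2-) by auto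
      from Suc(1)[OF this] show ?thesis using that by (auto simp del: upt_Suc)
    qed
    obtain tr1 where tr1: "exec ?c s tr1 ?s" "ntick tr1 \<le> 20"
      "outputs tr1 = (if ?v \<in> X then [Printed ?v] else [])"
    proof (cases "?v \<in> X")
      case True
      have "exec ?c s (ticks 1 @ ticks (1 + acost (Plus (R 5) (N 1))) @ ticks (1 + bcost (Not (Eq (Arr 6 (R 5)) (N 0)))) @
          ticks (1 + acost (R 5)) @ [Printed (aval (R 5) ?s)]) ?s"
        by (rule exec.Seq[OF _ exec.IfTrue[OF _ exec.Print]]) (use exec.Assign[of 5 "Plus (R 5) (N 1)" s] True Suc in auto)
      then show ?thesis by (rule that) (use True in auto)
    next
      case False
      have "exec ?c s (ticks 1 @ ticks (1 + acost (Plus (R 5) (N 1))) @ ticks (1 + bcost (Not (Eq (Arr 6 (R 5)) (N 0)))) @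
          ticks 1) ?s"
        by (rule exec.Seq[OF _ exec.IfFalse[OF _ exec.Skip]]) (use exec.Assign[of 5 "Plus (R 5) (N 1)" s] False Suc in auto)
      then show ?thesis by (rule that) (use False in auto)
    qed
    have "[?v..<Suc n] = ?v # [Suc ?v..<Suc n]" using Suc(2-) by (intro upt_conv_Cons) simp
    moreover have "n - reg s 5 = Suc (n - ?v)" using Suc by simp
    ultimately show ?case
      using exec.WhileTrue[OF b tr1(1) tr(1)] tr1 tr
      by (intro exI[of _ "ticks (1 + bcost ?b) @ tr1 @ tr"] exI[of _ t]) (auto simp: keeps_def)
  qed
  let ?s = "s\<lparr>reg := (reg s)(5 := 0)\<rparr>"
  obtain tr t where tr: "exec (While ?b ?c) ?s tr t" "keeps {5} {} ?s t" "ntick tr \<le> 30 * n + 4"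
      "outputs tr = map Printed (filter (\<lambda>v. v \<in> X) [1..<Suc n])"
    using loop[of ?s] n X by auto
  have "sorted_list_of_set X = filter (\<lambda>v. v \<in> X) [1..<Suc n]"
    by (rule sorted_distinct_set_unique)
      (use X finite_subset[OF X(1)] in \<open>auto simp: verts_def sorted_wrt_filter simp del: upt_Suc\<close>)
  moreover have "exec (Assign 5 (N 0)) s (ticks 2) ?s" using exec.Assign[of 5 "N 0" s] by (simp add: numeral_2_eq_2)
  ultimately show ?thesis
    using exec.Seq[OF exec.Seq[OF _ tr(1)] exec.End_Solution] tr
    unfolding write_set_def for_verts_def
    by (intro exI[of _ "ticks 1 @ (ticks 1 @ ticks 2 @ tr) @ ticks 1 @ [Solution_End]"] exI[of _ t])
      (auto simp: keeps_def)
qed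

context graph_input
begin

text \<open>Array 8 is the indicator of class 1, so on \<open>B\<close> its value equals
  \<open>i\<close> exactly for the members of class \<open>i\<close>.\<close>

lemma wp_seed:
  assumes B: "B \<subseteq> verts n" "bipartite E B" and i: "i \<in> {0, 1}" and v: "v \<in> verts n" "v \<notin> B"
    and s: "reg s 16 = v" "reg s 17 = i" "arr s 0 = off" "arr s 1 = adj" "arr s 6 = ind B"
      "arr s 8 = ind (side E B 1)"
  shows "wp seed s (\<lambda>t k. k \<le> 100 * graph_size \<and> keeps {6, 7} {6} s t \<and> arr t 6 = ind (nbr_seed E B v i))"
  unfolding seed_def wp_Seq
proof (rule wp_for_nbrs[where y = v and \<tau> = 30 and I = "\<lambda>M t. arr t 6 = ind (B - (M \<inter> side E B i))"], goal_cases)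
  case (13 M u t)
  have r: "reg t 17 = i" "arr t 8 = ind (side E B 1)" using 13(5) s by (auto simp: keeps_def)
  have sides: "u \<in> B \<Longrightarrow> ind (side E B 1) u = i \<longleftrightarrow> u \<in> side E B i"
    using side_bipartition[OF B(2)] i by (auto simp: bipartition_def)
  show ?case
  proof (cases "u \<in> side E B i \<and> u \<in> B")
    case True
    have "B - M \<inter> side E B i - {u} = B - insert u M \<inter> side E B i" using True by auto
    then show ?thesis using 13 r sides True by (simp add: wp_simps ind_remove)
  next
    case False
    then have "B - M \<inter> side E B i = B - insert u M \<inter> side E B i" by auto
    moreover have "\<not> bval (And (Not (Eq (Arr 6 (R 7)) (N 0))) (Eq (Arr 8 (R 7)) (R 17))) t"
      using 13 r sides False by auto
    ultimately show ?thesis unfolding wp_If wp_Skip using 13(1) by (simp only: if_False) simp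
  qed
next
  case (14 t k)
  have "reg t 16 = v" using 14(2) s by (simp add: keeps_def)
  moreover have "insert v (B - (nbhd E v \<inter> side E B i)) = nbr_seed E B v i"
    using side_Un[OF B(2) i] side_bipartition[OF B(2)] i
    by (auto simp: nbr_seed_def bipartition_def)
  moreover have "deg v \<le> n"
    using card_mono[OF _ nbhd_verts[of v]] by (simp add: verts_def)
  ultimately show ?case using 14 by (simp add: wp_simps ind_insert) (auto simp: keeps_def)
qed (use s v in auto)

end

section \<open>Rounds of the main loop\<close>

definition enter :: com where
  "enter = (Store 3 (Arr 4 (R 1)) (N 1) ;; If (Eq (R 2) (N 0)) (decode ;; write_set) Skip)"

definition leave :: com where
  "leave = (If (Eq (R 2) (N 1)) (decode ;; write_set) Skip ;; Assign 1 (Minus (R 1) (N 1)) ;;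
    Assign 2 (Minus (N 1) (R 2)))"

definition visit_neighbor :: com where
  "visit_neighbor = (reset ;; search visit_colour) ;; seed ;; complete ;; encode ;;
    If (Eq (Arr 3 (R 4)) (N 0))
      (Assign 1 (Plus (R 1) (N 1)) ;; Store 4 (R 1) (R 4) ;; Store 5 (R 1) (N 0) ;;
       Assign 2 (Minus (N 1) (R 2)))
      Skip"

text \<open>The solution is decoded anew in every round, because a completion overwrites array
  6.\<close>

definition step :: com where
  "step = (decode ;;
    If (Less (R 3) (Plus (R 0) (N 1)))
      (Assign 16 (R 3) ;; Assign 17 (N 0))
      (Assign 16 (Minus (R 3) (R 0)) ;; Assign 17 (N 1)) ;;
    If (Eq (Arr 6 (R 16)) (N 0)) visit_neighbor Skip)"

text \<open>The recursion is unrolled over an explicit stack. The position of the top call tells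
  what its next round does: 0 enters, 1 to \<open>2 * n\<close> treat a neighbour,
  \<open>2 * n + 1\<close> leaves. It is advanced before the work, so a caller resumes behind the
  neighbour that it called.\<close>

definition body :: com where
  "body = (Assign 3 (Arr 5 (R 1)) ;; Store 5 (R 1) (Plus (R 3) (N 1)) ;;
    If (Eq (R 3) (N 0)) enter (If (Less (R 3) (Plus (Plus (R 0) (R 0)) (N 1))) step leave))"

definition solution_events :: "nat set \<Rightarrow> event list" where
  "solution_events S = map Printed (sorted_list_of_set S) @ [Solution_End]"

lemma set_encode_inject: "X \<subseteq> verts n \<Longrightarrow> Y \<subseteq> verts n \<Longrightarrow> set_encode X = set_encode Y \<longleftrightarrow> X = Y"
  by (metis set_encode_eq finite_subset finite_atLeastAtMost verts_def)

lemma silent_step: "silent step"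
  by (simp add: step_def visit_neighbor_def decode_def encode_def complete_def extend_def reset_def seed_def
      program_defs for_verts_def for_nbrs_def)

context graph_input
begin

section \<open>The neighbours of a solution as a numbered list\<close>

definition nbr :: "nat set \<Rightarrow> nat \<Rightarrow> nat set" where
  "nbr S p = (if p \<le> n then if p \<in> S then S else completion (nbr_seed E S p 0)
     else if p - n \<in> S then S else completion (nbr_seed E S (p - n) 1))"

definition nbr_list :: "nat set \<Rightarrow> nat set list" where
  "nbr_list S = map (nbr S) [1..<2 * n + 1]"

lemma set_nbr_list: "set (nbr_list S) = neighbors n E completion S"
proof -
  have "{1..<2 * n + 1} = {1..n} \<union> (\<lambda>v. v + n) ` {1..n}"
  proof -
    have "{1..<2 * n + 1} = {1..n} \<union> {1 + n..n + n}" by auto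
    also have "{1 + n..n + n} = (\<lambda>v. v + n) ` {1..n}" by (simp add: add.commute)
    finally show ?thesis .
  qed
  then have "set (nbr_list S) = nbr S ` {1..n} \<union> (\<lambda>v. nbr S (v + n)) ` {1..n}"
    unfolding nbr_list_def set_map set_upt by (simp only: image_Un image_image)
  also have "\<dots> = (\<Union>v\<in>{1..n}. {nbr S v, nbr S (v + n)})" by auto
  also have "\<dots> = (\<Union>v\<in>{1..n}. neighbors_at E completion S v)"
    by (rule SUP_cong) (auto simp: nbr_def neighbors_at_eq)
  finally show ?thesis by (simp add: neighbors_def verts_def)
qed

lemma is_order_nbr_list: "is_order n E completion nbr_list"
  by (simp add: is_order_def set_nbr_list)

text \<open>The part of the memory that is independent of the stack. Between rounds array 6 holds
  some leftover vertex set, which the next decoding overwrites.\<close>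

definition base :: "state \<Rightarrow> nat set set \<Rightarrow> bool" where
  "base s \<V> \<longleftrightarrow> reg s 0 = n \<and> arr s 0 = off \<and> arr s 1 = adj \<and> (\<forall>v\<in>verts n. arr s 2 v = 2 ^ v) \<and>
    (\<forall>B. B \<subseteq> verts n \<longrightarrow> arr s 3 (set_encode B) = (if B \<in> \<V> then 1 else 0)) \<and>
    (\<exists>Y\<subseteq>verts n. arr s 6 = ind Y) \<and> clean n (arr s)"

lemma base_keeps:
  assumes "base s \<V>" "keeps X A s t" "0 \<notin> X" "A \<inter> {0, 1, 2, 3} = {}"
    "\<exists>Y\<subseteq>verts n. arr t 6 = ind Y" "clean n (arr t)"
  shows "base t \<V>"
proof -
  have "arr t 0 = arr s 0" "arr t 1 = arr s 1" "arr t 2 = arr s 2" "arr t 3 = arr s 3" "reg t 0 = reg s 0"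
    using assms(2-4) by (auto simp: keeps_def)
  then show ?thesis using assms(1,5,6) by (simp add: base_def)
qed

lemma clean_keeps: "clean n (arr s) \<Longrightarrow> keeps X A s t \<Longrightarrow> A \<inter> {7..12} = {} \<Longrightarrow> clean n (arr t)"
  by (auto simp: clean_def keeps_def)

lemma exec_output:
  assumes b: "base s \<V>" and S: "S \<subseteq> verts n" "arr s 4 (reg s 1) = set_encode S"
  shows "\<exists>tr t. exec (decode ;; write_set) s tr t \<and> keeps {4, 5, 6} {6} s t \<and> base t \<V> \<and>
    ntick tr \<le> 150 * graph_size \<and> outputs tr = solution_events S"
proof -
  obtain Y where Y: "Y \<subseteq> verts n" "arr s 6 = ind Y" using b by (auto simp: base_def)
  have "wp decode s (\<lambda>t k. k \<le> 50 * (n + 1) \<and> keeps {4, 5, 6} {6} s t \<and> arr t 6 = ind S)"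
    by (rule wp_decode[OF _ S(1) Y(1)]) (use b Y S in \<open>auto simp: base_def\<close>)
  then obtain tr1 t1 where 1: "exec decode s tr1 t1" "ntick tr1 \<le> 50 * (n + 1)"
    "keeps {4, 5, 6} {6} s t1" "arr t1 6 = ind S" unfolding wp_def by blast
  have "reg t1 0 = n" using 1(3) b by (simp add: keeps_def base_def)
  then obtain tr2 t2 where 2: "exec write_set t1 tr2 t2" "keeps {5} {} t1 t2" "ntick tr2 \<le> 50 * (n + 1)"
    "outputs tr2 = solution_events S"
    using exec_write_set[OF _ S(1) 1(4)] unfolding solution_events_def by blast
  have "silent decode" by (simp add: decode_def for_verts_def)
  then have "outputs (ticks 1 @ tr1 @ tr2) = solution_events S"
    using exec_silent[OF 1(1)] 2 by simp
  moreover have k: "keeps {4, 5, 6} {6} s t2" using 1(3) 2(2) by (rule keeps_trans) auto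
  moreover have "base t2 \<V>"
  proof (rule base_keeps[OF b k])
    have "arr t2 6 = ind S" using 2(2) 1(4) by (simp add: keeps_def)
    then show "\<exists>Y\<subseteq>verts n. arr t2 6 = ind Y" using S by blast
    show "clean n (arr t2)" by (rule clean_keeps[OF _ k]) (use b in \<open>auto simp: base_def\<close>)
  qed auto
  moreover have "exec (decode ;; write_set) s (ticks 1 @ tr1 @ tr2) t2"
    using exec.Seq[OF 1(1) 2(1)] .
  moreover have "ntick (ticks 1 @ tr1 @ tr2) \<le> 150 * graph_size" using 1 2 by simp
  ultimately show ?thesis by blast
qed

lemma wp_visit_neighbor:
  assumes b: "base s \<V>" and S: "S \<subseteq> verts n" "bipartite E S" and v: "v \<in> verts n" "v \<notin> S" and i: "i \<in> {0, 1}"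
    and s: "reg s 16 = v" "reg s 17 = i" "arr s 6 = ind S" "reg s 1 = Suc d" "reg s 2 = d mod 2"
    and T: "T = completion (nbr_seed E S v i)"
  shows "wp visit_neighbor s (\<lambda>t k. k \<le> 4200 * graph_size \<and> base t \<V> \<and>
    (if T \<in> \<V> then reg t 1 = Suc d \<and> reg t 2 = d mod 2 \<and> arr t 4 = arr s 4 \<and> arr t 5 = arr s 5
     else reg t 1 = Suc (Suc d) \<and> reg t 2 = Suc d mod 2 \<and> arr t 4 = (arr s 4)(Suc (Suc d) := set_encode T) \<and>
       arr t 5 = (arr s 5)(Suc (Suc d) := 0)))"
proof -
  let ?post = "\<lambda>t. if T \<in> \<V> then reg t 1 = Suc d \<and> reg t 2 = d mod 2 \<and> arr t 4 = arr s 4 \<and> arr t 5 = arr s 5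
     else reg t 1 = Suc (Suc d) \<and> reg t 2 = Suc d mod 2 \<and> arr t 4 = (arr s 4)(Suc (Suc d) := set_encode T) \<and>
       arr t 5 = (arr s 5)(Suc (Suc d) := 0)"
  let ?push = "If (Eq (Arr 3 (R 4)) (N 0))
    (Assign 1 (Plus (R 1) (N 1)) ;; Store 4 (R 1) (R 4) ;; Store 5 (R 1) (N 0) ;;
     Assign 2 (Minus (N 1) (R 2))) Skip"
  show ?thesis
  unfolding visit_neighbor_def wp_Seq[of "reset ;; search visit_colour"] wp_Seq[of seed]
    wp_Seq[of complete] wp_Seq[of encode]
proof (rule wp_mono[OF wp_sides[OF S]], goal_cases)
  case (6 t1 k1)
  note A = nbr_seed[OF simple S v i]
  have kr: "reg t1 16 = v" "reg t1 17 = i" "arr t1 0 = off" "arr t1 1 = adj" "arr t1 6 = ind S"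
    using 6 b s by (auto simp: keeps_def base_def)
  show ?case
  proof (rule wp_mono[OF wp_seed[OF S i v kr]])
    show "arr t1 8 = ind (side E S 1)" using 6 by blast
  next
    fix t2 k2
    assume h2: "k2 \<le> 100 * graph_size \<and> keeps {6, 7} {6} t1 t2 \<and> arr t2 6 = ind (nbr_seed E S v i)"
    have c2: "clean n (arr t2)" by (rule clean_keeps[of t1 "{6, 7}" "{6}"]) (use 6 h2 in auto)
    have kr2: "reg t2 0 = n" "arr t2 0 = off" "arr t2 1 = adj" "arr t2 6 = ind (nbr_seed E S v i)"
      using 6 h2 b by (auto simp: keeps_def base_def)
    have k2: "keeps {5..15} {6..12} s t2"
      by (rule keeps_trans[of "{5..15}" "{7..12}" s t1 "{6, 7}" "{6}"]) (use 6 h2 in auto)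
    show "wp complete t2 (\<lambda>s' k. wp encode s' (\<lambda>s' ka. wp (?push) s'
       (\<lambda>t k'. 1 + k1 + (1 + k2 + (1 + k + (1 + ka + k'))) \<le> 4200 * graph_size \<and> base t \<V> \<and>
    ?post t)))"
    proof (rule wp_mono[OF wp_complete[OF A kr2 c2]])
      fix t3 k3
      assume h3: "k3 \<le> 3200 * graph_size \<and> keeps {5..15} {6..12} t2 t3 \<and> clean n (arr t3) \<and>
        arr t3 6 = ind (completion (nbr_seed E S v i))"
      have k3: "keeps {5..15} {6..12} s t3"
        by (rule keeps_trans[OF k2 h3[THEN conjunct2, THEN conjunct1]]) auto
      have Tv: "T \<subseteq> verts n" using is_comp_max(2)[OF is_comp_completion A] T by (simp add: max_bip_def)
      have b3: "base t3 \<V>" by (rule base_keeps[OF b k3]) (use h3 T Tv in auto)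
      show "wp encode t3 (\<lambda>s' ka. wp (?push) s'
       (\<lambda>t k'. 1 + k1 + (1 + k2 + (1 + k3 + (1 + ka + k'))) \<le> 4200 * graph_size \<and> base t \<V> \<and>
    ?post t))"
      proof (rule wp_mono[OF wp_encode[OF _ Tv]])
        show "reg t3 0 = n" "arr t3 6 = ind T" "\<forall>v\<in>verts n. arr t3 2 v = 2 ^ v"
          using b3 h3 T by (auto simp: base_def)
      next
        fix t4 k4
        assume h4: "k4 \<le> 50 * (n + 1) \<and> keeps {4, 5} {} t3 t4 \<and> reg t4 4 = set_encode T"
        have k4: "keeps {4..15} {6..12} s t4"
          by (rule keeps_trans[OF k3 h4[THEN conjunct2, THEN conjunct1]]) auto
        have a4: "arr t4 = arr t3" using h4 by (auto simp: keeps_def fun_eq_iff)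
        have b4: "base t4 \<V>"
          by (rule base_keeps[OF b3 h4[THEN conjunct2, THEN conjunct1]]) (use a4 h3 T Tv in auto)
        have v4: "arr t4 3 (set_encode T) = (if T \<in> \<V> then 1 else 0)"
          using b4 Tv by (simp add: base_def)
        have r4: "reg t4 1 = Suc d" "reg t4 2 = d mod 2" "arr t4 4 = arr s 4" "arr t4 5 = arr s 5"
          using k4 s by (auto simp: keeps_def)
        have mod: "Suc 0 - d mod 2 = Suc d mod 2" by presburger
        have bs: "base (t4\<lparr>reg := (reg t4)(1 := x, 2 := y), arr := (arr t4)(4 := f, 5 := g)\<rparr>) \<V>" for x y f g
          using b4 by (auto simp: base_def clean_def)
        show "wp (?push) t4
           (\<lambda>t k'. 1 + k1 + (1 + k2 + (1 + k3 + (1 + k4 + k'))) \<le> 4200 * graph_size \<and> base t \<V> \<and>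
        ?post t)"
        proof (cases "T \<in> \<V>")
          case True
          then show ?thesis using v4 h4 h3 h2 6 b4 r4 by (simp add: wp_simps)
        next
          case False
          have "base (t4\<lparr>reg := (reg t4)(1 := Suc (Suc d)),
              arr := (arr t4)(4 := (arr s 4)(Suc (Suc d) := set_encode T), 5 := (arr s 5)(Suc (Suc d) := 0)),
              reg := (reg t4)(1 := Suc (Suc d), 2 := Suc d mod 2)\<rparr>) \<V>"
            using b4 by (simp add: base_def clean_def)
          then show ?thesis using v4 h4 h3 h2 6 r4 False mod by (simp add: wp_simps)
        qed
      qed
    qed
  qed
qed (use b s in \<open>auto simp: base_def\<close>)
qed

text \<open>If \<open>v\<close> lies in \<open>S\<close>, the neighbour is \<open>S\<close> itself,
  which is in \<open>\<V>\<close> already, so no completion is computed and nothing is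
  pushed.\<close>

lemma wp_step:
  assumes b: "base s \<V>" and S: "S \<subseteq> verts n" "bipartite E S" "S \<in> \<V>" and p: "1 \<le> p" "p \<le> 2 * n"
    and s: "reg s 3 = p" "reg s 1 = Suc d" "reg s 2 = d mod 2" "arr s 4 (Suc d) = set_encode S"
  shows "wp step s (\<lambda>t k. k \<le> 4500 * graph_size \<and> base t \<V> \<and>
    (if nbr S p \<in> \<V> then reg t 1 = Suc d \<and> reg t 2 = d mod 2 \<and> arr t 4 = arr s 4 \<and> arr t 5 = arr s 5
     else reg t 1 = Suc (Suc d) \<and> reg t 2 = Suc d mod 2 \<and>
       arr t 4 = (arr s 4)(Suc (Suc d) := set_encode (nbr S p)) \<and>
       arr t 5 = (arr s 5)(Suc (Suc d) := 0)))"
proof -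
  let ?post = "\<lambda>t. if nbr S p \<in> \<V> then reg t 1 = Suc d \<and> reg t 2 = d mod 2 \<and> arr t 4 = arr s 4 \<and> arr t 5 = arr s 5
     else reg t 1 = Suc (Suc d) \<and> reg t 2 = Suc d mod 2 \<and>
       arr t 4 = (arr s 4)(Suc (Suc d) := set_encode (nbr S p)) \<and>
       arr t 5 = (arr s 5)(Suc (Suc d) := 0)"
  define v where "v = (if p \<le> n then p else p - n)"
  define i :: nat where "i = (if p \<le> n then 0 else 1)"
  have v: "v \<in> verts n" and i: "i \<in> {0, 1}" using p by (auto simp: v_def i_def verts_def)
  have T: "nbr S p = (if v \<in> S then S else completion (nbr_seed E S v i))"
    by (simp add: nbr_def v_def i_def)
  obtain Y where Y: "Y \<subseteq> verts n" "arr s 6 = ind Y" using b by (auto simp: base_def)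
  have "wp decode s (\<lambda>t k. k \<le> 50 * (n + 1) \<and> keeps {4, 5, 6} {6} s t \<and> arr t 6 = ind S)"
    by (rule wp_decode[OF _ S(1) Y(1)]) (use b Y s in \<open>auto simp: base_def\<close>)
  then show ?thesis
    unfolding step_def wp_Seq[of decode]
  proof (rule wp_mono)
    fix t k
    assume h: "k \<le> 50 * (n + 1) \<and> keeps {4, 5, 6} {6} s t \<and> arr t 6 = ind S"
    have r: "reg t 0 = n" "reg t 1 = Suc d" "reg t 2 = d mod 2" "reg t 3 = p" "arr t 4 = arr s 4" "arr t 5 = arr s 5"
      using h s b by (auto simp: keeps_def base_def)
    have bt: "base t \<V>"
    proof (rule base_keeps[OF b h[THEN conjunct2, THEN conjunct1]])
      show "clean n (arr t)" by (rule clean_keeps[of s "{4, 5, 6}" "{6}"]) (use b h in \<open>auto simp: base_def\<close>)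
    qed (use h S in auto)
    let ?t = "t\<lparr>reg := (reg t)(16 := v, 17 := i)\<rparr>"
    have bt': "base ?t \<V>" using bt by (simp add: base_def)
    have "wp (If (Eq (Arr 6 (R 16)) (N 0)) visit_neighbor Skip) ?t (\<lambda>t k'. k + k' + 30 \<le> 4500 * graph_size \<and> base t \<V> \<and>
    ?post t)"
    proof (cases "v \<in> S")
      case True
      then show ?thesis using h r T S bt' by (simp add: wp_simps)
    next
      case False
      have w: "wp visit_neighbor ?t (\<lambda>t k. k \<le> 4200 * graph_size \<and> base t \<V> \<and>
        (if nbr S p \<in> \<V> then reg t 1 = Suc d \<and> reg t 2 = d mod 2 \<and> arr t 4 = arr ?t 4 \<and> arr t 5 = arr ?t 5
         else reg t 1 = Suc (Suc d) \<and> reg t 2 = Suc d mod 2 \<and>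
          arr t 4 = (arr ?t 4)(Suc (Suc d) := set_encode (nbr S p)) \<and>
          arr t 5 = (arr ?t 5)(Suc (Suc d) := 0)))"
        by (rule wp_visit_neighbor[OF bt' S(1,2) v False i]) (use h r T False in auto)
      have bv: "bval (Eq (Arr 6 (R 16)) (N 0)) ?t" using h False by simp
      show ?thesis
        unfolding wp_If if_P[OF bv]
        by (rule wp_mono[OF w]) (use h r in auto)
    qed
    then show "wp (If (Less (R 3) (Plus (R 0) (N 1)))
      (Assign 16 (R 3) ;; Assign 17 (N 0))
      (Assign 16 (Minus (R 3) (R 0)) ;; Assign 17 (N 1)) ;;
    If (Eq (Arr 6 (R 16)) (N 0)) visit_neighbor Skip) t (\<lambda>t k'. 1 + k + k' \<le> 4500 * graph_size \<and> base t \<V> \<and>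
    ?post t)"
      unfolding wp_Seq wp_If[of "Less (R 3) (Plus (R 0) (N 1))"] wp_Assign
      using r by (cases "p \<le> n") (auto simp: v_def i_def elim!: wp_mono)
  qed
qed

end

section \<open>Delay\<close>

fun since :: "nat \<Rightarrow> event list \<Rightarrow> nat" where
  "since k [] = k"
| "since k (Tick # tr) = since (Suc k) tr"
| "since k (Printed v # tr) = since k tr"
| "since k (Solution_End # tr) = since 0 tr"

text \<open>In contrast to \<open>gaps\<close>, the open gap at the end is left to
  \<open>since\<close>; together the two functions compose under concatenation of traces.\<close>

fun gaps_below :: "nat \<Rightarrow> nat \<Rightarrow> event list \<Rightarrow> bool" where
  "gaps_below b k [] \<longleftrightarrow> True"
| "gaps_below b k (Tick # tr) \<longleftrightarrow> gaps_below b (Suc k) tr"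
| "gaps_below b k (Printed v # tr) \<longleftrightarrow> gaps_below b k tr"
| "gaps_below b k (Solution_End # tr) \<longleftrightarrow> k \<le> b \<and> gaps_below b 0 tr"

lemma since_append: "since k (tr @ tr') = since (since k tr) tr'"
  by (induction k tr rule: since.induct) auto

lemma gaps_below_append: "gaps_below b k (tr @ tr') \<longleftrightarrow> gaps_below b k tr \<and> gaps_below b (since k tr) tr'"
  by (induction b k tr rule: gaps_below.induct) auto

lemma since_le: "since k tr \<le> k + ntick tr"
  by (induction k tr rule: since.induct) (auto intro: le_trans)

lemma since_le_ntick: "Solution_End \<in> set tr \<Longrightarrow> since k tr \<le> ntick tr"
  by (induction k tr rule: since.induct) (use since_le[of 0] in auto)

lemma gaps_below_ntick: "k + ntick tr \<le> b \<Longrightarrow> gaps_below b k tr"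
  by (induction b k tr rule: gaps_below.induct) auto

lemma gaps_le: "gaps_below b k tr \<Longrightarrow> since k tr \<le> b \<Longrightarrow> g \<in> set (gaps k tr) \<Longrightarrow> g \<le> b"
  by (induction b k tr rule: gaps_below.induct) auto

lemma delay_le:
  assumes "gaps_below b 0 tr" "since 0 tr \<le> b"
  shows "delay tr \<le> b"
proof -
  have "gaps k tr \<noteq> []" for k by (induction k tr rule: gaps.induct) auto
  then show ?thesis unfolding delay_def using gaps_le[OF assms] by (intro Max.boundedI) auto
qed

text \<open>A run of \<open>While\<close> always includes the final exit. Calls of
  \<open>enum\<close> correspond to inner segments of one long run, hence this notion of finitely
  many rounds without an exit.\<close>

inductive iterates :: "bexp \<Rightarrow> com \<Rightarrow> state \<Rightarrow> event list \<Rightarrow> state \<Rightarrow> bool" for b c where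
  stop: "iterates b c s [] s"
| more: "bval b s \<Longrightarrow> exec c s tr1 s' \<Longrightarrow> iterates b c s' tr2 t \<Longrightarrow>
    iterates b c s (ticks (1 + bcost b) @ tr1 @ tr2) t"

lemma iterates_trans: "iterates b c s tr1 s' \<Longrightarrow> iterates b c s' tr2 t \<Longrightarrow> iterates b c s (tr1 @ tr2) t"
proof (induction rule: iterates.induct)
  case (more s tr1 s' tr2' t')
  then show ?case using iterates.more[OF more.hyps(1,2)] by simp
qed simp

lemma iterates_exit: "iterates b c s tr t \<Longrightarrow> \<not> bval b t \<Longrightarrow>
    exec (While b c) s (tr @ ticks (1 + bcost b)) t"
proof (induction rule: iterates.induct)
  case (stop s)
  then show ?case using exec.WhileFalse by simp
next
  case (more s tr1 s' tr2 t)
  then show ?case using exec.WhileTrue[OF more.hyps(1,2)] by simp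
qed

definition guard :: bexp where
  "guard = Less (N 0) (R 1)"

definition push_first :: com where
  "push_first = (Store 4 (N 1) (R 4) ;; Store 5 (N 1) (N 0) ;; Assign 1 (N 1) ;; Assign 2 (N 0))"

definition algorithm :: com where
  "algorithm = (powers ;; complete ;; encode ;; push_first ;; While guard body)"

context graph_input
begin

definition frame :: "state \<Rightarrow> nat \<Rightarrow> nat set \<Rightarrow> nat \<Rightarrow> nat set set \<Rightarrow> bool" where
  "frame s d S p \<V> \<longleftrightarrow> base s \<V> \<and> reg s 1 = Suc d \<and> reg s 2 = d mod 2 \<and>
    arr s 4 (Suc d) = set_encode S \<and> arr s 5 (Suc d) = p"

text \<open>The call at depth \<open>d\<close> has its own entry at index \<open>Suc d\<close>; the
  entries up to \<open>d\<close> belong to its callers.\<close>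

definition below :: "state \<Rightarrow> state \<Rightarrow> nat \<Rightarrow> bool" where
  "below s t d \<longleftrightarrow> (\<forall>e\<le>d. arr t 4 e = arr s 4 e \<and> arr t 5 e = arr s 5 e)"

lemma below_trans: "below s t d \<Longrightarrow> below t u d \<Longrightarrow> below s u d"
  by (simp add: below_def)

abbreviation round_cost :: nat where
  "round_cost \<equiv> 5000 * graph_size"

abbreviation next_pos :: "state \<Rightarrow> nat \<Rightarrow> nat \<Rightarrow> state" where
  "next_pos s d p \<equiv> s\<lparr>reg := (reg s)(3 := p), arr := (arr s)(5 := (arr s 5)(Suc d := Suc p))\<rparr>"

lemma iterates_body:
  assumes s: "reg s 0 = n" "reg s 1 = Suc d" "arr s 5 (Suc d) = p"
    and e: "exec (if p = 0 then enter else if p < 2 * n + 1 then step else leave) (next_pos s d p) tr t"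
    and k: "ntick tr \<le> 4600 * graph_size"
  shows "\<exists>tr'. iterates guard body s tr' t \<and> ntick tr' \<le> round_cost \<and>
    outputs tr' = outputs tr"
proof -
  let ?s1 = "s\<lparr>reg := (reg s)(3 := p)\<rparr>" and ?s2 = "next_pos s d p"
  let ?b0 = "Eq (R 3) (N 0)" and ?b1 = "Less (R 3) (Plus (Plus (R 0) (R 0)) (N 1))"
  have e1: "exec (Assign 3 (Arr 5 (R 1))) s (ticks (1 + acost (Arr 5 (R 1)))) ?s1"
    using exec.Assign[of 3 "Arr 5 (R 1)" s] s by simp
  have e2: "exec (Store 5 (R 1) (Plus (R 3) (N 1))) ?s1
      (ticks (1 + acost (R 1) + acost (Plus (R 3) (N 1)))) ?s2"
    using exec.Store[of 5 "R 1" "Plus (R 3) (N 1)" ?s1] s by simp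
  obtain j where e3: "exec (If ?b0 enter (If ?b1 step leave)) ?s2 (ticks j @ tr) t" "j \<le> 30"
  proof (cases "p = 0")
    case True
    then have "exec (If ?b0 enter (If ?b1 step leave)) ?s2 (ticks (1 + bcost ?b0) @ tr) t"
      using e by (intro exec.IfTrue) auto
    then show ?thesis by (rule that) simp
  next
    case False
    have "exec (If ?b1 step leave) ?s2 (ticks (1 + bcost ?b1) @ tr) t"
    proof (cases "p < 2 * n + 1")
      case True then show ?thesis using e s(1) False by (intro exec.IfTrue) auto
    next
      case ge: False
      then show ?thesis using e s(1) False by (intro exec.IfFalse) auto
    qed
    then have "exec (If ?b0 enter (If ?b1 step leave)) ?s2 (ticks (1 + bcost ?b0) @ ticks (1 + bcost ?b1) @ tr) t"
      by (rule exec.IfFalse[rotated]) (use False in simp)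
    then show ?thesis by (intro that[of "(1 + bcost ?b0) + (1 + bcost ?b1)"]) (simp_all add: replicate_add)
  qed
  obtain tr1 where b: "exec body s tr1 t" "ntick tr1 \<le> 100 + ntick tr"
    "outputs tr1 = outputs tr"
    by (rule that[OF exec.Seq[OF e1 exec.Seq[OF e2 e3(1)], folded body_def]]) (use e3(2) in auto)
  have "iterates guard body s (ticks (1 + bcost guard) @ tr1 @ []) t"
    by (rule iterates.more[OF _ b(1) iterates.stop]) (use s in \<open>simp add: guard_def\<close>)
  moreover have "ntick (ticks (1 + bcost guard) @ tr1 @ []) \<le> round_cost"
    using b(2) k by (simp add: guard_def)
  ultimately show ?thesis using b(3)
    by (intro exI[of _ "ticks (1 + bcost guard) @ tr1 @ []"]) (simp del: replicate.simps)
qed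

lemma exec_output_if:
  assumes b: "base s \<V>" and S: "S \<subseteq> verts n" "arr s 4 (reg s 1) = set_encode S"
  shows "\<exists>tr t. exec (If (Eq (R 2) (N c)) (decode ;; write_set) Skip) s tr t \<and> keeps {4, 5, 6} {6} s t \<and>
    base t \<V> \<and> ntick tr \<le> 160 * graph_size \<and> outputs tr = (if reg s 2 = c then solution_events S else [])"
proof (cases "reg s 2 = c")
  case True
  obtain tr t where t: "exec (decode ;; write_set) s tr t" "keeps {4, 5, 6} {6} s t" "base t \<V>"
    "ntick tr \<le> 150 * graph_size" "outputs tr = solution_events S"
    using exec_output[OF b S] by blast
  have "exec (If (Eq (R 2) (N c)) (decode ;; write_set) Skip) s (ticks (1 + bcost (Eq (R 2) (N c))) @ tr) t"
    by (rule exec.IfTrue[OF _ t(1)]) (use True in simp)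
  then show ?thesis
    using t True by (intro exI[of _ "ticks (1 + bcost (Eq (R 2) (N c))) @ tr"] exI[of _ t]) auto
next
  case False
  then have "exec (If (Eq (R 2) (N c)) (decode ;; write_set) Skip) s (ticks 5) s"
    by (simp add: exec_iffs numeral_eq_Suc)
  then show ?thesis using b False by (intro exI[of _ "ticks 5"] exI[of _ s]) auto
qed

section \<open>One round in each of the three modes\<close>

lemma round_enter:
  assumes f: "frame s d S 0 \<V>" and S: "S \<subseteq> verts n"
  obtains tr t where "iterates guard body s tr t" "ntick tr \<le> round_cost"
    "outputs tr = (if even d then solution_events S else [])"
    "frame t d S 1 (insert S \<V>)" "below s t d"
proof -
  let ?s = "next_pos s d 0"
  let ?s1 = "?s\<lparr>arr := (arr ?s)(3 := (arr s 3)(set_encode S := 1))\<rparr>"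
  have b1: "base ?s1 (insert S \<V>)"
    using f S set_encode_inject[OF _ S] by (auto simp: frame_def base_def clean_def)
  have "exec (Store 3 (Arr 4 (R 1)) (N 1)) ?s (ticks 4) ?s1"
    using f by (simp add: exec_iffs frame_def numeral_eq_Suc)
  moreover obtain tr t where t: "exec (If (Eq (R 2) (N 0)) (decode ;; write_set) Skip) ?s1 tr t"
      "keeps {4, 5, 6} {6} ?s1 t" "base t (insert S \<V>)" "ntick tr \<le> 160 * graph_size"
      "outputs tr = (if reg ?s1 2 = 0 then solution_events S else [])"
    using exec_output_if[OF b1 S, of 0] f by (auto simp: frame_def)
  ultimately have ex: "exec enter ?s (ticks 1 @ ticks 4 @ tr) t" unfolding enter_def by (intro exec.Seq)
  have "\<exists>tr'. iterates guard body s tr' t \<and> ntick tr' \<le> round_cost \<and> outputs tr' = outputs (ticks 1 @ ticks 4 @ tr)"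
    by (rule iterates_body[of s d 0]) (use f t ex in \<open>auto simp: frame_def base_def\<close>)
  moreover have "outputs (ticks 1 @ ticks 4 @ tr) = (if even d then solution_events S else [])"
    using t(5) f by (auto simp: frame_def filter_replicate even_iff_mod_2_eq_zero)
  moreover have "frame t d S 1 (insert S \<V>)" "below s t d"
    using f t(2,3) by (auto simp: frame_def keeps_def below_def)
  ultimately show ?thesis using that by auto
qed

lemma round_leave:
  assumes f: "frame s d S (2 * n + 1) \<V>" and S: "S \<subseteq> verts n"
  obtains tr t where "iterates guard body s tr t" "ntick tr \<le> round_cost"
    "outputs tr = (if even d then [] else solution_events S)"
    "base t \<V>" "reg t 1 = d" "reg t 2 = Suc d mod 2" "below s t d"
proof -
  let ?s = "next_pos s d (2 * n + 1)"
  have b1: "base ?s \<V>" using f by (auto simp: frame_def base_def clean_def)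
  obtain tr t where t: "exec (If (Eq (R 2) (N 1)) (decode ;; write_set) Skip) ?s tr t" "keeps {4, 5, 6} {6} ?s t"
      "base t \<V>" "ntick tr \<le> 160 * graph_size" "outputs tr = (if reg ?s 2 = 1 then solution_events S else [])"
    using exec_output_if[OF b1 S, of 1] f by (auto simp: frame_def)
  let ?t = "t\<lparr>reg := (reg t)(1 := d, 2 := Suc d mod 2)\<rparr>"
  have "reg t 1 = Suc d" "reg t 2 = d mod 2" using t(2) f by (auto simp: keeps_def frame_def)
  moreover have "Suc 0 - d mod 2 = Suc d mod 2" by presburger
  ultimately have "exec (Assign 1 (Minus (R 1) (N 1)) ;; Assign 2 (Minus (N 1) (R 2))) t (ticks 9) ?t"
    by (simp add: exec_iffs numeral_eq_Suc)
  then have ex: "exec leave ?s (ticks 1 @ tr @ ticks 9) ?t"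
    unfolding leave_def by (intro exec.Seq[OF t(1)])
  have "\<exists>tr'. iterates guard body s tr' ?t \<and> ntick tr' \<le> round_cost \<and> outputs tr' = outputs (ticks 1 @ tr @ ticks 9)"
    by (rule iterates_body[of s d "2 * n + 1"]) (use f t ex in \<open>auto simp: frame_def base_def\<close>)
  moreover have "outputs (ticks 1 @ tr @ ticks 9) = (if even d then [] else solution_events S)"
    using t(5) f by (auto simp: frame_def filter_replicate odd_iff_mod_2_eq_one)
  moreover have "below s ?t d" using t(2) by (auto simp: below_def keeps_def)
  moreover have "base ?t \<V>" using t(3) by (simp add: base_def)
  ultimately show ?thesis using that by auto
qed

lemma round_step:
  assumes f: "frame s d S p \<V>" and S: "S \<subseteq> verts n" "bipartite E S" "S \<in> \<V>" and p: "1 \<le> p" "p \<le> 2 * n"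
  obtains tr t where "iterates guard body s tr t" "ntick tr \<le> round_cost" "outputs tr = []"
    "if nbr S p \<in> \<V> then frame t d S (Suc p) \<V> else frame t (Suc d) (nbr S p) 0 \<V>"
    "arr t 4 (Suc d) = set_encode S" "arr t 5 (Suc d) = Suc p" "below s t d"
proof -
  let ?s = "next_pos s d p"
  have b1: "base ?s \<V>" using f by (auto simp: frame_def base_def clean_def)
  have r1: "reg ?s 3 = p" "reg ?s 1 = Suc d" "reg ?s 2 = d mod 2" "arr ?s 4 (Suc d) = set_encode S"
    using f by (auto simp: frame_def)
  obtain tr t where t: "exec step ?s tr t" "ntick tr \<le> 4500 * graph_size" "base t \<V>"
    "if nbr S p \<in> \<V> then reg t 1 = Suc d \<and> reg t 2 = d mod 2 \<and> arr t 4 = arr ?s 4 \<and> arr t 5 = arr ?s 5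
     else reg t 1 = Suc (Suc d) \<and> reg t 2 = Suc d mod 2 \<and>
       arr t 4 = (arr ?s 4)(Suc (Suc d) := set_encode (nbr S p)) \<and>
       arr t 5 = (arr ?s 5)(Suc (Suc d) := 0)"
    using wp_step[OF b1 S p r1] unfolding wp_def by blast
  obtain tr' where tr': "iterates guard body s tr' t" "ntick tr' \<le> round_cost"
      "outputs tr' = outputs tr"
    using iterates_body[of s d p tr t] f t p by (auto simp: frame_def base_def)
  have "outputs tr = []" by (rule exec_silent[OF t(1) silent_step])
  moreover have "if nbr S p \<in> \<V> then frame t d S (Suc p) \<V> else frame t (Suc d) (nbr S p) 0 \<V>"
    using t(3,4) r1 by (auto simp: frame_def)
  moreover have "arr t 4 (Suc d) = set_encode S" "arr t 5 (Suc d) = Suc p" "below s t d"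
    using t(4) r1 by (auto simp: below_def split: if_splits)
  ultimately show ?thesis using that tr' by metis
qed

text \<open>Bounds for the time since the last output at the start of a round, where \<open>p\<close> rounds have been
  spent on the current call at depth \<open>d\<close>: a call at even depth writes its solution in its first round,
  and one at odd depth is preceded by at most \<open>2 * n + 3\<close> rounds without output.\<close>

definition pending :: "nat \<Rightarrow> nat \<Rightarrow> nat" where
  "pending d p = (if odd d then round_cost * (2 * n + 3 + p)
     else if p = 0 then round_cost * (4 * n + 4) else round_cost * p)"

abbreviation max_gap :: nat where
  "max_gap \<equiv> round_cost * (4 * n + 5)"

text \<open>The worst case is an odd call in its last position, with
  \<open>2 * n + 3 + (2 * n + 1) = 4 * n + 4\<close> rounds, which is also the value before an even
  call enters. The current round makes it \<open>4 * n + 5\<close>.\<close>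

lemma pending_max: "p \<le> 2 * n + 1 \<Longrightarrow> pending d p + round_cost \<le> max_gap"
proof -
  assume p: "p \<le> 2 * n + 1"
  have "pending d p \<le> round_cost * (4 * n + 4)"
    unfolding pending_def using p by (auto simp del: mult_Suc_right intro!: mult_le_mono2)
  then show ?thesis by (simp add: algebra_simps)
qed

lemma pending_Suc: "1 \<le> p \<or> odd d \<Longrightarrow> pending d p + round_cost = pending d (Suc p)"
  unfolding pending_def by (auto simp: algebra_simps)

text \<open>From odd depth, \<open>2 * n + 3 + p\<close> rounds and the one that pushes stay within
  the \<open>4 * n + 4\<close> allowed to an even call, as \<open>p \<le> 2 * n\<close>; from even
  depth, \<open>p + 1 \<le> 2 * n + 3\<close>.\<close>

lemma pending_call: "1 \<le> p \<Longrightarrow> p \<le> 2 * n \<Longrightarrow> pending d p + round_cost \<le> pending (Suc d) 0"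
proof -
  assume p: "1 \<le> p" "p \<le> 2 * n"
  have "pending d p + round_cost = round_cost * ((if odd d then 2 * n + 3 + p else p) + 1)"
    using p by (auto simp: pending_def algebra_simps)
  also have "\<dots> \<le> round_cost * (if odd d then 4 * n + 4 else 2 * n + 3)"
    by (rule mult_le_mono2) (use p in auto)
  also have "\<dots> = pending (Suc d) 0" by (auto simp: pending_def)
  finally show ?thesis .
qed

text \<open>Bound on the time since the last output when a call returns. An even call writes in the
  first of its own \<open>2 * n + 2\<close> rounds, an odd one in its last round.\<close>

definition after_call :: "nat \<Rightarrow> nat" where
  "after_call d = (if even d then round_cost * (2 * n + 2) else round_cost)"

lemma after_call_pending: "1 \<le> p \<Longrightarrow> after_call (Suc d) \<le> pending d p"
proof -
  assume p: "1 \<le> p"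
  have "round_cost * (2 * n + 2) \<le> round_cost * (2 * n + 3 + p)" by (rule mult_le_mono2) simp
  moreover have "round_cost * 1 \<le> round_cost * p" using p by (rule mult_le_mono2)
  moreover have "after_call (Suc d) = (if odd d then round_cost * (2 * n + 2) else round_cost * 1)"
    by (simp add: after_call_def)
  moreover have "pending d p = (if odd d then round_cost * (2 * n + 3 + p) else round_cost * p)"
    using p by (simp add: pending_def)
  ultimately show ?thesis by (cases "odd d") (simp_all only: if_True if_False not_False_eq_True)
qed

lemma nbr_max:
  assumes "max_bip n E S" "1 \<le> p" "p \<le> 2 * n"
  shows "max_bip n E (nbr S p)"
proof -
  have "nbr S p \<in> neighbors n E completion S"
    unfolding set_nbr_list[symmetric] nbr_list_def set_map set_upt using assms(2,3) by (intro imageI) simp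
  then show ?thesis by (rule neighbors_max[OF simple is_comp_completion assms(1)])
qed

lemma remaining_Cons:
  assumes "S' # Ss = map (nbr S) [p..<2 * n + 1]" "p \<le> 2 * n + 1"
  shows "p \<le> 2 * n \<and> S' = nbr S p \<and> Ss = map (nbr S) [Suc p..<2 * n + 1]"
proof -
  have "p \<noteq> 2 * n + 1" using assms(1) by auto
  then have p: "p \<le> 2 * n" using assms(2) by simp
  then have "[p..<2 * n + 1] = p # [Suc p..<2 * n + 1]" by (intro upt_conv_Cons) simp
  then show ?thesis using assms(1) p by simp
qed

text \<open>The bound is required for every incoming count up to \<open>k\<close>, so that segments
  can be chained although only upper bounds of the counts are known.\<close>

definition emits :: "nat \<Rightarrow> nat \<Rightarrow> nat set list \<Rightarrow> event list \<Rightarrow> bool" where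
  "emits k j out tr \<longleftrightarrow> outputs tr = concat (map solution_events out) \<and>
    (\<forall>i\<le>k. gaps_below max_gap i tr \<and> since i tr \<le> j)"

lemma emits_append: "emits k j out tr \<Longrightarrow> emits j l out' tr' \<Longrightarrow> emits k l (out @ out') (tr @ tr')"
  by (simp add: emits_def gaps_below_append since_append)

lemma emits_silent:
  assumes "outputs tr = []" "ntick tr \<le> round_cost" "k + round_cost \<le> j" "k + round_cost \<le> max_gap"
  shows "emits k j [] tr"
  unfolding emits_def
proof (intro conjI allI impI)
  fix i assume i: "i \<le> k"
  show "gaps_below max_gap i tr" using i assms(2,4) by (intro gaps_below_ntick) linarith
  show "since i tr \<le> j" using since_le[of i tr] i assms(2,3) by linarith
qed (use assms in simp)

lemma emits_solution:
  assumes "outputs tr = solution_events S" "ntick tr \<le> round_cost" "round_cost \<le> j" "k + round_cost \<le> max_gap"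
  shows "emits k j [S] tr"
  unfolding emits_def
proof (intro conjI allI impI)
  fix i assume i: "i \<le> k"
  show "gaps_below max_gap i tr" using i assms(2,4) by (intro gaps_below_ntick) linarith
  have "Solution_End \<in> set (outputs tr)" using assms(1) by (simp add: solution_events_def)
  then show "since i tr \<le> j" using since_le_ntick[of tr i] assms(2,3) by simp
qed (use assms in simp)

text \<open>Induction on the derivation of the recursive run. Entering, skipping and leaving take
  one round each; a call takes one pushing round followed by the rounds of the callee. The rest of a
  loop is identified by the position \<open>p\<close>.\<close>

lemma enum_loop_simulation:
  "enum ord d S \<V> out \<V>' \<Longrightarrow> ord = nbr_list \<Longrightarrow> frame s d S 0 \<V> \<Longrightarrow> max_bip n E S \<Longrightarrow>
    \<exists>tr t. iterates guard body s tr t \<and> base t \<V>' \<and> reg t 1 = d \<and> reg t 2 = Suc d mod 2 \<and> below s t d \<and>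
      emits (pending d 0) (after_call d) out tr"
  "loop ord d L \<V> out \<V>' \<Longrightarrow> ord = nbr_list \<Longrightarrow> L = map (nbr S) [p..<2 * n + 1] \<Longrightarrow> 1 \<le> p \<Longrightarrow> p \<le> 2 * n + 1 \<Longrightarrow>
    frame s d S p \<V> \<Longrightarrow> max_bip n E S \<Longrightarrow> S \<in> \<V> \<Longrightarrow>
    \<exists>tr t. iterates guard body s tr t \<and> frame t d S (2 * n + 1) \<V>' \<and> below s t d \<and>
      emits (pending d p) (pending d (2 * n + 1)) out tr"
proof (induction arbitrary: s and S p s rule: enum_loop.inducts)
  case (enum d S \<V> out \<V>')
  have S: "S \<subseteq> verts n" using enum.prems by (simp add: max_bip_def)
  obtain tr1 s1 where 1: "iterates guard body s tr1 s1" "ntick tr1 \<le> round_cost"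
    "outputs tr1 = (if even d then solution_events S else [])" "frame s1 d S 1 (insert S \<V>)" "below s s1 d"
    using round_enter[OF enum.prems(2) S] by metis
  have e1: "emits (pending d 0) (pending d 1) (if even d then [S] else []) tr1"
  proof (cases "even d")
    case True
    then show ?thesis using 1(2,3) pending_max[of 0 d] by (auto simp: pending_def intro!: emits_solution)
  next
    case False
    then show ?thesis using 1(2,3) pending_max[of 0 d] pending_Suc[of 0 d] by (auto intro!: emits_silent)
  qed
  obtain tr2 s2 where 2: "iterates guard body s1 tr2 s2" "frame s2 d S (2 * n + 1) \<V>'" "below s1 s2 d"
    "emits (pending d 1) (pending d (2 * n + 1)) out tr2"
    using enum.IH(2)[OF enum.prems(1) _ _ _ 1(4) enum.prems(3)] enum.prems(1) by (auto simp: nbr_list_def)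
  obtain tr3 s3 where 3: "iterates guard body s2 tr3 s3" "ntick tr3 \<le> round_cost"
    "outputs tr3 = (if even d then [] else solution_events S)"
    "base s3 \<V>'" "reg s3 1 = d" "reg s3 2 = Suc d mod 2" "below s2 s3 d"
    using round_leave[OF 2(2) S] by metis
  have e3: "emits (pending d (2 * n + 1)) (after_call d) (if even d then [] else [S]) tr3"
  proof (cases "even d")
    case True
    then have "pending d (2 * n + 1) + round_cost \<le> after_call d"
      by (simp add: pending_def after_call_def algebra_simps)
    then show ?thesis using True 3(2,3) pending_max[of "2 * n + 1" d] by (auto intro!: emits_silent)
  next
    case False
    then show ?thesis using 3(2,3) pending_max[of "2 * n + 1" d]
      by (auto simp: after_call_def intro!: emits_solution)
  qed
  have "iterates guard body s (tr1 @ tr2 @ tr3) s3"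
    using iterates_trans[OF 1(1) iterates_trans[OF 2(1) 3(1)]] .
  moreover have "below s s3 d" using 1(5) 2(3) 3(7) below_trans by blast
  moreover have "emits (pending d 0) (after_call d) (if even d then S # out else out @ [S]) (tr1 @ tr2 @ tr3)"
    using emits_append[OF e1 emits_append[OF 2(4) e3]] by (cases "even d") simp_all
  ultimately show ?case using 3(4-6) by blast
next
  case (loop_done d \<V>)
  then have "[p..<2 * n + 1] = []" by (simp del: upt_Suc)
  then have "p = 2 * n + 1" using loop_done.prems(4) by (simp del: upt_Suc)
  moreover have "pending d (2 * n + 1) \<le> max_gap" using pending_max[of "2 * n + 1" d] by linarith
  ultimately show ?case using loop_done
    by (intro exI[of _ "[]"] exI[of _ s]) (auto simp: below_def emits_def intro: iterates.stop)
next
  case (loop_skip S' \<V> d Ss out \<V>')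
  have p: "p \<le> 2 * n" "S' = nbr S p" "Ss = map (nbr S) [Suc p..<2 * n + 1]"
    using remaining_Cons[OF loop_skip.prems(2,4)] by blast+
  have S: "S \<subseteq> verts n" "bipartite E S" using loop_skip.prems(6) by (auto simp: max_bip_def)
  obtain tr1 s1 where 1: "iterates guard body s tr1 s1" "ntick tr1 \<le> round_cost" "outputs tr1 = []"
    "frame s1 d S (Suc p) \<V>" "below s s1 d"
    using round_step[OF loop_skip.prems(5) S loop_skip.prems(7,3) p(1)] loop_skip.hyps p(2) by metis
  have e1: "emits (pending d p) (pending d (Suc p)) [] tr1"
    using pending_Suc[of p d] pending_max[of p d] loop_skip.prems(3) p(1) by (intro emits_silent[OF 1(3,2)]) auto
  obtain tr2 s2 where 2: "iterates guard body s1 tr2 s2" "frame s2 d S (2 * n + 1) \<V>'" "below s1 s2 d"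
    "emits (pending d (Suc p)) (pending d (2 * n + 1)) out tr2"
    using loop_skip.IH(2)[OF loop_skip.prems(1) p(3) _ _ 1(4) loop_skip.prems(6,7)] p(1) by auto
  show ?case
    using iterates_trans[OF 1(1) 2(1)] 2(2) below_trans[OF 1(5) 2(3)] emits_append[OF e1 2(4)] by auto
next
  case (loop_call S' \<V> d out1 \<V>1 Ss out2 \<V>2)
  have p: "p \<le> 2 * n" "S' = nbr S p" "Ss = map (nbr S) [Suc p..<2 * n + 1]"
    using remaining_Cons[OF loop_call.prems(2,4)] by blast+
  have S: "S \<subseteq> verts n" "bipartite E S" using loop_call.prems(6) by (auto simp: max_bip_def)
  obtain tr1 s1 where 1: "iterates guard body s tr1 s1" "ntick tr1 \<le> round_cost" "outputs tr1 = []"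
    "frame s1 (Suc d) S' 0 \<V>" "arr s1 4 (Suc d) = set_encode S" "arr s1 5 (Suc d) = Suc p" "below s s1 d"
    using round_step[OF loop_call.prems(5) S loop_call.prems(7,3) p(1)] loop_call.hyps(1) p(2) by metis
  have e1: "emits (pending d p) (pending (Suc d) 0) [] tr1"
    using pending_call[OF loop_call.prems(3) p(1), of d] pending_max[of p d] p(1)
    by (intro emits_silent[OF 1(3,2)]) auto
  have S': "max_bip n E S'" using nbr_max[OF loop_call.prems(6,3) p(1)] p(2) by simp
  obtain tr2 s2 where 2: "iterates guard body s1 tr2 s2" "base s2 \<V>1" "reg s2 1 = Suc d"
    "reg s2 2 = Suc (Suc d) mod 2" "below s1 s2 (Suc d)" "emits (pending (Suc d) 0) (after_call (Suc d)) out1 tr2"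
    using loop_call.IH(2)[OF loop_call.prems(1) 1(4) S'] by blast
  \<comment> \<open>The callee at depth \<open>Suc d\<close> preserves all entries up to that index,
    among them the entry of the caller with the position \<open>Suc p\<close> stored before the
    call.\<close>
  have f2: "frame s2 d S (Suc p) \<V>1" using 2(2-5) 1(5,6) by (simp add: frame_def below_def)
  have e2: "emits (pending (Suc d) 0) (pending d (Suc p)) out1 tr2"
    using 2(6) after_call_pending[of "Suc p" d] unfolding emits_def by fastforce
  have SV: "S \<in> \<V>1" using enum_loop_sound(1)[OF loop_call.IH(1) loop_call.hyps(1)] loop_call.prems(7) by blast
  obtain tr3 s3 where 3: "iterates guard body s2 tr3 s3" "frame s3 d S (2 * n + 1) \<V>2" "below s2 s3 d"
    "emits (pending d (Suc p)) (pending d (2 * n + 1)) out2 tr3"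
    using loop_call.IH(4)[OF loop_call.prems(1) p(3) _ _ f2 loop_call.prems(6) SV] p(1) by auto
  have "below s1 s2 d" using 2(5) by (simp add: below_def)
  then have "below s s3 d" using 1(7) 3(3) below_trans by blast
  then show ?case
    using iterates_trans[OF 1(1) iterates_trans[OF 2(1) 3(1)]] 3(2) emits_append[OF e1 emits_append[OF e2 3(4)]]
    by auto
qed

lemma algorithm_correct:
  assumes n: "1 \<le> n" and s: "reg s = (\<lambda>_. 0)(0 := n)" "\<forall>a\<ge>2. arr s a = (\<lambda>_. 0)" "arr s 0 = off" "arr s 1 = adj"
  shows "\<exists>S0 out tr t. max_bip n E S0 \<and> alg_outputs nbr_list S0 out \<and> exec algorithm s tr t \<and>
    writes tr out \<and> delay tr \<le> max_gap"
proof -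
  have E: "{} \<subseteq> verts n" "bipartite E {}"
    by (auto simp: bipartite_def bipartition_def edgeless_def)
  let ?S = "completion {}"
  have max: "max_bip n E ?S" by (rule is_comp_max(2)[OF is_comp_completion E])
  then have Sv: "?S \<subseteq> verts n" by (simp add: max_bip_def)
  have n0: "reg s 0 = n" using s by simp
  obtain tr1 s1 where 1: "exec powers s tr1 s1" "ntick tr1 \<le> 50 * (n + 1)" "\<forall>v\<in>verts n. arr s1 2 v = 2 ^ v"
    using wp_powers[OF n0] unfolding wp_def by blast
  have k1: "keeps {4, 5} {2} s s1"
    using exec_frame[OF 1(1)] by (simp add: keeps_def powers_def)
  have z: "arr s1 a = (\<lambda>_. 0)" if "3 \<le> a" for a using k1 s that by (simp add: keeps_def)
  have c1: "clean n (arr s1)" using z by (simp add: clean_def)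
  have r1: "reg s1 0 = n" "arr s1 0 = off" "arr s1 1 = adj" "arr s1 6 = ind {}"
    using k1 s z by (auto simp: keeps_def ind_def)
  obtain tr2 s2 where 2: "exec complete s1 tr2 s2" "ntick tr2 \<le> 3200 * graph_size" "keeps {5..15} {6..12} s1 s2"
    "clean n (arr s2)" "arr s2 6 = ind ?S"
    using wp_complete[OF E r1 c1] unfolding wp_def by blast
  have r2: "reg s2 0 = n" "\<forall>v\<in>verts n. arr s2 2 v = 2 ^ v" using 2(3) r1 1(3) by (auto simp: keeps_def)
  obtain tr3 s3 where 3: "exec encode s2 tr3 s3" "ntick tr3 \<le> 50 * (n + 1)" "keeps {4, 5} {} s2 s3"
    "reg s3 4 = set_encode ?S"
    using wp_encode[OF r2(1) Sv 2(5) r2(2)] unfolding wp_def by blast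
  have a3: "arr s3 = arr s2" using 3(3) by (auto simp: keeps_def fun_eq_iff)
  let ?s4 = "s3\<lparr>arr := (arr s3)(4 := (arr s3 4)(1 := set_encode ?S), 5 := (arr s3 5)(1 := 0)),
    reg := (reg s3)(1 := 1, 2 := 0)\<rparr>"
  have b4: "base ?s4 {}"
  proof -
    have "reg s3 0 = n" using 3(3) r2 by (simp add: keeps_def)
    moreover have "arr s2 0 = off" "arr s2 1 = adj" "arr s2 3 = (\<lambda>_. 0)"
      using 2(3) r1 z by (auto simp: keeps_def)
    moreover have "\<exists>Y\<subseteq>verts n. arr s2 6 = ind Y" using 2(5) Sv by blast
    ultimately show ?thesis using a3 2(4) r2(2) by (simp add: base_def clean_def)
  qed
  have f4: "frame ?s4 0 ?S 0 {}" using b4 by (simp add: frame_def)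
  obtain out where out: "alg_outputs nbr_list ?S out"
    using enumeration_correct(1)[OF simple is_comp_completion is_order_nbr_list max] by blast
  then obtain \<V> where en: "enum nbr_list 0 ?S {} out \<V>" by (auto simp: alg_outputs_def)
  \<comment> \<open>The preparation costs less than one round, while \<open>4 * n + 4\<close> rounds
    are allowed before the first output. The 60 generously covers the sequencing and the first
    push.\<close>
  define k where "k = ntick tr1 + ntick tr2 + ntick tr3 + 60"
  have kp: "k \<le> pending 0 0"
  proof -
    have "k \<le> round_cost * 1" using 1(2) 2(2) 3(2) unfolding k_def by simp
    also have "\<dots> \<le> round_cost * (4 * n + 4)" by (intro mult_le_mono2) simp
    finally show ?thesis by (simp add: pending_def)
  qed
  have pf: "exec push_first s3 (ticks 13) ?s4"
    using 3(4) by (simp add: push_first_def exec_iffs numeral_eq_Suc)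
  let ?pre = "ticks 1 @ tr1 @ ticks 1 @ tr2 @ ticks 1 @ tr3 @ ticks 1 @ ticks 13"
  have pre: "ntick ?pre \<le> k" by (simp add: k_def)
  have silent: "silent powers" "silent complete" "silent encode"
    by (simp_all add: powers_def complete_def extend_def reset_def encode_def program_defs for_verts_def for_nbrs_def)
  have fpre: "outputs ?pre = []"
    using exec_silent[OF 1(1) silent(1)] exec_silent[OF 2(1) silent(2)] exec_silent[OF 3(1) silent(3)]
    by (simp add: filter_replicate)
  have sp: "since 0 ?pre \<le> pending 0 0" using since_le[of 0 ?pre] pre kp by linarith
  obtain tr4 t where 4: "iterates guard body ?s4 tr4 t" "base t \<V>" "reg t 1 = 0"
      "outputs tr4 = concat (map solution_events out)"
      "gaps_below max_gap (since 0 ?pre) tr4" "since (since 0 ?pre) tr4 \<le> after_call 0"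
    using enum_loop_simulation(1)[OF en refl f4 max] sp unfolding emits_def by blast
  have "exec (While guard body) ?s4 (tr4 @ ticks (1 + bcost guard)) t"
    by (rule iterates_exit[OF 4(1)]) (use 4(3) in \<open>simp add: guard_def\<close>)
  note ex = exec.Seq[OF 1(1) exec.Seq[OF 2(1) exec.Seq[OF 3(1) exec.Seq[OF pf this]]]]
  let ?tr = "?pre @ tr4 @ ticks (1 + bcost guard)"
  have "exec algorithm s ?tr t" using ex by (simp add: algorithm_def)
  moreover have "outputs ?tr = concat (map solution_events out)"
    using fpre 4(4) by (simp add: filter_replicate)
  then have "writes ?tr out" unfolding writes_def solution_events_def[abs_def] .
  moreover have "delay ?tr \<le> max_gap"
  proof (rule delay_le)
    let ?k = "since (since 0 ?pre) tr4"
    \<comment> \<open>After the root call has returned, only the failing test of the guard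
      remains.\<close>
    have e: "?k + ntick (ticks (1 + bcost guard)) \<le> max_gap"
    proof -
      have "?k \<le> round_cost * (2 * n + 2)" using 4(6) by (simp add: after_call_def)
      moreover have "ntick (ticks (1 + bcost guard)) \<le> round_cost * 1" by (simp add: guard_def)
      ultimately have "?k + ntick (ticks (1 + bcost guard)) \<le> round_cost * (2 * n + 2) + round_cost * 1"
        by linarith
      also have "\<dots> = round_cost * (2 * n + 3)" by (simp add: algebra_simps)
      also have "\<dots> \<le> max_gap" by (intro mult_le_mono2) simp
      finally show ?thesis .
    qed
    show "since 0 ?tr \<le> max_gap"
      using since_le[of ?k "ticks (1 + bcost guard)"] e unfolding since_append by linarith
    have "gaps_below max_gap 0 ?pre"
      using pre kp pending_max[of 0 0] by (intro gaps_below_ntick) linarith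
    then show "gaps_below max_gap 0 ?tr"
      unfolding gaps_below_append using 4(5) gaps_below_ntick[OF e] by (simp only: since_append simp_thms)
  qed
  ultimately show ?thesis using max out by blast
qed

end

section \<open>The inverse Ackermann function and the final bound\<close>

lemma ack_gt: "k < ack i k"
proof (induction i k rule: ack.induct)
  case (3 i k)
  then show ?case unfolding ack.simps by linarith
qed auto

text \<open>The witness \<open>Suc n\<close> shows that the minimum is attained. The final bound
  uses this as \<open>n \<le> n * inv_ack n\<close>.\<close>

lemma inv_ack_pos: "1 \<le> inv_ack n"
proof -
  have "1 \<le> Suc n \<and> n \<le> ack (Suc n) (Suc n)" using ack_gt[of "Suc n" "Suc n"] by simp
  then show ?thesis unfolding inv_ack_def by (rule LeastI2) simp
qed

lemma encodes_graph_input: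
  assumes "simple_graph n E" "encodes s n E"
  shows "graph_input n E (arr s 0) (arr s 1)"
  using assms by unfold_locales (auto simp: encodes_def)

theorem theorem5p7:
  "(\<forall>n E cmp ord S0.
      simple_graph n E \<and> is_comp n E cmp \<and> is_order n E cmp ord \<and> max_bip n E S0 \<longrightarrow>
      (\<exists>out. alg_outputs ord S0 out) \<and>
      (\<forall>out. alg_outputs ord S0 out \<longrightarrow> distinct out \<and> set out = {B. max_bip n E B})) \<and>
   (\<exists>prog C. \<forall>n E s.
      1 \<le> n \<and> simple_graph n E \<and> encodes s n E \<longrightarrow>
      (\<exists>cmp ord S0 out tr t.
         is_comp n E cmp \<and> is_order n E cmp ord \<and> max_bip n E S0 \<and>
         alg_outputs ord S0 out \<and>
         exec prog s tr t \<and> writes tr out \<and>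
         delay tr \<le> C * (n * (card E + n * inv_ack n))))"
proof (intro conjI)
  show "\<forall>n E cmp ord S0.
      simple_graph n E \<and> is_comp n E cmp \<and> is_order n E cmp ord \<and> max_bip n E S0 \<longrightarrow>
      (\<exists>out. alg_outputs ord S0 out) \<and>
      (\<forall>out. alg_outputs ord S0 out \<longrightarrow> distinct out \<and> set out = {B. max_bip n E B})"
    using enumeration_correct by blast
  show "\<exists>prog C. \<forall>n E s.
      1 \<le> n \<and> simple_graph n E \<and> encodes s n E \<longrightarrow>
      (\<exists>cmp ord S0 out tr t.
         is_comp n E cmp \<and> is_order n E cmp ord \<and> max_bip n E S0 \<and>
         alg_outputs ord S0 out \<and>
         exec prog s tr t \<and> writes tr out \<and>
         delay tr \<le> C * (n * (card E + n * inv_ack n)))"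
  \<comment> \<open>\<open>90000 = 5000 * 2 * 9\<close>: a round costs
    \<open>5000 * graph_size\<close>, \<open>graph_size \<le> 2 * (card E + n * inv_ack n)\<close>,
    and \<open>4 * n + 5 \<le> 9 * n\<close> as \<open>1 \<le> n\<close>.\<close>
  proof (rule exI[of _ algorithm], rule exI[of _ 90000], intro allI impI, elim conjE)
    fix n E s
    assume n: "1 \<le> n" and sg: "simple_graph n E" and s: "encodes s n E"
    interpret graph_input n E "arr s 0" "arr s 1" by (rule encodes_graph_input[OF sg s])
    obtain S0 out tr t where r: "max_bip n E S0" "alg_outputs nbr_list S0 out" "exec algorithm s tr t"
      "writes tr out" "delay tr \<le> max_gap"
      using algorithm_correct[OF n, of s] s unfolding encodes_def by blast
    have "n * 1 \<le> n * inv_ack n" by (rule mult_le_mono2[OF inv_ack_pos])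
    moreover have "graph_size \<le> 2 * (card E + x)" if "n \<le> x" for x using n that by simp
    ultimately have "graph_size \<le> 2 * (card E + n * inv_ack n)" by simp
    then have "max_gap \<le> (5000 * (2 * (card E + n * inv_ack n))) * (9 * n)"
      using n by (intro mult_le_mono) auto
    also have "\<dots> = 90000 * (n * (card E + n * inv_ack n))" by (simp add: algebra_simps)
    finally have "delay tr \<le> 90000 * (n * (card E + n * inv_ack n))" using r(5) by linarith
    then show "\<exists>cmp ord S0 out tr t.
         is_comp n E cmp \<and> is_order n E cmp ord \<and> max_bip n E S0 \<and>
         alg_outputs ord S0 out \<and>
         exec algorithm s tr t \<and> writes tr out \<and>
         delay tr \<le> 90000 * (n * (card E + n * inv_ack n))"
      using r(1-4) is_comp_completion is_order_nbr_list by blast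
  qed
qed

end
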